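(* Let $(\mathbb{R}^d,\cdot,X,K)$ be a sub-Finsler nilpotent group. Let $F\subseteq\mathbb{R}^d$ be a set of finite perimeter and finite volume, and suppose that there exists a point $p$ in the interior of $F$. Then there exist $C_3>0$, $\lambda_0>0$, $\lambda_1>0$ and a family of finite perimeter sets $\{F^\lambda\}_{-\lambda_0<\lambda<\lambda_1}$ such that, for all $-\lambda_0<\lambda<\lambda_1$, $|F^\lambda|=|F|+\lambda$ and $$P_K(F^\lambda)-P_K(F)\le C_3|\lambda|.$$ Moreover, if $F$ is bounded then one can take $\lambda_1=+\infty$.
   Context: Setting. A nilpotent group is a connected, simply connected Lie group $G$ whose Lie algebra $\mathfrak{g}$ is nilpotent. With $\mathfrak{g}_0=\mathfrak{g}$, $\mathfrak{g}_{i+1}=[\mathfrak{g},\mathfrak{g}_i]$ and $r$ the step ($\mathfrak{g}_r=0\ne\mathfrak{g}_{r-1}$), fix a Malcev basis $\{Y_1,\dots,Y_d\}$ of $\mathfrak{g}$, i.e. a basis such that each $\mathrm{span}\{Y_{d-n+1},\dots,Y_d\}$, $1\le n\le d$, is an ideal and each $\mathfrak{g}_i$, $0\le i\le r-1$, is one of these ideals. Identify $G$ with $(\mathbb{R}^d,\cdot)$ via $(x_1,\dots,x_d)\mapsto\exp(x_1Y_1+\dots+x_dY_d)$; the identity is $0$. The Lebesgue measure $|\cdot|$ of $\mathbb{R}^d$ (the volume) is then a Haar measure of the group. $X=\{X_1,\dots,X_k\}$ is a system of linearly independent left-invariant vector fields. Put $\mathcal{H}^0=\mathrm{span}(X)$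 and $\mathcal{H}^n=\mathcal{H}^{n-1}+[\mathcal{H}^{n-1},\mathcal{H}^0]$; $X$ is assumed to be Lie bracket generating, i.e. $\mathcal{H}^s(0)=\mathfrak{g}$ for some $s$. Vector fields tangent to $\mathcal{H}^0$ at every point are called horizontal. Fix a left-invariant Riemannian metric $g=\langle\cdot,\cdot\rangle$ for which $X$ is an orthonormal basis of $\mathcal{H}^0$ and $\mathcal{H}^0$ is orthogonal to a chosen complementary subbundle $V$; $\operatorname{div}$ is the divergence with respect to $g$. $K\subset\mathcal{H}^0_0$ is a convex body (compact convex set) with $0$ in its interior (relative to $\mathcal{H}^0_0$), not necessarily symmetric. It defines the asymmetric norm $\|u\|_K=\inf\{\lambda\ge0:u\in\lambda K\}$ on $\mathcal{H}^0_0$, extended to $\mathcal{H}^0$ by left-invariance: $\|\sum_i a_iX_i(p)\|_K=\|\sum_i a_iX_i(0)\|_K$. The data $(\mathbb{R}^d,\cdot,X,K)$ is called a sub-Finsler nilpotent group. Perimeter. For a measurable set $E\subseteq\mathbb{R}^d$, $P_K(E)=\sup\{\int_E\operatorname{div}(U)\,dx\}$, the supremum being over compactly supported $C^1$ horizontal vector fields $U$ on $\mathbb{R}^d$ with $\sup_p\|U_p\|_K\le1$. $E$ is a finite perimeter set if $P_K(E)<+\infty$. *)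

theory Defs
  imports "HOL-Analysis.Analysis"
begin

section \<open>Smooth maps and vector fields on Euclidean space\<close>

primrec C_k :: "nat \<Rightarrow> ('a::euclidean_space \<Rightarrow> 'b::real_normed_vector) \<Rightarrow> bool" where
  "C_k 0 f \<longleftrightarrow> continuous_on UNIV f"
| "C_k (Suc n) f \<longleftrightarrow>
     (\<forall>x. f differentiable (at x)) \<and> (\<forall>v. C_k n (\<lambda>x. frechet_derivative f (at x) v))"

definition smooth :: "('a::euclidean_space \<Rightarrow> 'b::real_normed_vector) \<Rightarrow> bool" where
  "smooth f \<longleftrightarrow> (\<forall>n. C_k n f)"

definition vf_bracket :: "('a \<Rightarrow> 'a) \<Rightarrow> ('a \<Rightarrow> 'a) \<Rightarrow> 'a \<Rightarrow> 'a::euclidean_space" where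
  "vf_bracket U W p = frechet_derivative W (at p) (U p) - frechet_derivative U (at p) (W p)"

section \<open>Nilpotent groups in exponential coordinates\<close>

definition left_diff :: "('a \<Rightarrow> 'a \<Rightarrow> 'a) \<Rightarrow> 'a \<Rightarrow> 'a \<Rightarrow> 'a \<Rightarrow> 'a::euclidean_space" where
  "left_diff mul p q = frechet_derivative (mul p) (at q)"

definition left_invariant :: "('a \<Rightarrow> 'a \<Rightarrow> 'a) \<Rightarrow> ('a \<Rightarrow> 'a::euclidean_space) \<Rightarrow> bool" where
  "left_invariant mul W \<longleftrightarrow> (\<forall>p q. W (mul p q) = left_diff mul p q (W q))"

definition left_inv_field :: "('a \<Rightarrow> 'a \<Rightarrow> 'a) \<Rightarrow> 'a \<Rightarrow> 'a \<Rightarrow> 'a::euclidean_space" where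
  "left_inv_field mul u p = left_diff mul p 0 u"

text \<open>The Lie algebra of the group is the tangent space at the identity \<open>0\<close>: a vector \<open>u\<close>
  stands for the left-invariant field with value \<open>u\<close> at \<open>0\<close>.\<close>

definition lie_bracket :: "('a \<Rightarrow> 'a \<Rightarrow> 'a) \<Rightarrow> 'a \<Rightarrow> 'a \<Rightarrow> 'a::euclidean_space" where
  "lie_bracket mul u v = vf_bracket (left_inv_field mul u) (left_inv_field mul v) 0"

definition bracket_space :: "('a \<Rightarrow> 'a \<Rightarrow> 'a) \<Rightarrow> 'a set \<Rightarrow> 'a set \<Rightarrow> 'a::euclidean_space set" where
  "bracket_space mul A B = span {lie_bracket mul u v | u v. u \<in> A \<and> v \<in> B}"

primrec lower_central :: "('a \<Rightarrow> 'a \<Rightarrow> 'a) \<Rightarrow> nat \<Rightarrow> 'a::euclidean_space set" where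
  "lower_central mul 0 = UNIV"
| "lower_central mul (Suc i) = bracket_space mul UNIV (lower_central mul i)"

definition lie_ideal :: "('a \<Rightarrow> 'a \<Rightarrow> 'a) \<Rightarrow> 'a::euclidean_space set \<Rightarrow> bool" where
  "lie_ideal mul I \<longleftrightarrow> subspace I \<and> (\<forall>u. \<forall>v\<in>I. lie_bracket mul u v \<in> I)"

text \<open>The spans of the last \<open>n\<close> vectors (\<open>1 \<le> n \<le> d\<close>) of the standard basis; the linear order
  of the index type \<open>'d\<close> enumerates the basis.\<close>

definition tail_span :: "'d::{finite,linorder} \<Rightarrow> (real, 'd) vec set" where
  "tail_span j = span {axis i 1 | i. j \<le> i}"

text \<open>
  In the coordinates \<open>x \<mapsto> exp (x\<^sub>1 Y\<^sub>1 + \<dots> + x\<^sub>d Y\<^sub>d)\<close> the identity is \<open>0\<close>, the lines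
  \<open>t \<mapsto> t x\<close> are the one-parameter subgroups (so the inverse of \<open>x\<close> is \<open>- x\<close>), and the Malcev
  basis vector \<open>Y\<^sub>i\<close>, as a tangent vector at \<open>0\<close>, is the standard basis vector \<open>axis i 1\<close>.
  The underlying manifold is a vector space, hence connected and simply connected.
\<close>

locale nilpotent_group =
  fixes mul :: "(real, 'd::{finite,linorder}) vec \<Rightarrow> (real, 'd) vec \<Rightarrow> (real, 'd) vec"
    and r :: nat
  assumes group: "group mul 0 uminus"
    and smooth_mul: "smooth (\<lambda>z. mul (fst z) (snd z))"
    and one_parameter: "mul (s *\<^sub>R x) (t *\<^sub>R x) = (s + t) *\<^sub>R x"
    and step: "0 < r" "lower_central mul r = {0}" "lower_central mul (r - 1) \<noteq> {0}"
    and malcev_ideal: "lie_ideal mul (tail_span j)"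
    and malcev_central: "i < r \<Longrightarrow> \<exists>j. lower_central mul i = tail_span j"

section \<open>Sub-Finsler structures\<close>

definition horizontal :: "nat \<Rightarrow> (nat \<Rightarrow> 'a \<Rightarrow> 'a) \<Rightarrow> 'a \<Rightarrow> 'a::euclidean_space set" where
  "horizontal k X p = span {X i p | i. i \<in> {1..k}}"

primrec horizontal_filtration ::
  "('a \<Rightarrow> 'a \<Rightarrow> 'a) \<Rightarrow> nat \<Rightarrow> (nat \<Rightarrow> 'a \<Rightarrow> 'a) \<Rightarrow> nat \<Rightarrow> 'a::euclidean_space set" where
  "horizontal_filtration mul k X 0 = horizontal k X 0"
| "horizontal_filtration mul k X (Suc n) =
     {u + v | u v. u \<in> horizontal_filtration mul k X n \<and>
                   v \<in> bracket_space mul (horizontal_filtration mul k X n) (horizontal k X 0)}"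

definition inner_product :: "('a::euclidean_space \<Rightarrow> 'a \<Rightarrow> real) \<Rightarrow> bool" where
  "inner_product b \<longleftrightarrow>
     bilinear b \<and> (\<forall>u v. b u v = b v u) \<and> (\<forall>u. u \<noteq> 0 \<longrightarrow> 0 < b u u)"

text \<open>The metric \<open>g\<close> takes a base point and two tangent vectors. Its smoothness follows from
  left-invariance.\<close>

locale sub_finsler_nilpotent_group = nilpotent_group mul r
  for mul :: "(real, 'd::{finite,linorder}) vec \<Rightarrow> (real, 'd) vec \<Rightarrow> (real, 'd) vec" and r :: nat +
  fixes k :: nat
    and X :: "nat \<Rightarrow> (real, 'd) vec \<Rightarrow> (real, 'd) vec"
    and V :: "(real, 'd) vec \<Rightarrow> (real, 'd) vec set"
    and g :: "(real, 'd) vec \<Rightarrow> (real, 'd) vec \<Rightarrow> (real, 'd) vec \<Rightarrow> real"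
    and K :: "(real, 'd) vec set"
  assumes X_left_invariant: "i \<in> {1..k} \<Longrightarrow> left_invariant mul (X i)"
    and X_independent: "(\<And>p. (\<Sum>i=1..k. c i *\<^sub>R X i p) = 0) \<Longrightarrow> i \<in> {1..k} \<Longrightarrow> c i = 0"
    and bracket_generating: "\<exists>s. horizontal_filtration mul k X s = UNIV"
    and V_subspace: "subspace (V p)"
    and V_complement: "horizontal k X p \<inter> V p = {0}"
      "{u + v | u v. u \<in> horizontal k X p \<and> v \<in> V p} = UNIV"
    and g_inner_product: "inner_product (g p)"
    and g_left_invariant: "g (mul p q) (left_diff mul p q u) (left_diff mul p q v) = g q u v"
    and g_orthonormal: "i \<in> {1..k} \<Longrightarrow> j \<in> {1..k} \<Longrightarrow> g p (X i p) (X j p) = (if i = j then 1 else 0)"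
    and g_orthogonal: "u \<in> horizontal k X p \<Longrightarrow> v \<in> V p \<Longrightarrow> g p u v = 0"
    and K_horizontal: "K \<subseteq> horizontal k X 0"
    and K_convex_body: "compact K" "convex K"
    and K_interior: "0 \<in> top_of_set (horizontal k X 0) interior_of K"

definition gauge_norm :: "'a::euclidean_space set \<Rightarrow> 'a \<Rightarrow> real" where
  "gauge_norm K u = Inf {l. 0 \<le> l \<and> u \<in> (\<lambda>x. l *\<^sub>R x) ` K}"

text \<open>For \<open>u = (\<Sum>i. a i *\<^sub>R X i p)\<close> the transported vector is \<open>\<Sum>i. a i *\<^sub>R X i 0\<close>; the
  coefficients are unique because left-invariant fields that are linearly independent are so at
  every point.\<close>

definition to_origin :: "nat \<Rightarrow> (nat \<Rightarrow> 'a \<Rightarrow> 'a) \<Rightarrow> 'a \<Rightarrow> 'a \<Rightarrow> 'a::euclidean_space" where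
  "to_origin k X p u =
     (THE w. \<exists>a. u = (\<Sum>i=1..k. a i *\<^sub>R X i p) \<and> w = (\<Sum>i=1..k. a i *\<^sub>R X i 0))"

definition K_norm ::
  "nat \<Rightarrow> (nat \<Rightarrow> 'a \<Rightarrow> 'a) \<Rightarrow> 'a set \<Rightarrow> 'a \<Rightarrow> 'a::euclidean_space \<Rightarrow> real" where
  "K_norm k X K p u = gauge_norm K (to_origin k X p u)"

section \<open>Divergence and perimeter\<close>

definition volume_density :: "(real^'d \<Rightarrow> real^'d \<Rightarrow> real^'d \<Rightarrow> real) \<Rightarrow> real^'d::finite \<Rightarrow> real" where
  "volume_density g p = sqrt (det (\<chi> i j. g p (axis i 1) (axis j 1)))"

definition riem_div ::
  "(real^'d \<Rightarrow> real^'d \<Rightarrow> real^'d \<Rightarrow> real) \<Rightarrow> (real^'d \<Rightarrow> real^'d) \<Rightarrow> real^'d::finite \<Rightarrow> real" where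
  "riem_div g U p =
     (\<Sum>i\<in>UNIV. frechet_derivative (\<lambda>q. volume_density g q * U q $ i) (at p) (axis i 1))
       / volume_density g p"

definition admissible_fields ::
  "nat \<Rightarrow> (nat \<Rightarrow> 'a \<Rightarrow> 'a) \<Rightarrow> 'a set \<Rightarrow> ('a::euclidean_space \<Rightarrow> 'a) set" where
  "admissible_fields k X K =
     {U. C_k 1 U \<and> compact (closure {p. U p \<noteq> 0}) \<and>
         (\<forall>p. U p \<in> horizontal k X p) \<and> (\<forall>p. K_norm k X K p (U p) \<le> 1)}"

definition perimeter ::
  "nat \<Rightarrow> (nat \<Rightarrow> real^'d \<Rightarrow> real^'d) \<Rightarrow> (real^'d \<Rightarrow> real^'d \<Rightarrow> real^'d \<Rightarrow> real) \<Rightarrow> (real^'d) set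
     \<Rightarrow> (real^'d::finite) set \<Rightarrow> ereal" where
  "perimeter k X g K E =
     (SUP U \<in> admissible_fields k X K. ereal (set_lebesgue_integral lebesgue E (riem_div g U)))"

definition finite_perimeter ::
  "nat \<Rightarrow> (nat \<Rightarrow> real^'d \<Rightarrow> real^'d) \<Rightarrow> (real^'d \<Rightarrow> real^'d \<Rightarrow> real^'d \<Rightarrow> real) \<Rightarrow> (real^'d) set
     \<Rightarrow> (real^'d::finite) set \<Rightarrow> bool" where
  "finite_perimeter k X g K E \<longleftrightarrow> E \<in> sets lebesgue \<and> perimeter k X g K E < \<infinity>"

end

theory Submission
  imports Defs
begin

text \<open>
  The volume of \<open>F\<close> is changed by adding to \<open>F\<close>, or removing from \<open>F\<close>, a left translate \<open>x \<Omega>\<close> of one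
  fixed small set \<open>\<Omega>\<close>.  For this to cost only a constant times the volume gained, \<open>\<Omega>\<close> must be
  \<^emph>\<open>inward minimizing\<close>: \<open>P(\<Omega>) \<le> P(Z) + C |\<Omega> - Z|\<close> for all \<open>Z \<subseteq> \<Omega>\<close>.  Then submodularity of the
  perimeter, \<open>P(F \<union> \<Omega>) + P(F \<inter> \<Omega>) \<le> P(F) + P(\<Omega>)\<close>, gives with \<open>Z = F \<inter> \<Omega>\<close> that
  \<open>P(F \<union> \<Omega>) \<le> P(F) + C |\<Omega> - F|\<close>.  If \<open>\<Omega>\<close> is inward minimizing for the reflected body \<open>- K\<close>, then in
  the same way \<open>P(F - \<Omega>) \<le> P(F) + C |\<Omega> \<inter> F|\<close>, since the perimeter of a complement is the perimeter for
  \<open>- K\<close>.  Perimeter and volume are invariant under left translations, so these estimates hold for all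
  translates \<open>x \<Omega>\<close> with the same \<open>C\<close>.

  An inward minimizing \<open>\<Omega>\<close> is a minimizer of \<open>P(Z) - C |Z|\<close> among the subsets \<open>Z\<close> of a small ball
  around the interior point of \<open>F\<close>.  Balls have finite perimeter, so for large \<open>C\<close> the minimum is
  negative and \<open>\<Omega>\<close> has positive volume.  Submodularity and lower semicontinuity produce the minimizer as
  the lower limit of a fast minimizing sequence (\<open>inward_minimizing_subset_exists\<close>).

  The volume \<open>|x \<Omega> \<inter> F|\<close> depends continuously on \<open>x\<close>.  It equals \<open>|\<Omega>|\<close> at the identity, since \<open>\<Omega>\<close> lies in \<open>F\<close>,
  and becomes arbitrarily small far away, since \<open>F\<close> has finite volume; by connectedness it takes all
  values in between.  This realizes every small change of volume.  For bounded \<open>F\<close> a whole disjoint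
  copy of \<open>\<Omega>\<close> can be added, and this can be repeated, which realizes every increase.

  Three facts carry the analysis.  Firstly, Lebesgue measure is left-invariant in these coordinates
  and the Riemannian volume density is constant, so the divergence is the Euclidean one: in Malcev
  coordinates the differential of a left translation is lower triangular with unit diagonal
  (\<open>unit_lower_triangular_dL\<close>).  This follows from the differential equation of the exponential map,
  because brackets with a fixed vector are strictly lower triangular.  Secondly, the divergence commutes
  with left translation of fields (\<open>divergence_translate_field\<close>).  Thirdly, submodularity holds for smooth
  functions by mixing two test fields with a smooth weight (\<open>smooth_submodular\<close>), and passes to sets by
  averaging over small left translations, which keeps the perimeter bound.
\<close>

section \<open>Continuously differentiable maps\<close>

definition has_C1_derivative ::
  "('a::real_normed_vector \<Rightarrow> 'b::real_normed_vector) \<Rightarrow> ('a \<Rightarrow> 'a \<Rightarrow>\<^sub>L 'b) \<Rightarrow> bool" where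
  "has_C1_derivative f f' \<longleftrightarrow>
     (\<forall>x. (f has_derivative blinfun_apply (f' x)) (at x)) \<and> continuous_on UNIV f'"

lemma has_C1_derivativeD:
  assumes "has_C1_derivative f f'"
  shows "(f has_derivative blinfun_apply (f' x)) (at x within S)" "continuous_on S f'"
    "continuous_on S f" "isCont f x" "frechet_derivative f (at x) = blinfun_apply (f' x)"
proof -
  have d: "(f has_derivative blinfun_apply (f' x)) (at x)" for x
    using assms by (auto simp: has_C1_derivative_def)
  show "(f has_derivative blinfun_apply (f' x)) (at x within S)"
    using d has_derivative_at_withinI by blast
  show "continuous_on S f'"
    using assms by (auto simp: has_C1_derivative_def intro: continuous_on_subset)
  show "isCont f x" using d has_derivative_continuous by blast
  show "continuous_on S f"
    using d by (meson continuous_at_imp_continuous_on has_derivative_continuous)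
  show "frechet_derivative f (at x) = blinfun_apply (f' x)"
    using d frechet_derivative_at by metis
qed

lemma has_C1_derivative_chain:
  assumes "has_C1_derivative g g'" "has_C1_derivative f f'"
  shows "has_C1_derivative (\<lambda>x. f (g x)) (\<lambda>x. f' (g x) o\<^sub>L g' x)"
proof -
  have "((\<lambda>x. f (g x)) has_derivative (\<lambda>v. f' (g x) (g' x v))) (at x)" for x
    using has_derivative_compose[OF has_C1_derivativeD(1)[OF assms(1), of x UNIV]
      has_C1_derivativeD(1)[OF assms(2)]] by simp
  moreover have "continuous_on UNIV (\<lambda>x. f' (g x) o\<^sub>L g' x)"
    by (intro continuous_intros has_C1_derivativeD(2)[OF assms(1)]
       continuous_on_compose2[OF has_C1_derivativeD(2)[OF assms(2), of UNIV]
          has_C1_derivativeD(3)[OF assms(1)]]) auto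
  moreover have "blinfun_apply (f' (g x) o\<^sub>L g' x) = (\<lambda>v. f' (g x) (g' x v))" for x
    by (rule ext) simp
  ultimately show ?thesis unfolding has_C1_derivative_def by metis
qed

lemma has_C1_derivative_bounded_linear:
  assumes "bounded_linear f"
  shows "has_C1_derivative f (\<lambda>_. Blinfun f)"
  using assms by (auto simp: has_C1_derivative_def bounded_linear_Blinfun_apply
      bounded_linear_imp_has_derivative)

lemma has_C1_derivative_const: "has_C1_derivative (\<lambda>_. c) (\<lambda>_. 0)"
  by (auto simp: has_C1_derivative_def zero_blinfun.rep_eq)

lemma has_C1_derivative_add:
  assumes "has_C1_derivative f f'" "has_C1_derivative g g'"
  shows "has_C1_derivative (\<lambda>x. f x + g x) (\<lambda>x. f' x + g' x)"
  using assms by (auto simp: has_C1_derivative_def blinfun.add_left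
      intro!: continuous_intros derivative_eq_intros)

lemma has_C1_derivative_diff:
  assumes "has_C1_derivative f f'" "has_C1_derivative g g'"
  shows "has_C1_derivative (\<lambda>x. f x - g x) (\<lambda>x. f' x - g' x)"
  using assms by (auto simp: has_C1_derivative_def blinfun.diff_left
      intro!: continuous_intros derivative_eq_intros)

lemma has_C1_derivative_minus:
  assumes "has_C1_derivative f f'"
  shows "has_C1_derivative (\<lambda>x. - f x) (\<lambda>x. - f' x)"
  using assms by (auto simp: has_C1_derivative_def blinfun.minus_left
      intro!: continuous_intros derivative_eq_intros)

lemma has_C1_derivative_scaleR:
  assumes "has_C1_derivative a a'" "has_C1_derivative f f'"
  shows "has_C1_derivative (\<lambda>x. a x *\<^sub>R f x)
    (\<lambda>x. a x *\<^sub>R f' x + (blinfun_scaleR_left (f x) o\<^sub>L a' x))"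
  unfolding has_C1_derivative_def
proof (intro conjI allI)
  show "((\<lambda>x. a x *\<^sub>R f x) has_derivative
     (a x *\<^sub>R f' x + (blinfun_scaleR_left (f x) o\<^sub>L a' x))) (at x)" for x
    by (rule derivative_eq_intros has_C1_derivativeD(1)[OF assms(1)] has_C1_derivativeD(1)[OF assms(2)])+
       (auto simp: blinfun.add_left blinfun.scaleR_left)
  show "continuous_on UNIV (\<lambda>x. a x *\<^sub>R f' x + (blinfun_scaleR_left (f x) o\<^sub>L a' x))"
    by (intro continuous_intros has_C1_derivativeD(2,3)[OF assms(1)] has_C1_derivativeD(2)[OF assms(2)]
         bounded_linear.continuous_on[OF bounded_linear_blinfun_scaleR_left]
         has_C1_derivativeD(3)[OF assms(2)])
qed

lemma has_C1_derivative_inner_const: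
  assumes "has_C1_derivative f f'"
  shows "\<exists>g'. has_C1_derivative (\<lambda>x. f x \<bullet> b) g' \<and> (\<forall>x v. g' x v = f' x v \<bullet> b)"
proof -
  have "has_C1_derivative (\<lambda>x. f x \<bullet> b) (\<lambda>x. Blinfun (\<lambda>v. v \<bullet> b) o\<^sub>L f' x)"
    using has_C1_derivative_chain[OF assms has_C1_derivative_bounded_linear[OF bounded_linear_inner_left[of b]]] .
  thus ?thesis
    by (intro exI[of _ "\<lambda>x. Blinfun (\<lambda>v. v \<bullet> b) o\<^sub>L f' x"])
       (auto simp: bounded_linear_Blinfun_apply bounded_linear_inner_left)
qed

lemma blinfun_expand:
  fixes A :: "'a::euclidean_space \<Rightarrow>\<^sub>L 'b::real_normed_vector"
  shows "A = (\<Sum>b\<in>Basis. blinfun_scaleR_left (A b) o\<^sub>L blinfun_inner_left b)"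
proof (rule blinfun_eqI)
  fix v
  have "A v = A (\<Sum>b\<in>Basis. (v \<bullet> b) *\<^sub>R b)" by (simp add: euclidean_representation)
  thus "A v = (\<Sum>b\<in>Basis. blinfun_scaleR_left (A b) o\<^sub>L blinfun_inner_left b) v"
    by (simp add: blinfun.sum_right blinfun.scaleR_right blinfun.sum_left inner_commute)
qed

text \<open>In finite dimension it suffices to differentiate a field of linear maps on a basis.\<close>

lemma has_C1_derivative_blinfun:
  fixes f :: "'c::real_normed_vector \<Rightarrow> 'a::euclidean_space \<Rightarrow>\<^sub>L 'b::real_normed_vector"
  assumes "\<And>b. b \<in> Basis \<Longrightarrow> \<exists>g. has_C1_derivative (\<lambda>x. f x b) g"
  shows "\<exists>f'. has_C1_derivative f f'"
proof -
  obtain g where g: "\<And>b. b \<in> Basis \<Longrightarrow> has_C1_derivative (\<lambda>x. f x b) (g b)"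
    using assms by metis
  have "\<exists>s. has_C1_derivative (\<lambda>x. \<Sum>b\<in>B. blinfun_scaleR_left (f x b) o\<^sub>L blinfun_inner_left b) s"
    if "finite B" "B \<subseteq> Basis" for B
    using that
  proof (induction B rule: finite_induct)
    case empty
    show ?case
      using has_C1_derivative_const[where c = "0 :: 'a \<Rightarrow>\<^sub>L 'b" and ?'a = 'c] by auto
  next
    case (insert b B)
    then obtain s where s: "has_C1_derivative (\<lambda>x. \<Sum>b\<in>B. blinfun_scaleR_left (f x b) o\<^sub>L blinfun_inner_left b) s"
      by auto
    have "bounded_linear (\<lambda>w::'b. blinfun_scaleR_left w o\<^sub>L blinfun_inner_left b)"
      by (intro bounded_linear_compose[OF bounded_bilinear.bounded_linear_left[OF
            bounded_bilinear_blinfun_compose]] bounded_linear_blinfun_scaleR_left)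
    from has_C1_derivative_chain[OF g has_C1_derivative_bounded_linear[OF this]] insert.prems
    obtain t where "has_C1_derivative (\<lambda>x. blinfun_scaleR_left (f x b) o\<^sub>L blinfun_inner_left b) t" by auto
    from has_C1_derivative_add[OF this s] show ?case using insert by auto
  qed
  from this[OF finite_Basis order_refl] show ?thesis
    by (subst (asm) blinfun_expand[symmetric]) 
qed

lemma C_k_1_iff:
  fixes f :: "'a::euclidean_space \<Rightarrow> 'b::real_normed_vector"
  shows "C_k 1 f \<longleftrightarrow> (\<exists>f'. has_C1_derivative f f')"
proof
  assume "C_k 1 f"
  hence d: "\<And>x. f differentiable (at x)"
    and c: "\<And>v. continuous_on UNIV (\<lambda>x. frechet_derivative f (at x) v)" by auto
  define f' where "f' x = Blinfun (frechet_derivative f (at x))" for x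
  have f': "blinfun_apply (f' x) = frechet_derivative f (at x)" for x
    unfolding f'_def by (intro bounded_linear_Blinfun_apply has_derivative_bounded_linear)
      (use d frechet_derivative_works in blast)
  have "continuous_on UNIV f'"
    by (rule continuous_on_blinfun_componentwise) (simp add: f' c)
  thus "\<exists>f'. has_C1_derivative f f'"
    using d frechet_derivative_works[of f] by (auto simp: has_C1_derivative_def f' intro!: exI[of _ f'])
next
  assume "\<exists>f'. has_C1_derivative f f'"
  then obtain f' where f': "has_C1_derivative f f'" by auto
  have "continuous_on UNIV (\<lambda>x. f' x v)" for v
    by (intro continuous_intros has_C1_derivativeD[OF f'])
  thus "C_k 1 f"
    using has_C1_derivativeD(1)[OF f', of _ UNIV] has_C1_derivativeD(5)[OF f']
    by (auto simp: differentiable_def)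
qed

lemma C_k_2_imp:
  fixes f :: "'a::euclidean_space \<Rightarrow> 'b::real_normed_vector"
  assumes "C_k 2 f"
  shows "\<exists>f' f''. has_C1_derivative f f' \<and> has_C1_derivative f' f''"
proof -
  have 2: "\<And>x. f differentiable (at x)" "\<And>v. C_k 1 (\<lambda>x. frechet_derivative f (at x) v)"
    using assms by (simp_all add: numeral_2_eq_2)
  have "C_k 1 f"
    using 2(1) 2(2)[unfolded C_k_1_iff] has_C1_derivativeD(3) by fastforce
  then obtain f' where f': "has_C1_derivative f f'" unfolding C_k_1_iff by blast
  have "\<exists>g. has_C1_derivative (\<lambda>x. f' x v) g" for v
    using 2(2)[of v] unfolding C_k_1_iff has_C1_derivativeD(5)[OF f'] .
  with has_C1_derivative_blinfun[of f'] f' show ?thesis by blast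
qed

text \<open>The second difference of \<open>f\<close> over a small parallelogram is, by the mean value theorem applied
  in either order, a value of either mixed second derivative near the base point.\<close>

lemma second_derivative_symmetric:
  fixes f :: "'a::real_normed_vector \<Rightarrow> 'b::real_inner"
  assumes f: "has_C1_derivative f f'" and f': "has_C1_derivative f' f''"
  shows "f'' x u v = f'' x v u"
proof -
  have key: "\<exists>s t. 0 < s \<and> s < h \<and> 0 < t \<and> t < h \<and>
       (f (x + h *\<^sub>R u + h *\<^sub>R v) - f (x + h *\<^sub>R u) - f (x + h *\<^sub>R v) + f x) \<bullet> b
          = h * h * (f'' (x + s *\<^sub>R u + t *\<^sub>R v) v u \<bullet> b)" if h: "0 < h" for h :: real and u v b
  proof -
    define p where "p s = (f (x + s *\<^sub>R u + h *\<^sub>R v) - f (x + s *\<^sub>R u)) \<bullet> b" for s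
    have dp: "(p has_real_derivative ((f' (x + s *\<^sub>R u + h *\<^sub>R v) u - f' (x + s *\<^sub>R u) u) \<bullet> b)) (at s)" for s
      unfolding p_def has_field_derivative_def
      by (rule derivative_eq_intros has_derivative_compose[OF _ has_C1_derivativeD(1)[OF f, of _ UNIV]] refl)+
         (auto simp: blinfun.scaleR_right inner_diff_left algebra_simps)
    obtain s where s: "0 < s" "s < h"
      "p h - p 0 = (h - 0) * ((f' (x + s *\<^sub>R u + h *\<^sub>R v) u - f' (x + s *\<^sub>R u) u) \<bullet> b)"
      using MVT2[OF h, of p, OF dp] by auto
    define q where "q t = f' (x + s *\<^sub>R u + t *\<^sub>R v) u \<bullet> b" for t
    have dq: "(q has_real_derivative (f'' (x + s *\<^sub>R u + t *\<^sub>R v) v u \<bullet> b)) (at t)" for t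
      unfolding q_def has_field_derivative_def
      by (rule derivative_eq_intros has_derivative_compose[OF _ has_C1_derivativeD(1)[OF f', of _ UNIV]] refl)+
         (auto simp: blinfun.scaleR_right blinfun.scaleR_left blinfun.zero_right algebra_simps)
    obtain t where t: "0 < t" "t < h" "q h - q 0 = (h - 0) * (f'' (x + s *\<^sub>R u + t *\<^sub>R v) v u \<bullet> b)"
      using MVT2[OF h, of q, OF dq] by auto
    have "p h - p 0 = h * (q h - q 0)" using s by (simp add: q_def inner_diff_left)
    hence "p h - p 0 = h * h * (f'' (x + s *\<^sub>R u + t *\<^sub>R v) v u \<bullet> b)" using t by simp
    thus ?thesis using s t by (intro exI[of _ s] exI[of _ t]) (auto simp: p_def algebra_simps inner_simps)
  qed
  have "f'' x u v \<bullet> b = f'' x v u \<bullet> b" for b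
  proof -
    define h where "h n = inverse (real (Suc n))" for n
    have h: "0 < h n" for n by (simp add: h_def)
    have h0: "h \<longlonglongrightarrow> 0" unfolding h_def by (rule LIMSEQ_inverse_real_of_nat)
    obtain s t where st: "\<And>n. 0 < s n \<and> s n < h n \<and> 0 < t n \<and> t n < h n \<and>
       (f (x + h n *\<^sub>R u + h n *\<^sub>R v) - f (x + h n *\<^sub>R u) - f (x + h n *\<^sub>R v) + f x) \<bullet> b
          = h n * h n * (f'' (x + s n *\<^sub>R u + t n *\<^sub>R v) v u \<bullet> b)"
      using key[OF h, of _ u v b] by metis
    obtain s' t' where st': "\<And>n. 0 < s' n \<and> s' n < h n \<and> 0 < t' n \<and> t' n < h n \<and>
       (f (x + h n *\<^sub>R v + h n *\<^sub>R u) - f (x + h n *\<^sub>R v) - f (x + h n *\<^sub>R u) + f x) \<bullet> b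
          = h n * h n * (f'' (x + s' n *\<^sub>R v + t' n *\<^sub>R u) u v \<bullet> b)"
      using key[OF h, of _ v u b] by metis
    have eq: "f'' (x + s n *\<^sub>R u + t n *\<^sub>R v) v u \<bullet> b = f'' (x + s' n *\<^sub>R v + t' n *\<^sub>R u) u v \<bullet> b" for n
    proof -
      have "h n * h n * (f'' (x + s n *\<^sub>R u + t n *\<^sub>R v) v u \<bullet> b)
          = h n * h n * (f'' (x + s' n *\<^sub>R v + t' n *\<^sub>R u) u v \<bullet> b)"
        using st[of n] st'[of n] by (simp add: algebra_simps)
      thus ?thesis using h[of n] by simp
    qed
    have lim0: "a \<longlonglongrightarrow> 0" if "\<And>n. 0 < a n \<and> a n < h n" for a
      by (rule real_tendsto_sandwich[OF _ _ tendsto_const h0])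
         (use that in \<open>auto intro!: always_eventually simp: less_imp_le\<close>)
    have cont: "isCont f'' y" for y
      using has_C1_derivativeD(2)[OF f', of UNIV] by (simp add: continuous_on_eq_continuous_at)
    have 1: "(\<lambda>n. f'' (x + s n *\<^sub>R u + t n *\<^sub>R v) v u \<bullet> b) \<longlonglongrightarrow> f'' (x + 0 *\<^sub>R u + 0 *\<^sub>R v) v u \<bullet> b"
      using st by (intro tendsto_intros isCont_tendsto_compose[OF cont] lim0) auto
    have 2: "(\<lambda>n. f'' (x + s' n *\<^sub>R v + t' n *\<^sub>R u) u v \<bullet> b) \<longlonglongrightarrow> f'' (x + 0 *\<^sub>R v + 0 *\<^sub>R u) u v \<bullet> b"
      using st' by (intro tendsto_intros isCont_tendsto_compose[OF cont] lim0) auto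
    show ?thesis using LIMSEQ_unique[OF 1 2[folded eq]] by simp
  qed
  thus ?thesis by (metis vector_eq_rdot)
qed

section \<open>Groups with a twice continuously differentiable product\<close>

text \<open>The maps \<open>dmul\<close> and \<open>ddmul\<close> are the first and second derivative of the product, as a function of
  the pair of factors.  Inversion is the linear map \<open>- 1\<close>, as in exponential coordinates.\<close>

locale C2_group =
  fixes mul :: "'a::euclidean_space \<Rightarrow> 'a \<Rightarrow> 'a"
    and dmul :: "'a \<times> 'a \<Rightarrow> ('a \<times> 'a) \<Rightarrow>\<^sub>L 'a"
    and ddmul :: "'a \<times> 'a \<Rightarrow> ('a \<times> 'a) \<Rightarrow>\<^sub>L (('a \<times> 'a) \<Rightarrow>\<^sub>L 'a)"
  assumes mul_assoc: "mul (mul x y) z = mul x (mul y z)"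
    and mul_0_left [simp]: "mul 0 x = x" and mul_0_right [simp]: "mul x 0 = x"
    and mul_minus_left [simp]: "mul (- x) x = 0" and mul_minus_right [simp]: "mul x (- x) = 0"
    and C1_mul: "has_C1_derivative (\<lambda>z. mul (fst z) (snd z)) dmul"
    and C1_dmul: "has_C1_derivative dmul ddmul"
begin

text \<open>The differential at \<open>q\<close> of the left translation by \<open>p\<close>.\<close>

definition dL :: "'a \<Rightarrow> 'a \<Rightarrow> 'a \<Rightarrow>\<^sub>L 'a" where
  "dL p q = dmul (p, q) o\<^sub>L Blinfun (\<lambda>v. (0, v))"

lemma dL_apply: "dL p q v = dmul (p, q) (0, v)"
proof -
  have "bounded_linear (\<lambda>v::'a. (0::'a, v))"
    by (intro bounded_linear_Pair bounded_linear_zero bounded_linear_ident)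
  thus ?thesis by (simp add: dL_def bounded_linear_Blinfun_apply)
qed

lemma dL_fun: "blinfun_apply (dL p q) = (\<lambda>v. dmul (p, q) (0, v))"
  by (rule ext) (rule dL_apply)

lemma mul_cancel [simp]: "mul (- p) (mul p q) = q" "mul p (mul (- p) q) = q"
  by (simp_all flip: mul_assoc)

lemma mul_cancel_right [simp]: "mul (mul p q) (- q) = p" "mul (mul p (- q)) q = p"
  by (simp_all add: mul_assoc)

lemma uminus_mul: "- mul p q = mul (- q) (- p)"
  by (metis mul_assoc mul_0_left mul_cancel(1) mul_minus_right mul_0_right)

lemma has_derivative_mul:
  assumes "(f has_derivative f') (at x within S)" "(g has_derivative g') (at x within S)"
  shows "((\<lambda>x. mul (f x) (g x)) has_derivative (\<lambda>h. dmul (f x, g x) (f' h, g' h))) (at x within S)"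
  using has_derivative_compose[OF has_derivative_Pair[OF assms] has_C1_derivativeD(1)[OF C1_mul, of _ UNIV]]
  by simp

lemma has_derivative_dmul:
  assumes "(f has_derivative f') (at x within S)" "(g has_derivative g') (at x within S)"
    "(k has_derivative k') (at x within S)"
  shows "((\<lambda>x. dmul (f x, g x) (k x)) has_derivative
    (\<lambda>h. dmul (f x, g x) (k' h) + ddmul (f x, g x) (f' h, g' h) (k x))) (at x within S)"
  by (rule blinfun.FDERIV[OF has_derivative_compose[OF has_derivative_Pair[OF assms(1,2)]
        has_C1_derivativeD(1)[OF C1_dmul, of _ UNIV]] assms(3)])

lemma has_derivative_left_translation: "(mul p has_derivative dL p q) (at q within S)"
  using has_derivative_mul[OF has_derivative_const[of p] has_derivative_ident, of q S]
  unfolding dL_fun .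

lemma has_C1_derivative_left_translation: "has_C1_derivative (mul p) (dL p)"
proof -
  have "continuous_on UNIV (\<lambda>q. dmul (p, q) o\<^sub>L Blinfun (\<lambda>v. (0, v)))"
    by (intro continuous_intros continuous_on_compose2[OF has_C1_derivativeD(2)[OF C1_mul, of UNIV]]) auto
  thus ?thesis
    using has_derivative_left_translation[of p _ UNIV] by (simp add: has_C1_derivative_def dL_def[abs_def])
qed

lemma dL_chain: "dL p (mul q z) (dL q z v) = dL (mul p q) z v"
proof -
  have "((\<lambda>z. mul p (mul q z)) has_derivative (\<lambda>v. dL p (mul q z) (dL q z v))) (at z)"
    by (rule has_derivative_compose[OF has_derivative_left_translation has_derivative_left_translation])
  hence "(mul (mul p q) has_derivative (\<lambda>v. dL p (mul q z) (dL q z v))) (at z)"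
    by (simp add: mul_assoc[symmetric])
  from has_derivative_unique[OF this has_derivative_left_translation] show ?thesis by metis
qed

lemma dL_0 [simp]: "dL 0 q v = v"
proof -
  have "mul 0 = (\<lambda>x. x)" by auto
  hence "(mul 0 has_derivative (\<lambda>v. v)) (at q)" by simp
  from has_derivative_unique[OF this has_derivative_left_translation] show ?thesis by metis
qed

lemma dL_inverse [simp]:
  "dL (- p) (mul p q) (dL p q v) = v" "dL p q (dL (- p) (mul p q) v) = v"
  using dL_chain[of "- p" p q v] dL_chain[of p "- p" "mul p q" v] by simp_all

lemma dL_inverse_0 [simp]: "dL (- p) p (dL p 0 v) = v" "dL p 0 (dL (- p) p v) = v"
  using dL_inverse[of p 0 v] by simp_all

text \<open>The value at the identity of the commutator of the left-invariant fields with values \<open>u\<close> and \<open>v\<close>.\<close>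

definition bracket :: "'a \<Rightarrow> 'a \<Rightarrow> 'a" where
  "bracket u v = ddmul (0, 0) (u, 0) (0, v) - ddmul (0, 0) (v, 0) (0, u)"

lemma bracket_linear_right: "linear (bracket u)"
proof
  have [simp]: "(0::'a, a + b) = (0, a) + (0, b)" "(a + b, 0::'a) = (a, 0) + (b, 0)"
    "(0::'a, c *\<^sub>R a) = c *\<^sub>R (0, a)" "(c *\<^sub>R a, 0::'a) = c *\<^sub>R (a, 0)" for a b :: 'a and c :: real
    by auto
  show "bracket u (a + b) = bracket u a + bracket u b" "bracket u (c *\<^sub>R b) = c *\<^sub>R bracket u b" for a b c
    unfolding bracket_def
    by (simp_all add: blinfun.add_left blinfun.add_right blinfun.scaleR_left blinfun.scaleR_right
        algebra_simps del: scaleR_Pair add_Pair)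
qed

lemma has_derivative_left_invariant_field:
  "((\<lambda>p. dL p 0 v) has_derivative (\<lambda>h. ddmul (p, 0) (h, 0) (0, v))) (at p within S)"
  unfolding dL_apply
proof -
  have "((\<lambda>p. dmul (p, 0) (0, v)) has_derivative
      (\<lambda>h. dmul (p, 0) 0 + ddmul (p, 0) (h, 0) (0, v))) (at p within S)"
    by (rule has_derivative_dmul has_derivative_ident has_derivative_const)+
  thus "((\<lambda>p. dmul (p, 0) (0, v)) has_derivative
      (\<lambda>h. ddmul (p, 0) (h, 0) (0, v))) (at p within S)"
    by (simp add: blinfun.zero_right)
qed

text \<open>The bracket of two left-invariant fields is the left-invariant field of the bracket:
  differentiate the left-invariance \<open>dL p q (dL q 0 v) = dL (mul p q) 0 v\<close> at \<open>q = 0\<close> and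
  antisymmetrize; the second derivatives in the second argument of the product cancel.\<close>

lemma bracket_left_invariant:
  "ddmul (p, 0) (dL p 0 u, 0) (0, v) - ddmul (p, 0) (dL p 0 v, 0) (0, u) = dL p 0 (bracket u v)"
proof -
  have *: "ddmul (p, 0) (dL p 0 u, 0) (0, v)
      = dL p 0 (ddmul (0, 0) (u, 0) (0, v)) + ddmul (p, 0) (0, u) (0, v)" for u v
  proof -
    have 1: "((\<lambda>q. dmul (p, q) (0, dL q 0 v)) has_derivative
       (\<lambda>h. dmul (p, 0) (0, ddmul (0, 0) (h, 0) (0, v)) + ddmul (p, 0) (0, h) (0, dL 0 0 v))) (at 0)"
      by (rule has_derivative_dmul has_derivative_const has_derivative_ident has_derivative_Pair
           has_derivative_left_invariant_field)+
    have 2: "((\<lambda>q. dL (mul p q) 0 v) has_derivative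
       (\<lambda>h. ddmul (mul p 0, 0) (dL p 0 h, 0) (0, v))) (at 0)"
      by (rule has_derivative_compose[OF has_derivative_left_translation has_derivative_left_invariant_field])
    have eq: "(\<lambda>q. dmul (p, q) (0, dL q 0 v)) = (\<lambda>q. dL (mul p q) 0 v)"
      using dL_chain[of p _ 0 v] by (simp add: dL_apply fun_eq_iff)
    have "(\<lambda>h. dmul (p, 0) (0, ddmul (0, 0) (h, 0) (0, v)) + ddmul (p, 0) (0, h) (0, dL 0 0 v))
       = (\<lambda>h. ddmul (mul p 0, 0) (dL p 0 h, 0) (0, v))"
      by (rule has_derivative_unique[OF 1[unfolded eq] 2])
    from fun_cong[OF this, of u] dL_0[of 0 v] show ?thesis by (simp add: dL_apply)
  qed
  have "ddmul (p, 0) (0, u) (0, v) = ddmul (p, 0) (0, v) (0, u)"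
    by (rule second_derivative_symmetric[OF C1_mul C1_dmul])
  thus ?thesis by (simp add: * bracket_def blinfun.diff_right)
qed

end

section \<open>The differential of a left translation in exponential coordinates\<close>

locale exponential_C2_group = C2_group +
  assumes one_parameter: "mul (s *\<^sub>R x) (t *\<^sub>R x) = (s + t) *\<^sub>R x"
begin

text \<open>Rays are one-parameter subgroups, so along the ray of \<open>x\<close> the left-invariant field of \<open>x\<close> is
  constantly \<open>x\<close>.\<close>

lemma dL_radial: "dL (t *\<^sub>R x) 0 x = x"
proof -
  have "((\<lambda>s. mul (t *\<^sub>R x) (s *\<^sub>R x)) has_derivative (\<lambda>h. dL (t *\<^sub>R x) (0 *\<^sub>R x) (h *\<^sub>R x))) (at 0)"
    by (rule has_derivative_compose[OF _ has_derivative_left_translation]) (auto intro!: derivative_eq_intros)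
  moreover have "((\<lambda>s. mul (t *\<^sub>R x) (s *\<^sub>R x)) has_derivative (\<lambda>h. h *\<^sub>R x)) (at 0)"
    unfolding one_parameter by (auto intro!: derivative_eq_intros simp: algebra_simps)
  ultimately have "(\<lambda>h. dL (t *\<^sub>R x) (0 *\<^sub>R x) (h *\<^sub>R x)) = (\<lambda>h. h *\<^sub>R x)"
    by (rule has_derivative_unique)
  from fun_cong[OF this, of 1] show ?thesis by simp
qed

text \<open>Differentiate the identity \<open>dL (t *\<^sub>R y) 0 y = y\<close> with respect to \<open>y\<close> at \<open>x\<close>.\<close>

lemma radial_field_derivative:
  "t *\<^sub>R ddmul (t *\<^sub>R x, 0) (w, 0) (0, x) = w - dL (t *\<^sub>R x) 0 w"
proof -
  have "((\<lambda>y. dmul (t *\<^sub>R y, 0) (0, y)) has_derivative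
     (\<lambda>h. dmul (t *\<^sub>R x, 0) (0, h) + ddmul (t *\<^sub>R x, 0) (t *\<^sub>R h, 0) (0, x))) (at x)"
    by (rule has_derivative_dmul has_derivative_const has_derivative_ident has_derivative_Pair
        has_derivative_scaleR_right)+
  moreover have "(\<lambda>y. dmul (t *\<^sub>R y, 0) (0, y)) = (\<lambda>y. y)"
    using dL_radial by (simp add: dL_apply)
  ultimately have "((\<lambda>y. y) has_derivative
     (\<lambda>h. dmul (t *\<^sub>R x, 0) (0, h) + ddmul (t *\<^sub>R x, 0) (t *\<^sub>R h, 0) (0, x))) (at x)" by simp
  from has_derivative_unique[OF this has_derivative_ident]
  have "dmul (t *\<^sub>R x, 0) (0, w) + ddmul (t *\<^sub>R x, 0) (t *\<^sub>R w, 0) (0, x) = w" by metis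
  moreover have "(t *\<^sub>R w, 0::'a) = t *\<^sub>R (w, 0)" by simp
  ultimately show ?thesis
    by (simp add: dL_apply blinfun.scaleR_left blinfun.scaleR_right algebra_simps del: scaleR_Pair)
qed

text \<open>The differential of \<open>y \<mapsto> t y\<close> at \<open>x\<close> maps \<open>v\<close> to the tangent vector \<open>t v\<close> at \<open>t x\<close>; moved to the
  identity by left translation it becomes \<open>dexp x v t\<close>.\<close>

definition dexp :: "'a \<Rightarrow> 'a \<Rightarrow> real \<Rightarrow> 'a" where
  "dexp x v t = t *\<^sub>R dL (- (t *\<^sub>R x)) (t *\<^sub>R x) v"

lemma dexp_differentiable: "dexp x v differentiable (at t)"
proof -
  have "\<exists>D. ((\<lambda>t. dmul (- (t *\<^sub>R x), t *\<^sub>R x) (0, v)) has_derivative D) (at t)"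
    by (rule exI, (rule has_derivative_dmul has_derivative_const has_derivative_minus
          has_derivative_scaleR_left has_derivative_ident)+)
  hence "(\<lambda>t. dmul (- (t *\<^sub>R x), t *\<^sub>R x) (0, v)) differentiable (at t)"
    by (auto simp: differentiable_def)
  thus ?thesis
    unfolding dexp_def[abs_def] dL_apply by (intro differentiable_scaleR) auto
qed

lemma dexp_eq: "dL (t *\<^sub>R x) 0 (dexp x v t) = t *\<^sub>R v"
  by (simp add: dexp_def blinfun.scaleR_right)

text \<open>Differentiate \<open>dL (t *\<^sub>R x) 0 (dexp x v t) = t *\<^sub>R v\<close>; the derivative of the first factor
  is governed by the bracket of \<open>x\<close> with the field of \<open>v\<close> and by the radial field.\<close>

lemma dexp_ode:
  assumes t: "t \<noteq> 0"
  shows "(dexp x v has_vector_derivative (v - bracket x (dexp x v t))) (at t)"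
proof -
  let ?p = "t *\<^sub>R x" and ?w = "dexp x v t"
  obtain D where D: "(dexp x v has_vector_derivative D) (at t)"
    using dexp_differentiable[of x v t] vector_derivative_works by blast
  hence D': "(dexp x v has_derivative (\<lambda>h. h *\<^sub>R D)) (at t)" by (simp add: has_vector_derivative_def)
  have a: "((\<lambda>t. dmul (t *\<^sub>R x, 0) (0, dexp x v t)) has_derivative
      (\<lambda>h. dmul (?p, 0) (0, h *\<^sub>R D) + ddmul (?p, 0) (h *\<^sub>R x, 0) (0, ?w))) (at t)"
    by (rule has_derivative_dmul has_derivative_const has_derivative_ident has_derivative_Pair D'
        has_derivative_scaleR_left)+
  have eq: "(\<lambda>t. dmul (t *\<^sub>R x, 0) (0, dexp x v t)) = (\<lambda>t. t *\<^sub>R v)"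
    using dexp_eq by (simp add: dL_apply)
  have b: "((\<lambda>t. t *\<^sub>R v) has_derivative (\<lambda>h. h *\<^sub>R v)) (at t)"
    by (auto intro!: derivative_eq_intros)
  have "(\<lambda>h. dmul (?p, 0) (0, h *\<^sub>R D) + ddmul (?p, 0) (h *\<^sub>R x, 0) (0, ?w)) = (\<lambda>h. h *\<^sub>R v)"
    by (rule has_derivative_unique[OF a[unfolded eq] b])
  from fun_cong[OF this, of 1] have 1: "dL ?p 0 D + ddmul (?p, 0) (x, 0) (0, ?w) = v"
    by (simp add: dL_apply)
  have "ddmul (?p, 0) (x, 0) (0, ?w) - ddmul (?p, 0) (t *\<^sub>R v, 0) (0, x) = dL ?p 0 (bracket x ?w)"
    using bracket_left_invariant[of ?p x ?w] by (simp add: dL_radial dexp_eq)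
  moreover have "(t *\<^sub>R v, 0::'a) = t *\<^sub>R (v, 0)" by simp
  ultimately have "ddmul (?p, 0) (x, 0) (0, ?w) = dL ?p 0 (bracket x ?w) + (v - dL ?p 0 v)"
    using radial_field_derivative[of t x v]
    by (simp add: blinfun.scaleR_left blinfun.scaleR_right algebra_simps del: scaleR_Pair)
  with 1 have "dL ?p 0 D = dL ?p 0 (v - bracket x ?w)"
    by (simp add: blinfun.diff_right algebra_simps)
  hence "D = v - bracket x ?w" by (metis dL_inverse_0(1))
  with D show ?thesis by simp
qed

end

section \<open>Unit lower triangular maps\<close>

text \<open>The column \<open>f (axis j 1)\<close> of the matrix of \<open>f\<close> has entry \<open>1\<close> in row \<open>j\<close> and \<open>0\<close> in the earlier rows.\<close>

definition unit_lower_triangular :: "((real, 'd::{finite,linorder}) vec \<Rightarrow> (real, 'd) vec) \<Rightarrow> bool" where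
  "unit_lower_triangular f \<longleftrightarrow>
     (\<forall>i j. i \<le> j \<longrightarrow> f (axis j 1) $ i = (if i = j then 1 else 0))"

lemma linear_axis_expand:
  fixes f :: "real^'d \<Rightarrow> real^'e"
  assumes "linear f"
  shows "f w $ i = (\<Sum>l\<in>UNIV. w $ l * f (axis l 1) $ i)"
proof -
  have "w = (\<Sum>l\<in>UNIV. w $ l *\<^sub>R axis l 1)"
    using basis_expansion[of w] by (simp add: scalar_mult_eq_scaleR)
  hence "f w = f (\<Sum>l\<in>UNIV. w $ l *\<^sub>R axis l 1)" by simp
  thus ?thesis using assms by (simp add: linear_sum linear_scale)
qed

lemma unit_lower_triangular_compose:
  assumes "linear f" and f: "unit_lower_triangular f" and g: "unit_lower_triangular g"
  shows "unit_lower_triangular (\<lambda>v. f (g v))"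
  unfolding unit_lower_triangular_def
proof (intro allI impI)
  fix i j :: 'a assume ij: "i \<le> j"
  have "g (axis j 1) $ l * f (axis l 1) $ i = (if l = j then if i = j then 1 else 0 else 0)" for l
  proof (cases l j rule: linorder_cases)
    case less
    thus ?thesis using g by (simp add: unit_lower_triangular_def)
  next
    case equal
    thus ?thesis using f g ij by (simp add: unit_lower_triangular_def)
  next
    case greater
    thus ?thesis using f ij by (auto simp: unit_lower_triangular_def)
  qed
  thus "f (g (axis j 1)) $ i = (if i = j then 1 else 0)"
    by (subst linear_axis_expand[OF \<open>linear f\<close>]) simp
qed

text \<open>Columns are treated from the last one backwards: \<open>f (axis j 1)\<close> is \<open>axis j 1\<close> plus a combination
  of later basis vectors, whose images under \<open>g\<close> are already known.\<close>

lemma unit_lower_triangular_inverse: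
  assumes "linear g" and f: "unit_lower_triangular f" and gf: "\<And>v. g (f v) = v"
  shows "unit_lower_triangular g"
proof -
  have "\<forall>i\<le>j. g (axis j 1) $ i = (if i = j then 1 else 0)" for j :: 'a
  proof (induction "card {j<..}" arbitrary: j rule: less_induct)
    case less
    show ?case
    proof (intro allI impI)
      fix i assume ij: "i \<le> j"
      have t: "f (axis j 1) $ l * g (axis l 1) $ i = (if l = j then g (axis j 1) $ i else 0)" for l
      proof (cases l j rule: linorder_cases)
        case less
        thus ?thesis using f by (simp add: unit_lower_triangular_def)
      next
        case equal
        thus ?thesis using f by (simp add: unit_lower_triangular_def)
      next
        case greater
        hence "card {l<..} < card {j<..}" by (intro psubset_card_mono) auto
        from less.hyps[OF this] have "g (axis l 1) $ i = 0" using greater ij by auto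
        thus ?thesis using greater by simp
      qed
      have "axis j 1 $ i = g (f (axis j 1)) $ i" by (simp add: gf)
      also have "\<dots> = g (axis j 1) $ i"
        by (subst linear_axis_expand[OF \<open>linear g\<close>]) (simp add: t)
      finally show "g (axis j 1) $ i = (if i = j then 1 else 0)" by (simp add: axis_def)
    qed
  qed
  thus ?thesis by (simp add: unit_lower_triangular_def)
qed

lemma permutes_le_imp_id:
  fixes p :: "'d::{finite,linorder} \<Rightarrow> 'd"
  assumes p: "inj p" and le: "\<And>i. p i \<le> i"
  shows "p = id"
proof -
  have "p i = i" for i
  proof (induction "card {..<i}" arbitrary: i rule: less_induct)
    case less
    have "p l = l" if "l < i" for l
      using that by (intro less psubset_card_mono) auto
    hence "\<not> p i < i" using p by (metis injD less_irrefl)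
    thus ?case using le[of i] by simp
  qed
  thus ?thesis by auto
qed

text \<open>In the Leibniz formula a permutation contributes only if it never increases an index, and the
  identity is the only such permutation.\<close>

lemma det_unit_lower_triangular:
  assumes "unit_lower_triangular f"
  shows "det (matrix f) = 1"
proof -
  have "(\<Prod>i\<in>UNIV. matrix f $ i $ p i) = 0" if p: "p permutes UNIV" "p \<noteq> id" for p
  proof -
    obtain i where "\<not> p i \<le> i"
      using permutes_le_imp_id[OF permutes_inj[OF p(1)]] p(2) by blast
    hence "matrix f $ i $ p i = 0"
      using assms by (simp add: matrix_def unit_lower_triangular_def)
    thus ?thesis by (simp add: prod_zero_iff) blast
  qed
  hence "det (matrix f) = (\<Sum>p\<in>{p. p permutes (UNIV::'a set)}. if p = id then \<Prod>i\<in>UNIV. matrix f $ i $ i else 0)"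
    unfolding det_def by (intro sum.cong refl) (auto simp: sign_id)
  also have "\<dots> = (\<Prod>i\<in>UNIV. matrix f $ i $ i)"
    by (simp add: permutes_id)
  finally show ?thesis
    using assms by (simp add: matrix_def unit_lower_triangular_def)
qed

section \<open>Left translations of a nilpotent group are triangular in Malcev coordinates\<close>

locale nilpotent_C2_group = nilpotent_group mul r + exponential_C2_group mul dmul ddmul
  for mul :: "(real, 'd::{finite,linorder}) vec \<Rightarrow> (real, 'd) vec \<Rightarrow> (real, 'd) vec" and r dmul ddmul
begin

lemma left_diff_eq: "left_diff mul p q = dL p q"
  unfolding left_diff_def
  using frechet_derivative_at[OF has_derivative_left_translation[of p q UNIV]] by simp

lemma lie_bracket_eq: "lie_bracket mul u v = bracket u v"
proof -
  have "left_inv_field mul w = (\<lambda>p. dL p 0 w)" for w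
    by (simp add: left_inv_field_def[abs_def] left_diff_eq)
  moreover have "frechet_derivative (\<lambda>p. dL p 0 w) (at 0) = (\<lambda>h. ddmul (0, 0) (h, 0) (0, w))" for w
    using frechet_derivative_at[OF has_derivative_left_invariant_field[of w 0 UNIV]] by simp
  ultimately show ?thesis
    by (simp add: lie_bracket_def vf_bracket_def bracket_def)
qed

lemma funpow_bracket_lower_central: "((bracket x) ^^ n) v \<in> lower_central mul n"
proof (induction n)
  case (Suc n)
  thus ?case
    unfolding funpow.simps o_apply lower_central.simps bracket_space_def
    by (intro span_base) (auto simp: lie_bracket_eq)
qed simp

lemma bracket_axis_lower:
  assumes "i < j"
  shows "bracket x (axis j 1) $ i = 0"
proof -
  have "axis j 1 \<in> tail_span j" unfolding tail_span_def by (intro span_base) auto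
  hence "bracket x (axis j 1) \<in> tail_span j"
    using malcev_ideal[of j] by (auto simp: lie_ideal_def lie_bracket_eq)
  hence "bracket x (axis j 1) \<in> {w. w $ i = 0}"
    unfolding tail_span_def
    by (rule subsetD[OF span_minimal, rotated -1])
       (use assms in \<open>auto simp: axis_def subspace_def\<close>)
  thus ?thesis by simp
qed

text \<open>The ideals of the Malcev basis make \<open>bracket x\<close> triangular, and a nilpotent triangular map
  has zero diagonal.\<close>

lemma bracket_axis_strictly_lower:
  assumes "i \<le> j"
  shows "bracket x (axis j 1) $ i = 0"
proof (cases "i = j")
  case False
  thus ?thesis using assms bracket_axis_lower by simp
next
  case True
  define c where "c = bracket x (axis j 1) $ j"
  have "\<forall>i\<le>j. ((bracket x) ^^ n) (axis j 1) $ i = (if i = j then c ^ n else 0)" for n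
  proof (induction n)
    case 0
    show ?case by (auto simp: axis_def)
  next
    case (Suc n)
    let ?w = "((bracket x) ^^ n) (axis j 1)"
    show ?case
    proof (intro allI impI)
      fix i assume ij: "i \<le> j"
      have "?w $ l * bracket x (axis l 1) $ i = (if l = j then if i = j then c ^ Suc n else 0 else 0)" for l
      proof (cases l j rule: linorder_cases)
        case less
        thus ?thesis using Suc by auto
      next
        case equal
        thus ?thesis using Suc ij bracket_axis_lower[of i j x] by (auto simp: c_def)
      next
        case greater
        thus ?thesis using ij bracket_axis_lower[of i l x] by auto
      qed
      hence "bracket x ?w $ i = (if i = j then c ^ Suc n else 0)"
        by (subst linear_axis_expand[OF bracket_linear_right]) simp
      thus "((bracket x) ^^ Suc n) (axis j 1) $ i = (if i = j then c ^ Suc n else 0)" by simp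
    qed
  qed
  moreover have "((bracket x) ^^ r) (axis j 1) = 0"
    using funpow_bracket_lower_central[of r x "axis j 1"] step by simp
  ultimately have "c ^ r = 0" by (metis order_refl zero_index)
  thus ?thesis using True by (simp add: c_def)
qed

text \<open>Integrating the differential equation of \<open>dexp\<close> component by component, the strictly lower
  triangular bracket only feeds earlier components into later ones.\<close>

lemma dexp_axis:
  assumes "i \<le> j" "0 \<le> t"
  shows "dexp x (axis j 1) t $ i = (if i = j then t else 0)"
  using assms
proof (induction "card {..<i}" arbitrary: i t rule: less_induct)
  case less
  have ij: "i \<le> j" by fact
  let ?f = "\<lambda>s. dexp x (axis j 1) s $ i - (if i = j then s else 0)"
  have der: "(?f has_real_derivative 0) (at s)" if s: "0 < s" for s
  proof -
    have 0: "dexp x (axis j 1) s $ l * bracket x (axis l 1) $ i = 0" for l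
    proof (cases "l < i")
      case True
      hence "card {..<l} < card {..<i}" by (intro psubset_card_mono) auto
      from less.hyps[OF this, of s] show ?thesis using True ij s by simp
    next
      case False
      thus ?thesis using bracket_axis_strictly_lower[of i l x] by simp
    qed
    have "bracket x (dexp x (axis j 1) s) $ i = 0"
      by (subst linear_axis_expand[OF bracket_linear_right]) (simp add: 0)
    moreover have "((\<lambda>s. dexp x (axis j 1) s $ i) has_vector_derivative
        (axis j 1 - bracket x (dexp x (axis j 1) s)) $ i) (at s)"
      by (rule bounded_linear.has_vector_derivative[OF bounded_linear_vec_nth dexp_ode]) (use s in simp)
    ultimately have "((\<lambda>s. dexp x (axis j 1) s $ i) has_real_derivative (if i = j then 1 else 0)) (at s)"
      by (simp add: has_real_derivative_iff_has_vector_derivative axis_def split: if_splits)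
    thus ?thesis by (auto intro!: derivative_eq_intros)
  qed
  have cont: "continuous_on {0..t} ?f"
  proof -
    have "continuous_on {0..t} (dexp x (axis j 1))"
      by (meson continuous_at_imp_continuous_on dexp_differentiable differentiable_imp_continuous_within)
    moreover have "continuous_on {0..t} (\<lambda>s. if i = j then s else 0)"
      by (cases "i = j") auto
    ultimately show ?thesis by (intro continuous_intros)
  qed
  have "?f t = ?f 0"
  proof (cases "t = 0")
    case False
    with less.prems have "0 < t" by simp
    from DERIV_isconst_end[OF this cont] der show ?thesis by auto
  qed simp
  moreover have "dexp x (axis j 1) 0 = 0" by (simp add: dexp_def)
  ultimately show ?case by (simp split: if_splits)
qed

text \<open>The value of \<open>dexp\<close> at time \<open>1\<close> settles \<open>dL (- x) x\<close>, and its inverse \<open>dL x 0\<close>; every other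
  \<open>dL p q\<close> is a composition of these two kinds.\<close>

lemma unit_lower_triangular_dL: "unit_lower_triangular (dL p q)"
proof -
  have lin: "linear (dL p q)" for p q
    by (simp add: bounded_linear.linear blinfun.bounded_linear_right)
  have 1: "unit_lower_triangular (dL (- x) x)" for x
    unfolding unit_lower_triangular_def using dexp_axis[of _ _ 1 x] by (simp add: dexp_def)
  have 2: "unit_lower_triangular (dL x 0)" for x
    by (rule unit_lower_triangular_inverse[OF lin 1[of x]]) simp
  have "dL p q v = dL (mul p q) 0 (dL (- q) q v)" for v
    using dL_chain[of p q 0 "dL (- q) q v"] by simp
  hence "blinfun_apply (dL p q) = (\<lambda>v. dL (mul p q) 0 (dL (- q) q v))" by auto
  thus ?thesis using unit_lower_triangular_compose[OF lin 2 1] by metis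
qed

end

lemma nilpotent_group_imp_C2:
  assumes "nilpotent_group mul r"
  obtains dmul ddmul where "nilpotent_C2_group mul r dmul ddmul"
proof -
  interpret nilpotent_group mul r by fact
  have "C_k 2 (\<lambda>z. mul (fst z) (snd z))" using smooth_mul by (simp add: smooth_def)
  then obtain dmul ddmul where d: "has_C1_derivative (\<lambda>z. mul (fst z) (snd z)) dmul"
    "has_C1_derivative dmul ddmul" using C_k_2_imp by blast
  interpret g: group mul 0 uminus by (rule group)
  have "nilpotent_C2_group mul r dmul ddmul"
    by unfold_locales (simp_all add: d g.assoc one_parameter)
  thus thesis by (rule that)
qed

section \<open>Triangular diffeomorphisms preserve Lebesgue measure\<close>

text \<open>A finite linear order is a well-order, but its type need not belong to the class
  \<^class>\<open>wellorder\<close>, for which the change of variables theorem is stated.  A copy of the type can be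
  made an instance of that class, and Lebesgue measure is transported along the renaming of
  coordinates.\<close>

typedef 'd wellordered_copy = "UNIV :: 'd set" by simp

instance wellordered_copy :: (finite) finite
proof
  have "(UNIV :: 'a wellordered_copy set) = range Abs_wellordered_copy"
    by (metis Rep_wellordered_copy_inverse surjI)
  thus "finite (UNIV :: 'a wellordered_copy set)" by (metis finite finite_imageI)
qed

instantiation wellordered_copy :: ("{finite,linorder}") wellorder
begin

definition "x \<le> y \<longleftrightarrow> Rep_wellordered_copy x \<le> Rep_wellordered_copy y"
definition "x < y \<longleftrightarrow> Rep_wellordered_copy x < Rep_wellordered_copy y"

instance
proof
  fix P :: "'a wellordered_copy \<Rightarrow> bool" and a
  assume step: "\<And>x. (\<And>y. y < x \<Longrightarrow> P y) \<Longrightarrow> P x"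
  show "P a"
  proof (induction "card {..<Rep_wellordered_copy a}" arbitrary: a rule: less_induct)
    case less
    show ?case
      by (rule step, rule less.hyps, rule psubset_card_mono)
         (auto simp: less_wellordered_copy_def)
  qed
qed (auto simp: less_eq_wellordered_copy_def less_wellordered_copy_def Rep_wellordered_copy_inject
    order.strict_iff_order)

end

abbreviation to_copy :: "(real, 'd::finite) vec \<Rightarrow> (real, 'd wellordered_copy) vec" where
  "to_copy x \<equiv> \<chi> i. x $ Rep_wellordered_copy i"

abbreviation from_copy :: "(real, 'd wellordered_copy) vec \<Rightarrow> (real, 'd::finite) vec" where
  "from_copy y \<equiv> \<chi> i. y $ Abs_wellordered_copy i"

lemma bounded_linear_copy: "bounded_linear to_copy" "bounded_linear from_copy"
  by (auto intro!: linear_linear[THEN iffD2] linearI simp: linear_conv_bounded_linear[symmetric] vec_eq_iff)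

lemma prod_Basis_cart:
  fixes x :: "(real, 'd::finite) vec"
  shows "(\<Prod>b\<in>Basis. x \<bullet> b) = (\<Prod>i\<in>UNIV. x $ i)"
  by (simp add: Basis_vec_def UNION_singleton_eq_range prod.reindex axis_eq_axis inj_on_def inner_axis)

lemma emeasure_lborel_box_cart:
  fixes l u :: "(real, 'd::finite) vec"
  assumes "\<And>i. l $ i \<le> u $ i"
  shows "emeasure lborel (box l u) = (\<Prod>i\<in>UNIV. u $ i - l $ i)"
proof -
  have "\<And>b. b \<in> Basis \<Longrightarrow> l \<bullet> b \<le> u \<bullet> b"
    using assms by (auto simp: Basis_vec_def inner_axis)
  hence "emeasure lborel (box l u) = (\<Prod>b\<in>Basis. (u - l) \<bullet> b)" by simp
  thus ?thesis by (simp add: prod_Basis_cart)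
qed

lemma lborel_eqI_cart:
  fixes M :: "(real, 'd::finite) vec measure"
  assumes "\<And>l u. (\<And>i. l $ i \<le> u $ i) \<Longrightarrow> emeasure M (box l u) = emeasure lborel (box l u)"
    and "sets M = sets borel"
  shows "M = lborel"
proof (rule lborel_eqI[symmetric])
  fix l u :: "(real, 'd) vec" assume lu: "\<And>b. b \<in> Basis \<Longrightarrow> l \<bullet> b \<le> u \<bullet> b"
  have "l $ i \<le> u $ i" for i using lu[of "axis i 1"] by (simp add: inner_axis)
  with assms(1) show "emeasure M (box l u) = (\<Prod>b\<in>Basis. (u - l) \<bullet> b)"
    using lu by simp
qed fact

lemma prod_copy: "(\<Prod>i\<in>UNIV. h (Rep_wellordered_copy i)) = (\<Prod>i\<in>(UNIV::'d::finite set). h i)"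
  by (rule prod.reindex_bij_witness[of _ Abs_wellordered_copy Rep_wellordered_copy])
     (auto simp: Abs_wellordered_copy_inverse Rep_wellordered_copy_inverse)

lemma distr_to_copy: "distr lborel borel (to_copy :: (real, 'd::finite) vec \<Rightarrow> _) = lborel"
proof (rule lborel_eqI_cart)
  fix l u :: "(real, 'd wellordered_copy) vec" assume lu: "\<And>i. l $ i \<le> u $ i"
  have meas: "(to_copy :: (real, 'd) vec \<Rightarrow> _) \<in> borel_measurable lborel"
    using borel_measurable_continuous_onI[OF linear_continuous_on[OF bounded_linear_copy(1)]] by simp
  have "(\<forall>i. l $ i < x $ Rep_wellordered_copy i \<and> x $ Rep_wellordered_copy i < u $ i) \<longleftrightarrow>
      (\<forall>i. l $ Abs_wellordered_copy i < x $ i \<and> x $ i < u $ Abs_wellordered_copy i)" for x :: "(real, 'd) vec"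
    by (metis UNIV_I Abs_wellordered_copy_inverse Rep_wellordered_copy_inverse)
  hence "to_copy -` box l u = (box (from_copy l) (from_copy u) :: (real, 'd) vec set)"
    by (auto simp: mem_box_cart)
  hence "emeasure (distr lborel borel (to_copy :: (real, 'd) vec \<Rightarrow> _)) (box l u)
      = emeasure lborel (box (from_copy l) (from_copy u) :: (real, 'd) vec set)"
    using meas by (subst emeasure_distr) auto
  also have "\<dots> = (\<Prod>i\<in>UNIV. from_copy u $ i - from_copy l $ i)"
    by (rule emeasure_lborel_box_cart) (simp add: lu)
  also have "\<dots> = (\<Prod>i\<in>UNIV. u $ i - l $ i)"
    by (subst prod_copy[symmetric]) (simp add: Rep_wellordered_copy_inverse)
  also have "\<dots> = emeasure lborel (box l u)"
    by (rule emeasure_lborel_box_cart[symmetric]) (rule lu)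
  finally show "emeasure (distr lborel borel (to_copy :: (real, 'd) vec \<Rightarrow> _)) (box l u) = emeasure lborel (box l u)" .
qed simp

lemma distr_from_copy: "distr lborel borel (from_copy :: _ \<Rightarrow> (real, 'd::finite) vec) = lborel"
proof -
  have m: "(to_copy :: (real, 'd) vec \<Rightarrow> _) \<in> borel_measurable borel"
    "(from_copy :: _ \<Rightarrow> (real, 'd) vec) \<in> borel_measurable borel"
    using borel_measurable_continuous_onI[OF linear_continuous_on[OF bounded_linear_copy(1)]]
      borel_measurable_continuous_onI[OF linear_continuous_on[OF bounded_linear_copy(2)]] by simp_all
  have "distr lborel borel (from_copy :: _ \<Rightarrow> (real, 'd) vec)
      = distr (distr lborel borel (to_copy :: (real, 'd) vec \<Rightarrow> _)) borel from_copy"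
    by (simp add: distr_to_copy)
  also have "\<dots> = distr lborel borel (\<lambda>x::(real, 'd) vec. x)"
    using m by (subst distr_distr) (auto simp: o_def Abs_wellordered_copy_inverse)
  finally show ?thesis by (simp add: distr_id2)
qed

text \<open>The preimage of a box under \<open>f\<close> is its image under the inverse \<open>g\<close>, whose Jacobian determinant is
  \<open>1\<close>.\<close>

lemma distr_lborel_wellorder:
  fixes f g :: "(real, 'd::{finite,wellorder}) vec \<Rightarrow> (real, 'd) vec"
  assumes fg: "\<And>x. f (g x) = x" "\<And>x. g (f x) = x"
    and cont: "continuous_on UNIV f"
    and der: "\<And>x. (g has_derivative g' x) (at x)"
    and tri: "\<And>x. unit_lower_triangular (g' x)"
  shows "distr lborel borel f = lborel"
proof (rule lborel_eqI_cart)
  fix l u :: "(real, 'd) vec" assume lu: "\<And>i. l $ i \<le> u $ i"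
  let ?B = "box l u"
  have m: "f \<in> borel_measurable lborel"
    using borel_measurable_continuous_onI[OF cont] by simp
  have det: "\<bar>det (matrix (g' x))\<bar> = 1" for x
    using det_unit_lower_triangular[OF tri] by simp
  have inj: "inj_on g ?B" using fg(1) by (metis inj_onI)
  have "((\<lambda>x. 1::real) has_integral measure lebesgue ?B) ?B"
    by (metis fmeasurable_box has_integral_iff integrable_on_const lmeasure_integral lmeasurable_box)
  hence *: "g ` ?B \<in> lmeasurable \<and> measure lebesgue (g ` ?B) = measure lebesgue ?B"
    using has_measure_differentiable_image[of ?B g g' "measure lebesgue ?B"] der inj
    by (simp add: det has_derivative_at_withinI)
  have img: "f -` ?B = g ` ?B" using fg by (auto simp: image_iff) metis
  have b: "g ` ?B \<in> sets borel"
    using measurable_sets[OF m, of ?B] by (simp add: img)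
  have "emeasure (distr lborel borel f) ?B = emeasure lborel (g ` ?B)"
    using m by (subst emeasure_distr) (auto simp: img)
  also have "\<dots> = emeasure lebesgue (g ` ?B)" using b by simp
  also have "\<dots> = emeasure lebesgue ?B"
    using * by (metis emeasure_eq_measure2 fmeasurable_box lmeasurable_box)
  finally show "emeasure (distr lborel borel f) ?B = emeasure lborel ?B" by simp
qed simp

lemma distr_lborel_unit_lower_triangular:
  fixes f g :: "(real, 'd::{finite,linorder}) vec \<Rightarrow> (real, 'd) vec"
  assumes fg: "\<And>x. f (g x) = x" "\<And>x. g (f x) = x"
    and cont: "continuous_on UNIV f"
    and der: "\<And>x. (g has_derivative g' x) (at x)"
    and tri: "\<And>x. unit_lower_triangular (g' x)"
  shows "distr lborel borel f = lborel"
proof -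
  define F where "F y = to_copy (f (from_copy y))" for y
  define G where "G y = to_copy (g (from_copy y))" for y
  define G' where "G' y v = to_copy (g' (from_copy y) (from_copy v))" for y v
  have cont_copy: "continuous_on UNIV (to_copy :: (real, 'd) vec \<Rightarrow> _)"
    "continuous_on UNIV (from_copy :: _ \<Rightarrow> (real, 'd) vec)"
    by (intro linear_continuous_on bounded_linear_copy)+
  have mf: "f \<in> borel_measurable borel" using borel_measurable_continuous_onI[OF cont] by simp
  have mc: "(to_copy :: (real, 'd) vec \<Rightarrow> _) \<in> borel_measurable borel"
    "(from_copy :: _ \<Rightarrow> (real, 'd) vec) \<in> borel_measurable borel"
    using cont_copy borel_measurable_continuous_onI by auto
  have contF: "continuous_on UNIV F"
    unfolding F_def
    by (rule continuous_on_compose2[OF cont_copy(1)], rule continuous_on_compose2[OF cont cont_copy(2)]) auto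
  have derG: "(G has_derivative G' y) (at y)" for y
    unfolding G_def G'_def
    by (rule has_derivative_compose[OF has_derivative_compose[OF
           bounded_linear_imp_has_derivative[OF bounded_linear_copy(2)] der]
           bounded_linear_imp_has_derivative[OF bounded_linear_copy(1)]])
  have triG: "unit_lower_triangular (G' y)" for y
    unfolding unit_lower_triangular_def
  proof (intro allI impI)
    fix i j :: "'d wellordered_copy" assume ij: "i \<le> j"
    have "from_copy (axis j 1) = (axis (Rep_wellordered_copy j) 1 :: (real, 'd) vec)"
      by (auto simp: axis_def vec_eq_iff Abs_wellordered_copy_inverse Rep_wellordered_copy_inverse)
    thus "G' y (axis j 1) $ i = (if i = j then 1 else 0)"
      using tri[of "from_copy y"] ij
      by (auto simp: G'_def unit_lower_triangular_def less_eq_wellordered_copy_def Rep_wellordered_copy_inject)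
  qed
  have "distr lborel borel F = lborel"
    by (rule distr_lborel_wellorder[OF _ _ contF derG triG]) (simp_all add: F_def G_def fg Abs_wellordered_copy_inverse Rep_wellordered_copy_inverse)
  hence F: "distr (distr lborel borel F) borel (from_copy :: _ \<Rightarrow> (real, 'd) vec) = lborel"
    by (simp add: distr_from_copy)
  have "distr lborel borel f = distr (distr lborel borel from_copy) borel f"
    by (simp add: distr_from_copy)
  also have "\<dots> = distr lborel borel (\<lambda>y. f (from_copy y))"
    using mf mc by (subst distr_distr) (auto simp: o_def)
  also have "(\<lambda>y. f (from_copy y)) = from_copy \<circ> F"
    by (simp add: F_def o_def Abs_wellordered_copy_inverse)
  also have "distr lborel borel (from_copy \<circ> F) = distr (distr lborel borel F) borel (from_copy :: _ \<Rightarrow> (real, 'd) vec)"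
    using borel_measurable_continuous_onI[OF contF] mc by (subst distr_distr) auto
  finally show ?thesis using F by simp
qed

context nilpotent_C2_group
begin

lemma lborel_left_translation: "distr lborel borel (mul p) = lborel"
  by (rule distr_lborel_unit_lower_triangular[where g = "mul (- p)" and g' = "dL (- p)"])
     (simp_all add: has_derivative_left_translation unit_lower_triangular_dL
       has_C1_derivativeD(3)[OF has_C1_derivative_left_translation])

end

section \<open>The Riemannian volume density of a left-invariant metric is constant\<close>

text \<open>The Gram matrix of the transformed basis is \<open>A\<^sup>T G A\<close>, with \<open>A\<close> the matrix of \<open>f\<close>.\<close>

lemma matrix_gram:
  fixes b :: "(real, 'd::finite) vec \<Rightarrow> (real, 'd) vec \<Rightarrow> real"
  assumes "bilinear b" "linear f"
  shows "(\<chi> i j. b (f (axis i 1)) (f (axis j 1)))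
     = transpose (matrix f) ** (\<chi> i j. b (axis i 1) (axis j 1)) ** matrix f"
proof -
  have ex: "f (axis i 1) = (\<Sum>l\<in>UNIV. matrix f $ l $ i *\<^sub>R axis l 1)" for i
    using basis_expansion[of "f (axis i 1)"] by (simp add: scalar_mult_eq_scaleR matrix_def)
  have l: "linear (b x)" "linear (\<lambda>x. b x y)" for x y using assms(1) by (auto simp: bilinear_def)
  have "b (f (axis i 1)) (f (axis j 1))
      = (\<Sum>m\<in>UNIV. (\<Sum>l\<in>UNIV. matrix f $ l $ i * b (axis l 1) (axis m 1)) * matrix f $ m $ j)" for i j
  proof -
    have "b (f (axis i 1)) (f (axis j 1)) = (\<Sum>m\<in>UNIV. matrix f $ m $ j * b (f (axis i 1)) (axis m 1))"
      by (subst ex[of j]) (simp add: linear_sum[OF l(1)] linear_scale[OF l(1)])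
    also have "\<dots> = (\<Sum>m\<in>UNIV. matrix f $ m $ j * (\<Sum>l\<in>UNIV. matrix f $ l $ i * b (axis l 1) (axis m 1)))"
      by (subst ex[of i]) (simp add: linear_sum[OF l(2)] linear_scale[OF l(2)])
    finally show ?thesis by (simp add: mult.commute)
  qed
  thus ?thesis by (simp add: matrix_matrix_mult_def transpose_def vec_eq_iff)
qed

lemma det_gram_nonzero:
  fixes b :: "(real, 'd::finite) vec \<Rightarrow> (real, 'd) vec \<Rightarrow> real"
  assumes "inner_product b"
  shows "det (\<chi> i j. b (axis i 1) (axis j 1)) \<noteq> 0"
proof
  let ?A = "\<chi> i j. b (axis i 1) (axis j 1)"
  have bil: "linear (b x)" "linear (\<lambda>x. b x y)" for x y
    using assms by (auto simp: inner_product_def bilinear_def)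
  assume "det ?A = 0"
  then obtain v where v: "v \<noteq> 0" "?A *v v = 0"
    using invertible_det_nz[of ?A] matrix_left_invertible_ker[of ?A]
    by (auto simp: invertible_left_inverse)
  have vx: "v = (\<Sum>l\<in>UNIV. v $ l *\<^sub>R axis l 1)"
    using basis_expansion[of v] by (simp add: scalar_mult_eq_scaleR)
  have "b (axis i 1) v = (?A *v v) $ i" for i
    by (subst vx) (simp add: linear_sum[OF bil(1)] linear_scale[OF bil(1)] matrix_vector_mult_def mult.commute)
  hence "b (axis i 1) v = 0" for i using v by simp
  hence "b (\<Sum>l\<in>UNIV. v $ l *\<^sub>R axis l 1) v = 0"
    by (simp add: linear_sum[OF bil(2)] linear_scale[OF bil(2)])
  hence "b v v = 0" using vx by simp
  moreover have "0 < b v v" using assms v(1) by (simp add: inner_product_def)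
  ultimately show False by simp
qed

text \<open>By left-invariance the Gram matrix at \<open>0\<close> is congruent to that at \<open>p\<close>, by the matrix of the
  differential of a left translation, which has determinant \<open>1\<close>.\<close>

lemma (in nilpotent_C2_group) volume_density_const:
  assumes ip: "\<And>p. inner_product (g p)"
    and inv: "\<And>p q u v. g (mul p q) (left_diff mul p q u) (left_diff mul p q v) = g q u v"
  shows "volume_density g p = volume_density g 0" "volume_density g 0 \<noteq> 0"
proof -
  have bil: "bilinear (g p)" using ip by (simp add: inner_product_def)
  have lin: "linear (dL p 0)" by (simp add: bounded_linear.linear blinfun.bounded_linear_right)
  have "(\<chi> i j. g 0 (axis i 1) (axis j 1)) = (\<chi> i j. g p (dL p 0 (axis i 1)) (dL p 0 (axis j 1)))"
    using inv[of p 0] by (simp add: left_diff_eq)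
  also have "det \<dots> = det (\<chi> i j. g p (axis i 1) (axis j 1))"
    by (simp add: matrix_gram[OF bil lin] det_mul det_transpose
         det_unit_lower_triangular[OF unit_lower_triangular_dL])
  finally show "volume_density g p = volume_density g 0" by (simp add: volume_density_def)
  show "volume_density g 0 \<noteq> 0"
    using det_gram_nonzero[OF ip[of 0]] by (simp add: volume_density_def)
qed

lemma (in nilpotent_C2_group) riem_div_eq:
  assumes ip: "\<And>p. inner_product (g p)"
    and inv: "\<And>p q u v. g (mul p q) (left_diff mul p q u) (left_diff mul p q v) = g q u v"
    and U: "(U has_derivative U') (at p)"
  shows "riem_div g U p = (\<Sum>b\<in>Basis. U' b \<bullet> b)"
proof -
  let ?c = "volume_density g 0"
  have "frechet_derivative (\<lambda>q. volume_density g q * U q $ i) (at p) = (\<lambda>v. ?c * U' v $ i)" for i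
  proof (rule frechet_derivative_at[symmetric])
    have "((\<lambda>q. ?c * U q $ i) has_derivative (\<lambda>v. ?c * U' v $ i)) (at p)"
      by (intro has_derivative_mult_right bounded_linear.has_derivative[OF bounded_linear_vec_nth U])
    moreover have "(\<lambda>q. volume_density g q * U q $ i) = (\<lambda>q. ?c * U q $ i)"
      by (intro ext arg_cong2[where f = "(*)"] volume_density_const(1)[OF ip inv] refl)
    ultimately show "((\<lambda>q. volume_density g q * U q $ i) has_derivative (\<lambda>v. ?c * U' v $ i)) (at p)" by simp
  qed
  hence "riem_div g U p = (\<Sum>i\<in>UNIV. ?c * U' (axis i 1) $ i) / ?c"
    using volume_density_const(1)[OF ip inv, of p] by (simp add: riem_div_def)
  also have "\<dots> = (\<Sum>i\<in>UNIV. U' (axis i 1) $ i)"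
    using volume_density_const(2)[OF ip inv] by (simp flip: sum_distrib_left)
  also have "\<dots> = (\<Sum>b\<in>Basis. U' b \<bullet> b)"
    by (simp add: Basis_vec_def UNION_singleton_eq_range sum.reindex axis_eq_axis inj_on_def inner_axis)
  finally show ?thesis .
qed

section \<open>Divergence and integration by parts\<close>

definition C1_compact :: "('a::euclidean_space \<Rightarrow> 'b::real_normed_vector) \<Rightarrow> bool" where
  "C1_compact f \<longleftrightarrow> (\<exists>f'. has_C1_derivative f f') \<and> bounded {x. f x \<noteq> 0}"

definition divergence :: "('a::euclidean_space \<Rightarrow> 'a) \<Rightarrow> 'a \<Rightarrow> real" where
  "divergence U x = (\<Sum>b\<in>Basis. frechet_derivative U (at x) b \<bullet> b)"

lemma divergence_eq:
  "has_C1_derivative U U' \<Longrightarrow> divergence U x = (\<Sum>b\<in>Basis. U' x b \<bullet> b)"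
  by (simp add: divergence_def has_C1_derivativeD(5))

lemma continuous_on_divergence:
  assumes "has_C1_derivative U U'"
  shows "continuous_on S (divergence U)"
proof -
  have "continuous_on S (\<lambda>x. \<Sum>b\<in>Basis. U' x b \<bullet> b)"
    by (intro continuous_intros has_C1_derivativeD(2)[OF assms])
  thus ?thesis using divergence_eq[OF assms] by (simp add: fun_eq_iff cong: continuous_on_cong)
qed

lemma divergence_add:
  assumes "has_C1_derivative U U'" "has_C1_derivative W W'"
  shows "divergence (\<lambda>x. U x + W x) x = divergence U x + divergence W x"
  by (simp add: divergence_eq[OF has_C1_derivative_add[OF assms]] divergence_eq[OF assms(1)]
      divergence_eq[OF assms(2)] blinfun.add_left inner_add_left sum.distrib)

lemma divergence_diff:
  assumes "has_C1_derivative U U'" "has_C1_derivative W W'"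
  shows "divergence (\<lambda>x. U x - W x) x = divergence U x - divergence W x"
  by (simp add: divergence_eq[OF has_C1_derivative_diff[OF assms]] divergence_eq[OF assms(1)]
      divergence_eq[OF assms(2)] blinfun.diff_left inner_diff_left sum_subtractf)

lemma divergence_minus:
  assumes "has_C1_derivative U U'"
  shows "divergence (\<lambda>x. - U x) x = - divergence U x"
  by (simp add: divergence_eq[OF has_C1_derivative_minus[OF assms]] divergence_eq[OF assms(1)]
      blinfun.minus_left sum_negf)

lemma divergence_scaleR:
  assumes a: "has_C1_derivative a a'" and U: "has_C1_derivative U U'"
  shows "divergence (\<lambda>x. a x *\<^sub>R U x) x = a x * divergence U x + a' x (U x)"
proof -
  have "a' x (U x) = a' x (\<Sum>b\<in>Basis. (U x \<bullet> b) *\<^sub>R b)" by (simp add: euclidean_representation)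
  hence "a' x (U x) = (\<Sum>b\<in>Basis. a' x b * (U x \<bullet> b))"
    by (simp add: blinfun.sum_right blinfun.scaleR_right mult.commute)
  thus ?thesis
    by (simp add: divergence_eq[OF has_C1_derivative_scaleR[OF assms]] divergence_eq[OF U]
        blinfun.add_left blinfun.scaleR_left inner_add_left sum.distrib sum_distrib_left)
qed

lemma continuous_on_blinfun_apply_const:
  "has_C1_derivative f f' \<Longrightarrow> continuous_on S (\<lambda>x. f' x v)"
  by (intro continuous_intros has_C1_derivativeD(2))

lemma C1_derivative_zero_outside:
  assumes f: "has_C1_derivative f f'" and S: "bounded {x. f x \<noteq> 0}"
  obtains R where "0 < R" "\<And>x. R < norm x \<Longrightarrow> f x = 0" "\<And>x. R < norm x \<Longrightarrow> f' x = 0"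
proof -
  obtain R where R: "0 < R" "\<And>x. f x \<noteq> 0 \<Longrightarrow> norm x \<le> R"
    using S unfolding bounded_pos by auto
  have "f' x = 0" if x: "R < norm x" for x
  proof -
    have "open {x::'a. R < norm x}" by (intro open_Collect_less continuous_intros)
    moreover have "f y = 0" if "R < norm y" for y using R(2)[of y] that by force
    ultimately have "((\<lambda>_. 0) has_derivative f' x) (at x)"
      using x by (intro has_derivative_transform_within_open[OF has_C1_derivativeD(1)[OF f, of x UNIV],
            of "{x. R < norm x}"]) auto
    from has_derivative_unique[OF this has_derivative_const] show ?thesis
      by (intro blinfun_eqI) (simp add: zero_blinfun.rep_eq)
  qed
  thus thesis using R by (intro that[of R]) force+
qed

lemma bounded_support_divergence:
  assumes "C1_compact U"
  shows "bounded {x. divergence U x \<noteq> 0}"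
proof -
  obtain U' where U': "has_C1_derivative U U'" using assms by (auto simp: C1_compact_def)
  obtain R where "\<And>x. R < norm x \<Longrightarrow> U' x = 0"
    using C1_derivative_zero_outside[OF U'] assms unfolding C1_compact_def by metis
  hence "\<And>x. divergence U x \<noteq> 0 \<Longrightarrow> norm x \<le> R"
    by (simp add: divergence_eq[OF U']) (metis (no_types, lifting) inner_zero_left linorder_not_less sum.neutral zero_blinfun.rep_eq)
  thus ?thesis unfolding bounded_iff by auto
qed

lemma integrable_continuous_bounded_support:
  fixes h :: "'a::euclidean_space \<Rightarrow> 'b::{banach,second_countable_topology}"
  assumes "continuous_on UNIV h" "bounded {x. h x \<noteq> 0}"
  shows "integrable lborel h"
proof -
  obtain R where R: "\<And>x. h x \<noteq> 0 \<Longrightarrow> norm x \<le> R" using assms(2) unfolding bounded_iff by auto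
  have "integrable lborel (\<lambda>x. indicator (cball 0 R) x *\<^sub>R h x)"
    by (rule borel_integrable_compact) (use assms(1) continuous_on_subset in auto)
  moreover have "indicator (cball 0 R) x *\<^sub>R h x = h x" for x
    using R[of x] by (auto simp: indicator_def)
  ultimately show ?thesis by simp
qed

lemma bounded_continuous_bounded_support:
  fixes h :: "'a::euclidean_space \<Rightarrow> 'b::real_normed_vector"
  assumes "continuous_on UNIV h" "bounded {x. h x \<noteq> 0}"
  obtains M where "0 \<le> M" "\<And>x. norm (h x) \<le> M"
proof -
  obtain R where R: "\<And>x. h x \<noteq> 0 \<Longrightarrow> norm x \<le> R" using assms(2) unfolding bounded_iff by auto
  have "compact (h ` cball 0 R)"
    by (intro compact_continuous_image continuous_on_subset[OF assms(1)]) auto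
  then obtain M where M: "\<And>x. x \<in> cball 0 R \<Longrightarrow> norm (h x) \<le> M"
    by (metis bounded_iff compact_imp_bounded imageI)
  have "norm (h x) \<le> max M 0" for x
    using R[of x] M[of x] by (cases "h x = 0") (auto simp: le_max_iff_disj)
  thus thesis by (intro that[of "max M 0"]) auto
qed

lemma integrable_bounded_mult:
  fixes h f :: "'a::euclidean_space \<Rightarrow> real"
  assumes f: "f \<in> borel_measurable borel" "\<And>x. \<bar>f x\<bar> \<le> B"
    and h: "integrable lborel h"
  shows "integrable lborel (\<lambda>x. f x * h x)"
proof (rule Bochner_Integration.integrable_bound)
  show "integrable lborel (\<lambda>x. B * h x)" using h by simp
  have "0 \<le> B" using f(2)[of undefined] by linarith
  thus "AE x in lborel. norm (f x * h x) \<le> norm (B * h x)"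
    using f(2) by (intro always_eventually allI) (simp add: abs_mult mult_right_mono)
qed (use f h in measurable)

text \<open>The difference quotients of \<open>\<phi>\<close> in direction \<open>b\<close> have integral zero, because Lebesgue measure is
  invariant under vector addition; they converge dominatedly to the derivative.\<close>

lemma integral_derivative_zero:
  fixes \<phi> :: "'a::euclidean_space \<Rightarrow> real"
  assumes d: "has_C1_derivative \<phi> \<phi>'" and S: "bounded {x. \<phi> x \<noteq> 0}"
  shows "integral\<^sup>L lborel (\<lambda>x. \<phi>' x b) = 0"
proof -
  obtain R where R: "0 < R" "\<And>x. R < norm x \<Longrightarrow> \<phi> x = 0" "\<And>x. R < norm x \<Longrightarrow> \<phi>' x = 0"
    using C1_derivative_zero_outside[OF d S] by metis
  have "bounded {x. \<phi>' x \<noteq> 0}" unfolding bounded_iff using R(3) by (metis mem_Collect_eq linorder_not_le)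
  then obtain M where M: "0 \<le> M" "\<And>x. norm (\<phi>' x) \<le> M"
    using bounded_continuous_bounded_support[OF has_C1_derivativeD(2)[OF d]] by metis
  have lip: "\<bar>\<phi> (x + v) - \<phi> x\<bar> \<le> M * norm v" for x v
    using differentiable_bound[OF convex_UNIV has_C1_derivativeD(1)[OF d], of M "x + v" x] M(2)
    by (simp add: norm_blinfun.rep_eq)
  define h where "h n = inverse (real (Suc n))" for n
  have h: "0 < h n" "h n \<le> 1" for n by (auto simp: h_def field_simps)
  have h0: "filterlim h (at 0) sequentially"
    unfolding h_def filterlim_at using LIMSEQ_inverse_real_of_nat by auto
  define q where "q n x = (\<phi> (x + h n *\<^sub>R b) - \<phi> x) / h n" for n x
  have int\<phi>: "integrable lborel \<phi>"
    by (rule integrable_continuous_bounded_support[OF has_C1_derivativeD(3)[OF d] S])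
  have shift: "integrable lborel (\<lambda>x. \<phi> (x + v))" "integral\<^sup>L lborel (\<lambda>x. \<phi> (x + v)) = integral\<^sup>L lborel \<phi>" for v
  proof -
    have m: "\<phi> \<in> borel_measurable borel"
      using borel_measurable_continuous_onI[OF has_C1_derivativeD(3)[OF d]] .
    have "distr lborel borel ((+) v) = lborel" by (rule lborel_distr_plus)
    thus "integrable lborel (\<lambda>x. \<phi> (x + v))" "integral\<^sup>L lborel (\<lambda>x. \<phi> (x + v)) = integral\<^sup>L lborel \<phi>"
      using int\<phi> integrable_distr_eq[of "(+) v" lborel borel \<phi>] integral_distr[of "(+) v" lborel borel \<phi>] m
      by (simp_all add: add.commute)
  qed
  have "(\<lambda>n. integral\<^sup>L lborel (q n)) \<longlonglongrightarrow> integral\<^sup>L lborel (\<lambda>x. \<phi>' x b)"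
  proof (rule integral_dominated_convergence)
    show "(\<lambda>x. \<phi>' x b) \<in> borel_measurable lborel"
      using borel_measurable_continuous_onI[OF continuous_on_blinfun_apply_const[OF d]] by simp
    show "q n \<in> borel_measurable lborel" for n
      unfolding q_def using shift(1)[of "h n *\<^sub>R b"] int\<phi> by (intro borel_measurable_divide) auto
    show "integrable lborel (\<lambda>x. (M * norm b) * indicator (cball 0 (R + norm b)) x :: real)"
      using emeasure_lborel_cball_finite[of 0 "R + norm b"]
      by (intro integrable_mult_right integrable_real_indicator) auto
    show "AE x in lborel. norm (q n x) \<le> (M * norm b) * indicator (cball 0 (R + norm b)) x" for n
    proof (intro always_eventually allI)
      fix x
      show "norm (q n x) \<le> (M * norm b) * indicator (cball 0 (R + norm b)) x"
      proof (cases "norm x \<le> R + norm b")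
        case True
        have "\<bar>\<phi> (x + h n *\<^sub>R b) - \<phi> x\<bar> \<le> M * norm b * h n"
          using lip[of x "h n *\<^sub>R b"] h[of n] by (simp add: mult_ac)
        thus ?thesis using True h[of n] by (simp add: q_def field_simps)
      next
        case False
        have "norm (h n *\<^sub>R b) \<le> norm b" using h[of n] by (simp add: mult_left_le_one_le)
        hence "R < norm (x + h n *\<^sub>R b)"
          using False norm_triangle_ineq2[of x "- (h n *\<^sub>R b)"] by simp
        moreover have "R < norm x" using False norm_ge_zero[of b] by linarith
        ultimately show ?thesis using R(2) M(1) by (simp add: q_def)
      qed
    qed
    show "AE x in lborel. (\<lambda>n. q n x) \<longlonglongrightarrow> \<phi>' x b"
    proof (intro always_eventually allI)
      fix x
      have "((\<lambda>s. \<phi> (x + s *\<^sub>R b)) has_derivative (\<lambda>s. \<phi>' (x + 0 *\<^sub>R b) (s *\<^sub>R b))) (at 0)"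
        by (rule has_derivative_compose[OF _ has_C1_derivativeD(1)[OF d]]) (auto intro!: derivative_eq_intros)
      moreover have "(\<lambda>s. \<phi>' (x + 0 *\<^sub>R b) (s *\<^sub>R b)) = (*) (\<phi>' x b)"
        by (rule ext) (simp add: blinfun.scaleR_right)
      ultimately have "((\<lambda>s. \<phi> (x + s *\<^sub>R b)) has_real_derivative \<phi>' x b) (at 0)"
        by (simp add: has_field_derivative_def)
      hence "((\<lambda>s. (\<phi> (x + s *\<^sub>R b) - \<phi> x) / s) \<longlongrightarrow> \<phi>' x b) (at 0)"
        by (simp add: DERIV_def)
      from filterlim_compose[OF this h0] show "(\<lambda>n. q n x) \<longlonglongrightarrow> \<phi>' x b" by (simp add: q_def)
    qed
  qed
  moreover have "integral\<^sup>L lborel (q n) = 0" for n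
    unfolding q_def using shift int\<phi> by simp
  ultimately show ?thesis by (simp add: LIMSEQ_const_iff)
qed

lemma integral_divergence_zero:
  assumes "C1_compact U"
  shows "integral\<^sup>L lborel (divergence U) = 0"
proof -
  obtain U' where U': "has_C1_derivative U U'" using assms by (auto simp: C1_compact_def)
  have S: "bounded {x. U x \<noteq> 0}" using assms by (simp add: C1_compact_def)
  have Z: "integral\<^sup>L lborel (\<lambda>x. U' x b \<bullet> b) = 0" for b
  proof -
    obtain g' where g': "has_C1_derivative (\<lambda>x. U x \<bullet> b) g'" "\<And>x v. g' x v = U' x v \<bullet> b"
      using has_C1_derivative_inner_const[OF U'] by metis
    have "bounded {x. U x \<bullet> b \<noteq> 0}" by (rule bounded_subset[OF S]) auto
    from integral_derivative_zero[OF g'(1) this, of b] show ?thesis by (simp add: g')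
  qed
  obtain R where R: "\<And>x. R < norm x \<Longrightarrow> U' x = 0"
    using C1_derivative_zero_outside[OF U' S] by metis
  have "integrable lborel (\<lambda>x. U' x b \<bullet> b)" for b
  proof (rule integrable_continuous_bounded_support)
    show "continuous_on UNIV (\<lambda>x. U' x b \<bullet> b)" by (intro continuous_intros has_C1_derivativeD(2)[OF U'])
    show "bounded {x. U' x b \<bullet> b \<noteq> 0}"
      unfolding bounded_iff using R by (intro exI[of _ R]) (force simp: not_less[symmetric])
  qed
  hence "integral\<^sup>L lborel (\<lambda>x. \<Sum>b\<in>Basis. U' x b \<bullet> b) = (\<Sum>b\<in>Basis. integral\<^sup>L lborel (\<lambda>x. U' x b \<bullet> b))"
    by (intro Bochner_Integration.integral_sum)
  thus ?thesis using divergence_eq[OF U'] Z by (simp add: fun_eq_iff[symmetric] cong: Bochner_Integration.integral_cong)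
qed

lemma integral_by_parts:
  assumes a: "has_C1_derivative a a'" and U: "C1_compact U"
  shows "integrable lborel (\<lambda>x. a x * divergence U x)" "integrable lborel (\<lambda>x. a' x (U x))"
    "integral\<^sup>L lborel (\<lambda>x. a x * divergence U x) = - integral\<^sup>L lborel (\<lambda>x. a' x (U x))"
proof -
  obtain U' where U': "has_C1_derivative U U'" using U by (auto simp: C1_compact_def)
  show i1: "integrable lborel (\<lambda>x. a x * divergence U x)"
    by (rule integrable_continuous_bounded_support)
       (auto intro!: continuous_intros has_C1_derivativeD(3)[OF a] continuous_on_divergence[OF U']
          bounded_subset[OF bounded_support_divergence[OF U]])
  show i2: "integrable lborel (\<lambda>x. a' x (U x))"
    by (rule integrable_continuous_bounded_support)
       (use U in \<open>auto intro!: continuous_intros has_C1_derivativeD(2)[OF a] has_C1_derivativeD(3)[OF U']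
          intro: bounded_subset simp: C1_compact_def blinfun.zero_right\<close>)
  have "C1_compact (\<lambda>x. a x *\<^sub>R U x)"
    using U has_C1_derivative_scaleR[OF a U'] bounded_subset[of "{x. U x \<noteq> 0}" "{x. a x *\<^sub>R U x \<noteq> 0}"]
    unfolding C1_compact_def by auto
  from integral_divergence_zero[OF this]
  have "integral\<^sup>L lborel (\<lambda>x. a x * divergence U x + a' x (U x)) = 0"
    using divergence_scaleR[OF a U'] by (simp cong: Bochner_Integration.integral_cong)
  thus "integral\<^sup>L lborel (\<lambda>x. a x * divergence U x) = - integral\<^sup>L lborel (\<lambda>x. a' x (U x))"
    using i1 i2 by simp
qed

section \<open>Bump functions\<close>

lemma has_C1_derivative_real:
  assumes "\<And>t. (f has_real_derivative f' t) (at t)" "continuous_on UNIV f'"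
  shows "has_C1_derivative f (\<lambda>t. blinfun_scaleR_left (f' t))"
proof -
  have "(f has_derivative blinfun_scaleR_left (f' t)) (at t)" for t
  proof -
    have "blinfun_apply (blinfun_scaleR_left (f' t)) = (*) (f' t)" by (rule ext) simp
    thus ?thesis using assms(1)[of t] by (simp add: has_field_derivative_def)
  qed
  thus ?thesis
    unfolding has_C1_derivative_def
    using bounded_linear.continuous_on[OF bounded_linear_blinfun_scaleR_left assms(2)] by auto
qed

text \<open>This function vanishes on a half-line, is positive on the other one and is continuously
  differentiable.  Bumps and cutoff functions are compositions of it with itself and polynomials.\<close>

definition sq_pos :: "real \<Rightarrow> real" where
  "sq_pos t = (max 0 t)\<^sup>2"

lemma DERIV_sq_pos: "(sq_pos has_real_derivative 2 * max 0 t) (at t)"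
proof (cases t "0::real" rule: linorder_cases)
  case less
  have "((\<lambda>_. 0) has_real_derivative 2 * max 0 t) (at t)" using less by simp
  thus ?thesis
    by (rule DERIV_cong_ev[THEN iffD1, rotated -1, OF _ refl _ refl])
       (use less eventually_nhds_in_open[of "{..<0}" t] in \<open>auto elim!: eventually_mono simp: sq_pos_def\<close>)
next
  case greater
  have "((\<lambda>t. t\<^sup>2) has_real_derivative 2 * max 0 t) (at t)"
    using greater by (auto intro!: derivative_eq_intros)
  thus ?thesis
    by (rule DERIV_cong_ev[THEN iffD1, rotated -1, OF _ refl _ refl])
       (use greater eventually_nhds_in_open[of "{0<..}" t] in \<open>auto elim!: eventually_mono simp: sq_pos_def\<close>)
next
  case equal
  have "((\<lambda>h. sq_pos h / h) \<longlongrightarrow> 0) (at 0)"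
  proof (rule Lim_null_comparison)
    show "\<forall>\<^sub>F h in at 0. norm (sq_pos h / h) \<le> \<bar>h\<bar>"
      by (intro always_eventually allI)
         (auto simp: sq_pos_def max_def power2_eq_square divide_simps)
    show "((\<lambda>h::real. \<bar>h\<bar>) \<longlongrightarrow> 0) (at 0)"
      using tendsto_rabs[OF tendsto_ident_at[of "0::real" UNIV]] by simp
  qed
  thus ?thesis using equal by (simp add: DERIV_def sq_pos_def)
qed

lemma has_C1_derivative_sq_pos: "has_C1_derivative sq_pos (\<lambda>t. blinfun_scaleR_left (2 * max 0 t))"
  by (rule has_C1_derivative_real[OF DERIV_sq_pos]) (intro continuous_intros)

lemma sq_pos_nonneg: "0 \<le> sq_pos t"
  by (simp add: sq_pos_def)

lemma has_C1_derivative_sqdist: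
  "has_C1_derivative (\<lambda>x. c - (x - a) \<bullet> (x - a)) (\<lambda>x. - (2 *\<^sub>R blinfun_inner_right (x - a)))"
  unfolding has_C1_derivative_def
  by (auto intro!: derivative_eq_intros continuous_intros
      bounded_linear.continuous_on[OF bounded_linear_blinfun_inner_right]
      simp: blinfun.minus_left blinfun.scaleR_left inner_commute)

definition bump :: "'a::euclidean_space \<Rightarrow> real \<Rightarrow> 'a \<Rightarrow> real" where
  "bump a \<rho> x = sq_pos (\<rho>\<^sup>2 - (x - a) \<bullet> (x - a))"

lemma bump_pos_iff:
  assumes "0 < \<rho>"
  shows "0 < bump a \<rho> x \<longleftrightarrow> dist a x < \<rho>"
proof -
  have "(x - a) \<bullet> (x - a) < \<rho>\<^sup>2 \<longleftrightarrow> dist a x < \<rho>"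
    unfolding power2_norm_eq_inner[symmetric] dist_norm norm_minus_commute[of a x]
    using assms by (meson less_imp_le norm_ge_zero power2_less_imp_less power_strict_mono zero_less_numeral)
  thus ?thesis by (auto simp: bump_def sq_pos_def max_def)
qed

lemma bump_nonneg: "0 \<le> bump a \<rho> x"
  by (simp add: bump_def sq_pos_nonneg)

lemma C1_compact_bump:
  assumes "0 < \<rho>"
  shows "C1_compact (bump a \<rho>)"
proof -
  have "bump a \<rho> x \<noteq> 0 \<Longrightarrow> x \<in> ball a \<rho>" for x
    using bump_pos_iff[OF assms, of a x] bump_nonneg[of a \<rho> x] by auto
  hence "{x. bump a \<rho> x \<noteq> 0} \<subseteq> ball a \<rho>" by auto
  moreover have "\<exists>f'. has_C1_derivative (bump a \<rho>) f'"
    unfolding bump_def[abs_def]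
    using has_C1_derivative_chain[OF has_C1_derivative_sqdist has_C1_derivative_sq_pos] by blast
  ultimately show ?thesis
    unfolding C1_compact_def using bounded_ball bounded_subset by blast
qed

lemma integral_bump_pos:
  fixes h :: "'a::euclidean_space \<Rightarrow> real"
  assumes "0 < \<rho>" and h: "continuous_on UNIV h" and pos: "\<And>x. dist a x < \<rho> \<Longrightarrow> 0 < h x"
  shows "0 < integral\<^sup>L lborel (\<lambda>x. bump a \<rho> x * h x)"
proof -
  have b: "continuous_on UNIV (bump a \<rho>)" "bounded {x. bump a \<rho> x \<noteq> 0}"
    using C1_compact_bump[OF assms(1), of a] has_C1_derivativeD(3) unfolding C1_compact_def by blast+
  have nonneg: "0 \<le> bump a \<rho> x * h x" for x
    using bump_nonneg[of a \<rho> x] bump_pos_iff[OF assms(1), of a x] pos[of x]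
    by (cases "bump a \<rho> x = 0") (auto intro!: mult_nonneg_nonneg less_imp_le)
  have int: "integrable lborel (\<lambda>x. bump a \<rho> x * h x)"
    by (rule integrable_continuous_bounded_support)
       (auto intro!: continuous_intros b h bounded_subset[OF b(2)])
  have "integral\<^sup>L lborel (\<lambda>x. bump a \<rho> x * h x) \<noteq> 0"
  proof
    assume "integral\<^sup>L lborel (\<lambda>x. bump a \<rho> x * h x) = 0"
    hence "AE x in lborel. bump a \<rho> x * h x = 0"
      using integral_nonneg_eq_0_iff_AE[OF int] nonneg by simp
    hence "AE x in lborel. x \<notin> ball a \<rho>"
    proof (rule eventually_mono)
      fix x assume "bump a \<rho> x * h x = 0"
      thus "x \<notin> ball a \<rho>"
        using bump_pos_iff[OF assms(1), of a x] pos[of x] by auto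
    qed
    hence "ball a \<rho> \<in> null_sets lborel"
      using AE_iff_null_sets[of "ball a \<rho>" lborel] by simp
    moreover have "\<not> negligible (ball a \<rho>)" using assms(1) by (simp add: open_not_negligible)
    ultimately show False
      using negligible_iff_null_sets null_sets_completionI by blast
  qed
  moreover have "0 \<le> integral\<^sup>L lborel (\<lambda>x. bump a \<rho> x * h x)"
    by (rule Bochner_Integration.integral_nonneg) (rule nonneg)
  ultimately show ?thesis by simp
qed

text \<open>If \<open>h\<close> were nonzero at \<open>a\<close>, its integral against a bump concentrated near \<open>a\<close> would be nonzero.\<close>

lemma continuous_eq_0_if_integrals_vanish:
  fixes h :: "'a::euclidean_space \<Rightarrow> real"
  assumes h: "continuous_on UNIV h"
    and Z: "\<And>\<phi>. C1_compact \<phi> \<Longrightarrow> integral\<^sup>L lborel (\<lambda>x. \<phi> x * h x) = 0"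
  shows "h a = 0"
proof -
  have *: "\<not> 0 < k a" if k: "continuous_on UNIV k"
    and Zk: "\<And>\<phi>. C1_compact \<phi> \<Longrightarrow> integral\<^sup>L lborel (\<lambda>x. \<phi> x * k x) = 0" for k :: "'a \<Rightarrow> real"
  proof
    assume pos: "0 < k a"
    have "isCont k a" using k by (simp add: continuous_on_eq_continuous_at)
    then obtain \<rho> where \<rho>: "0 < \<rho>" "\<And>x. dist x a < \<rho> \<Longrightarrow> dist (k x) (k a) < k a"
      using pos unfolding continuous_at_eps_delta by blast
    have kp: "0 < k x" if "dist a x < \<rho>" for x
      using \<rho>(2)[of x] that by (auto simp: dist_commute dist_real_def)
    from integral_bump_pos[of \<rho> k a, OF \<rho>(1) k kp] Zk[OF C1_compact_bump[OF \<rho>(1), of a]] show False by simp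
  qed
  have "\<not> 0 < h a" using *[OF h Z] .
  moreover have "\<not> 0 < - h a"
    by (rule *[of "\<lambda>x. - h x"]) (use h Z in \<open>auto intro!: continuous_intros\<close>)
  ultimately show ?thesis by linarith
qed

section \<open>Compactly supported maps\<close>

lemma has_C1_derivative_sum:
  assumes "finite I" "\<And>i. i \<in> I \<Longrightarrow> \<exists>f'. has_C1_derivative (f i) f'"
  shows "\<exists>f'. has_C1_derivative (\<lambda>x. \<Sum>i\<in>I. f i x) f'"
  using assms
proof (induction I rule: finite_induct)
  case empty
  show ?case using has_C1_derivative_const[of 0] by auto
next
  case (insert i I)
  then obtain f' s where "has_C1_derivative (f i) f'" "has_C1_derivative (\<lambda>x. \<Sum>i\<in>I. f i x) s" by blast
  from has_C1_derivative_add[OF this] show ?case using insert by auto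
qed

lemma has_C1_derivative_apply:
  fixes A :: "'c::real_normed_vector \<Rightarrow> 'a::euclidean_space \<Rightarrow>\<^sub>L 'b::real_normed_vector"
  assumes A: "has_C1_derivative A A'" and u: "has_C1_derivative u u'"
  shows "\<exists>f'. has_C1_derivative (\<lambda>x. A x (u x)) f'"
proof -
  have "\<exists>f'. has_C1_derivative (\<lambda>x. (u x \<bullet> b) *\<^sub>R A x b) f'" for b
  proof -
    have "bounded_linear (\<lambda>T::'a \<Rightarrow>\<^sub>L 'b. T b)" by (rule blinfun.bounded_linear_left)
    from has_C1_derivative_chain[OF A has_C1_derivative_bounded_linear[OF this]]
    show ?thesis using has_C1_derivative_inner_const[OF u, of b] has_C1_derivative_scaleR by blast
  qed
  hence "\<exists>f'. has_C1_derivative (\<lambda>x. \<Sum>b\<in>Basis. (u x \<bullet> b) *\<^sub>R A x b) f'"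
    by (intro has_C1_derivative_sum) auto
  moreover have "(\<Sum>b\<in>Basis. (u x \<bullet> b) *\<^sub>R A x b) = A x (u x)" for x
    unfolding blinfun.scaleR_right[symmetric] blinfun.sum_right[symmetric]
    by (simp add: euclidean_representation)
  ultimately show ?thesis by simp
qed

lemma C1_compactD:
  assumes "C1_compact f"
  shows "\<exists>f'. has_C1_derivative f f'" "bounded {x. f x \<noteq> 0}" "continuous_on S f"
  using assms has_C1_derivativeD(3) unfolding C1_compact_def by blast+

lemma C1_compact_add:
  assumes "C1_compact U" "C1_compact W"
  shows "C1_compact (\<lambda>x. U x + W x)"
proof -
  have "bounded {x. U x + W x \<noteq> 0}"
    by (rule bounded_subset[OF bounded_Un[THEN iffD2], of "{x. U x \<noteq> 0}" "{x. W x \<noteq> 0}"])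
       (use assms in \<open>auto simp: C1_compact_def\<close>)
  thus ?thesis using assms has_C1_derivative_add unfolding C1_compact_def by blast
qed

lemma C1_compact_minus: "C1_compact U \<Longrightarrow> C1_compact (\<lambda>x. - U x)"
  unfolding C1_compact_def using has_C1_derivative_minus by auto

lemma C1_compact_scaleR:
  assumes "has_C1_derivative a a'" "C1_compact U"
  shows "C1_compact (\<lambda>x. a x *\<^sub>R U x)"
proof -
  have "bounded {x. a x *\<^sub>R U x \<noteq> 0}"
    by (rule bounded_subset[OF C1_compactD(2)[OF assms(2)]]) auto
  thus ?thesis using assms has_C1_derivative_scaleR unfolding C1_compact_def by blast
qed

lemma integrable_divergence:
  assumes "C1_compact U"
  shows "integrable lborel (divergence U)"
  using assms integrable_continuous_bounded_support[of "divergence U"] continuous_on_divergence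
    bounded_support_divergence unfolding C1_compact_def by blast

section \<open>Test fields and perimeter on a group with invariant Lebesgue measure\<close>

definition pairing :: "('a::euclidean_space \<Rightarrow> real) \<Rightarrow> ('a \<Rightarrow> 'a) \<Rightarrow> real" where
  "pairing f U = integral\<^sup>L lborel (\<lambda>x. f x * divergence U x)"

text \<open>Unlike a convex body in the usual sense, the set may have empty interior: in the application it spans
  only the horizontal directions.\<close>

definition convex_body_at_0 :: "'a::euclidean_space set \<Rightarrow> bool" where
  "convex_body_at_0 K \<longleftrightarrow> compact K \<and> convex K \<and> 0 \<in> K"

text \<open>Lebesgue measure is then a two-sided Haar measure: inversion preserves it, being the linear map
  \<open>- 1\<close>, and therefore so do right translations.\<close>

locale haar_C2_group = C2_group +
  assumes lborel_left_invariant: "distr lborel borel (mul p) = lborel"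
begin

text \<open>The vector fields whose value at \<open>p\<close> lies in the left translate of \<open>K\<close> to \<open>p\<close> are the fields of
  norm at most \<open>1\<close> for the left-invariant asymmetric norm with unit ball \<open>K\<close>.  The bound \<open>tv_le K f c\<close>
  says that the \<open>K\<close>-variation of \<open>f\<close> is at most \<open>c\<close>.\<close>

definition fields :: "'a set \<Rightarrow> ('a \<Rightarrow> 'a) set" where
  "fields K = {U. C1_compact U \<and> (\<forall>p. U p \<in> dL p 0 ` K)}"

definition per :: "'a set \<Rightarrow> 'a set \<Rightarrow> ereal" where
  "per K E = (SUP U\<in>fields K. ereal (pairing (indicator E) U))"

definition tv_le :: "'a set \<Rightarrow> ('a \<Rightarrow> real) \<Rightarrow> real \<Rightarrow> bool" where
  "tv_le K f c \<longleftrightarrow> (\<forall>U\<in>fields K. pairing f U \<le> c)"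

lemma per_le_iff: "per K E \<le> ereal c \<longleftrightarrow> tv_le K (indicator E) c"
  by (simp add: per_def tv_le_def SUP_le_iff)

lemma fieldsD: "U \<in> fields K \<Longrightarrow> C1_compact U" "U \<in> fields K \<Longrightarrow> U p \<in> dL p 0 ` K"
  by (auto simp: fields_def)

lemma zero_in_fields:
  assumes "convex_body_at_0 K"
  shows "(\<lambda>_. 0) \<in> fields K"
proof -
  have "0 \<in> dL p 0 ` K" for p
    using assms by (intro image_eqI[of _ _ 0]) (auto simp: convex_body_at_0_def blinfun.zero_right)
  moreover have "C1_compact (\<lambda>_::'a. 0::'a)" using has_C1_derivative_const by (auto simp: C1_compact_def)
  ultimately show ?thesis by (simp add: fields_def)
qed

lemma fields_convex:
  assumes K: "convex_body_at_0 K" and UW: "U \<in> fields K" "W \<in> fields K"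
    and a: "has_C1_derivative a a'" "\<And>x. 0 \<le> a x" "\<And>x. a x \<le> 1"
  shows "(\<lambda>x. W x + a x *\<^sub>R (U x - W x)) \<in> fields K"
  unfolding fields_def
proof (intro CollectI conjI allI)
  have "C1_compact (\<lambda>x. W x + a x *\<^sub>R (U x + - W x))"
    using UW by (intro C1_compact_add C1_compact_scaleR[OF a(1)] C1_compact_minus fieldsD)
  thus "C1_compact (\<lambda>x. W x + a x *\<^sub>R (U x - W x))" by simp
  fix p
  have "convex (dL p 0 ` K)"
    using K by (intro convex_linear_image) (auto simp: convex_body_at_0_def bounded_linear.linear blinfun.bounded_linear_right)
  hence "(1 - a p) *\<^sub>R W p + a p *\<^sub>R U p \<in> dL p 0 ` K"
    using fieldsD(2)[OF UW(1), of p] fieldsD(2)[OF UW(2), of p] a(2,3)[of p]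
    by (intro convexD) auto
  thus "W p + a p *\<^sub>R (U p - W p) \<in> dL p 0 ` K" by (simp add: algebra_simps)
qed

lemma has_C1_derivative_dL: "\<exists>D. has_C1_derivative (dL p) D" "\<exists>D. has_C1_derivative (\<lambda>p. dL p 0) D"
proof -
  have *: "\<exists>D. has_C1_derivative (\<lambda>x. dmul (i x) o\<^sub>L Blinfun (\<lambda>v. (0, v))) D"
    if "has_C1_derivative i i'" for i i'
  proof -
    have "bounded_linear (\<lambda>T. T o\<^sub>L Blinfun (\<lambda>v::'a. (0::'a, v)))"
      by (rule bounded_bilinear.bounded_linear_left[OF bounded_bilinear_blinfun_compose])
    from has_C1_derivative_chain[OF has_C1_derivative_chain[OF that C1_dmul] has_C1_derivative_bounded_linear[OF this]]
    show ?thesis by blast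
  qed
  have bl: "bounded_linear (\<lambda>v::'a. (0::'a, v))" "bounded_linear (\<lambda>v::'a. (v, 0::'a))"
    by (intro bounded_linear_Pair bounded_linear_zero bounded_linear_ident)+
  have 1: "has_C1_derivative (\<lambda>q. (p, 0) + (0, q)) (\<lambda>_. 0 + Blinfun (\<lambda>v::'a. (0::'a, v)))"
    by (rule has_C1_derivative_add[OF has_C1_derivative_const has_C1_derivative_bounded_linear[OF bl(1)]])
  from *[OF 1] show "\<exists>D. has_C1_derivative (dL p) D" by (simp add: dL_def[abs_def])
  from *[OF has_C1_derivative_bounded_linear[OF bl(2)]]
  show "\<exists>D. has_C1_derivative (\<lambda>p. dL p 0) D" by (simp add: dL_def[abs_def])
qed

lemma fields_bounded:
  assumes K: "convex_body_at_0 K" and S: "compact S"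
  obtains M where "0 \<le> M" "\<And>U x. U \<in> fields K \<Longrightarrow> x \<in> S \<Longrightarrow> norm (U x) \<le> M"
proof -
  have "continuous_on S (\<lambda>p. dL p 0)" using has_C1_derivative_dL(2) has_C1_derivativeD(3) by blast
  hence "bounded ((\<lambda>p. dL p 0) ` S)" using compact_continuous_image[OF _ S] compact_imp_bounded by blast
  then obtain A where A: "0 < A" "\<And>p. p \<in> S \<Longrightarrow> norm (dL p 0) \<le> A" unfolding bounded_pos by auto
  have "bounded K" using K by (auto simp: convex_body_at_0_def compact_imp_bounded)
  then obtain B where B: "0 < B" "\<And>k. k \<in> K \<Longrightarrow> norm k \<le> B" unfolding bounded_pos by auto
  show thesis
  proof (rule that[of "A * B"])
    fix U x assume U: "U \<in> fields K" and x: "x \<in> S"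
    obtain k where k: "k \<in> K" "U x = dL x 0 k" using fieldsD(2)[OF U, of x] by auto
    have "norm (U x) \<le> norm (dL x 0) * norm k" unfolding k by (rule norm_blinfun)
    also have "\<dots> \<le> A * B" using A B x k by (intro mult_mono) auto
    finally show "norm (U x) \<le> A * B" .
  qed (use A B in simp)
qed

lemma measurable_mul [measurable]: "mul p \<in> borel_measurable borel"
  using borel_measurable_continuous_onI[OF has_C1_derivativeD(3)[OF has_C1_derivative_left_translation]] .

lemma integral_left_translate:
  fixes f :: "'a \<Rightarrow> real"
  assumes "f \<in> borel_measurable borel"
  shows "integral\<^sup>L lborel (\<lambda>x. f (mul p x)) = integral\<^sup>L lborel f"
proof -
  have "integral\<^sup>L (distr lborel borel (mul p)) f = integral\<^sup>L lborel (\<lambda>x. f (mul p x))"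
    using assms by (intro integral_distr) auto
  thus ?thesis by (simp add: lborel_left_invariant)
qed

definition translate_field :: "'a \<Rightarrow> ('a \<Rightarrow> 'a) \<Rightarrow> 'a \<Rightarrow> 'a" where
  "translate_field p U x = dL p (mul (- p) x) (U (mul (- p) x))"

lemma C1_compact_left_translate:
  assumes "C1_compact f"
  shows "C1_compact (\<lambda>x. f (mul p x))"
proof -
  have "bounded (mul (- p) ` closure {x. f x \<noteq> 0})"
    using C1_compactD(2)[OF assms]
    by (intro compact_imp_bounded compact_continuous_image
        has_C1_derivativeD(3)[OF has_C1_derivative_left_translation]) auto
  moreover have "{x. f (mul p x) \<noteq> 0} \<subseteq> mul (- p) ` closure {x. f x \<noteq> 0}"
  proof
    fix x assume "x \<in> {x. f (mul p x) \<noteq> 0}"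
    hence "mul p x \<in> {x. f x \<noteq> 0}" by simp
    hence "mul p x \<in> closure {x. f x \<noteq> 0}" by (rule subsetD[OF closure_subset])
    thus "x \<in> mul (- p) ` closure {x. f x \<noteq> 0}"
      by (rule rev_image_eqI) (rule mul_cancel(1)[symmetric])
  qed
  ultimately have "bounded {x. f (mul p x) \<noteq> 0}" using bounded_subset by blast
  thus ?thesis
    using assms has_C1_derivative_chain[OF has_C1_derivative_left_translation] unfolding C1_compact_def by blast
qed

lemma C1_compact_translate_field:
  assumes U: "C1_compact U"
  shows "C1_compact (translate_field p U)"
proof -
  have V: "C1_compact (\<lambda>x. U (mul (- p) x))" using C1_compact_left_translate[OF U] .
  then obtain V' where V': "has_C1_derivative (\<lambda>x. U (mul (- p) x)) V'" using C1_compactD(1) by blast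
  obtain D where D: "has_C1_derivative (dL p) D" using has_C1_derivative_dL(1) by blast
  have "\<exists>f'. has_C1_derivative (translate_field p U) f'"
    unfolding translate_field_def[abs_def]
    by (rule has_C1_derivative_apply[OF has_C1_derivative_chain[OF has_C1_derivative_left_translation D] V'])
  moreover have "bounded {x. translate_field p U x \<noteq> 0}"
    by (rule bounded_subset[OF C1_compactD(2)[OF V]]) (auto simp: translate_field_def blinfun.zero_right)
  ultimately show ?thesis by (simp add: C1_compact_def)
qed

lemma translate_field_in_fields:
  assumes "U \<in> fields K"
  shows "translate_field p U \<in> fields K"
  unfolding fields_def
proof (intro CollectI conjI allI)
  show "C1_compact (translate_field p U)" using C1_compact_translate_field fieldsD(1)[OF assms] .
  fix x
  obtain k where k: "k \<in> K" "U (mul (- p) x) = dL (mul (- p) x) 0 k"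
    using fieldsD(2)[OF assms] by blast
  have "translate_field p U x = dL x 0 k"
    using dL_chain[of p "mul (- p) x" 0 k] by (simp add: translate_field_def k)
  thus "translate_field p U x \<in> dL x 0 ` K" using k by blast
qed

text \<open>Tested against a function, the divergence of a field turns into the derivative of the
  function along the field, which is a first-order expression and clearly equivariant.  Invariance
  of the Lebesgue measure then gives invariance of the divergence.\<close>

lemma divergence_translate_field:
  assumes U: "C1_compact U"
  shows "divergence (translate_field p U) x = divergence U (mul (- p) x)"
proof -
  let ?V = "translate_field p U"
  have V: "C1_compact ?V" by (rule C1_compact_translate_field[OF U])
  obtain U' V' where U': "has_C1_derivative U U'" and V': "has_C1_derivative ?V V'"
    using C1_compactD(1)[OF U] C1_compactD(1)[OF V] by blast
  have cont: "continuous_on UNIV (\<lambda>x. divergence U (mul (- p) x))"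
    by (rule continuous_on_compose2[OF continuous_on_divergence[OF U', of UNIV]
         has_C1_derivativeD(3)[OF has_C1_derivative_left_translation]]) auto
  have "divergence ?V x - divergence U (mul (- p) x) = 0"
  proof (rule continuous_eq_0_if_integrals_vanish[where h = "\<lambda>x. divergence ?V x - divergence U (mul (- p) x)"])
    show "continuous_on UNIV (\<lambda>x. divergence ?V x - divergence U (mul (- p) x))"
      by (intro continuous_on_diff cont continuous_on_divergence[OF V'])
    fix \<phi> :: "'a \<Rightarrow> real" assume "C1_compact \<phi>"
    then obtain \<phi>' where \<phi>: "has_C1_derivative \<phi> \<phi>'" "bounded {x. \<phi> x \<noteq> 0}"
      by (auto simp: C1_compact_def)
    have int1: "integrable lborel (\<lambda>x. \<phi> x * divergence ?V x)"
      by (rule integral_by_parts(1)[OF \<phi>(1) V])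
    have int2: "integrable lborel (\<lambda>x. \<phi> x * divergence U (mul (- p) x))"
      by (rule integrable_continuous_bounded_support)
         (auto intro!: continuous_intros has_C1_derivativeD(3)[OF \<phi>(1)] cont bounded_subset[OF \<phi>(2)])
    have m1: "(\<lambda>x. \<phi>' x (?V x)) \<in> borel_measurable borel"
      by (intro borel_measurable_continuous_onI continuous_intros has_C1_derivativeD(2)[OF \<phi>(1)]
          C1_compactD(3)[OF V])
    have m2: "(\<lambda>x. \<phi> x * divergence U (mul (- p) x)) \<in> borel_measurable borel"
      by (intro borel_measurable_continuous_onI continuous_intros has_C1_derivativeD(3)[OF \<phi>(1)] cont)
    have "integral\<^sup>L lborel (\<lambda>x. \<phi> x * divergence ?V x) = - integral\<^sup>L lborel (\<lambda>x. \<phi>' x (?V x))"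
      by (rule integral_by_parts(3)[OF \<phi>(1) V])
    also have "integral\<^sup>L lborel (\<lambda>x. \<phi>' x (?V x)) = integral\<^sup>L lborel (\<lambda>x. \<phi>' (mul p x) (?V (mul p x)))"
      using integral_left_translate[OF m1, of p] by simp
    also have "(\<lambda>x. \<phi>' (mul p x) (?V (mul p x))) = (\<lambda>x. (\<phi>' (mul p x) o\<^sub>L dL p x) (U x))"
      by (simp add: translate_field_def)
    also have "- integral\<^sup>L lborel \<dots> = integral\<^sup>L lborel (\<lambda>x. \<phi> (mul p x) * divergence U x)"
      using integral_by_parts(3)[OF has_C1_derivative_chain[OF has_C1_derivative_left_translation \<phi>(1)] U, of p]
      by simp
    also have "\<dots> = integral\<^sup>L lborel (\<lambda>x. \<phi> x * divergence U (mul (- p) x))"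
      using integral_left_translate[OF m2, of p] by simp
    finally show "integral\<^sup>L lborel (\<lambda>x. \<phi> x * (divergence ?V x - divergence U (mul (- p) x))) = 0"
      using int1 int2 by (simp add: right_diff_distrib)
  qed
  thus ?thesis by simp
qed

definition translate :: "'a \<Rightarrow> 'a set \<Rightarrow> 'a set" where
  "translate p E = mul (- p) -` E"

lemma translate_borel [measurable]: "E \<in> sets borel \<Longrightarrow> translate p E \<in> sets borel"
  unfolding translate_def using measurable_sets[OF measurable_mul, of E "- p"] by simp

lemma translate_translate: "translate p (translate q E) = translate (mul p q) E"
  by (auto simp: translate_def uminus_mul mul_assoc)

lemma translate_0 [simp]: "translate 0 E = E"
  by (simp add: translate_def vimage_def)

lemma emeasure_translate:
  assumes "E \<in> sets borel"
  shows "emeasure lborel (translate p E) = emeasure lborel E"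
proof -
  have "emeasure (distr lborel borel (mul (- p))) E = emeasure lborel (translate p E)"
    using assms by (subst emeasure_distr) (auto simp: translate_def)
  thus ?thesis by (simp add: lborel_left_invariant)
qed

lemma pairing_translate:
  assumes E: "E \<in> sets borel" and U: "C1_compact U"
  shows "pairing (indicator (translate p E)) U = pairing (indicator E) (translate_field (- p) U)"
proof -
  obtain U' where U': "has_C1_derivative U U'" using C1_compactD(1)[OF U] by blast
  have m: "divergence U \<in> borel_measurable borel"
    by (rule borel_measurable_continuous_onI[OF continuous_on_divergence[OF U']])
  have ind: "indicator (translate p E) (mul p x) = (indicator E x :: real)" for x
    by (simp add: translate_def indicator_def)
  have "pairing (indicator (translate p E)) U
      = integral\<^sup>L lborel (\<lambda>x. indicator (translate p E) (mul p x) * divergence U (mul p x))"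
    unfolding pairing_def
    using integral_left_translate[of "\<lambda>x. indicator (translate p E) x * divergence U x" p] m E by simp
  also have "\<dots> = pairing (indicator E) (translate_field (- p) U)"
    unfolding pairing_def ind divergence_translate_field[OF U] by simp
  finally show ?thesis .
qed

lemma per_translate:
  assumes E: "E \<in> sets borel"
  shows "per K (translate p E) = per K E"
proof -
  have *: "per K (translate p E) \<le> per K E" if "E \<in> sets borel" for p E
    unfolding per_def
    by (rule SUP_mono) (metis pairing_translate[OF that] fieldsD(1) translate_field_in_fields order_refl)
  have "per K E = per K (translate (- p) (translate p E))" by (simp add: translate_translate)
  also have "\<dots> \<le> per K (translate p E)" by (rule *) (use E in measurable)
  finally show ?thesis using *[OF E, of p] by (rule antisym[rotated])
qed

lemma per_nonneg:
  assumes "convex_body_at_0 K"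
  shows "0 \<le> per K E"
proof -
  have "divergence (\<lambda>_. 0) x = 0" for x :: 'a
    by (simp add: divergence_eq[OF has_C1_derivative_const])
  hence "pairing (indicator E) (\<lambda>_. 0) = 0" by (simp add: pairing_def)
  thus ?thesis
    unfolding per_def using SUP_upper[OF zero_in_fields[OF assms], of "\<lambda>U. ereal (pairing (indicator E) U)"]
    by (simp add: zero_ereal_def)
qed

text \<open>The perimeter is a supremum of the functionals \<open>E \<mapsto> pairing (indicator E) U\<close>, which are continuous for
  pointwise convergence of indicator functions by dominated convergence.\<close>

lemma per_lower_semicontinuous:
  assumes E: "\<And>n. E n \<in> sets borel" "F \<in> sets borel"
    and lim: "\<And>x. (\<lambda>n. indicator (E n) x :: real) \<longlonglongrightarrow> indicator F x"
    and per: "\<And>n. per K (E n) \<le> ereal (c n)" and c: "c \<longlonglongrightarrow> d"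
  shows "per K F \<le> ereal d"
  unfolding per_le_iff tv_le_def
proof
  fix U assume U: "U \<in> fields K"
  have int: "integrable lborel (divergence U)" by (rule integrable_divergence[OF fieldsD(1)[OF U]])
  have m: "divergence U \<in> borel_measurable borel" using borel_measurable_integrable[OF int] by simp
  have "(\<lambda>n. pairing (indicator (E n)) U) \<longlonglongrightarrow> pairing (indicator F) U"
    unfolding pairing_def
  proof (rule integral_dominated_convergence)
    show "integrable lborel (\<lambda>x. \<bar>divergence U x\<bar>)" using int by simp
    show "AE x in lborel. (\<lambda>n. indicator (E n) x * divergence U x) \<longlonglongrightarrow> indicator F x * divergence U x"
      by (intro always_eventually allI tendsto_mult lim tendsto_const)
  qed (use E m in \<open>auto simp: indicator_def\<close>)
  moreover have "pairing (indicator (E n)) U \<le> c n" for n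
    using per[of n] U by (simp add: per_le_iff tv_le_def)
  ultimately show "pairing (indicator F) U \<le> d"
    using c by (intro LIMSEQ_le) auto
qed

section \<open>Submodularity for smooth functions\<close>

text \<open>A smooth convex function within \<open>\<delta>\<close> of the positive part, and its derivative.\<close>

definition smooth_pos :: "real \<Rightarrow> real \<Rightarrow> real" where
  "smooth_pos \<delta> s = (s + sqrt (\<delta>\<^sup>2 + s\<^sup>2)) / 2"

definition smooth_step :: "real \<Rightarrow> real \<Rightarrow> real" where
  "smooth_step \<delta> s = (1 + s / sqrt (\<delta>\<^sup>2 + s\<^sup>2)) / 2"

lemma smooth_positive_part:
  fixes \<delta> :: real
  assumes \<delta>: "0 < \<delta>"
  shows "has_C1_derivative (smooth_pos \<delta>) (\<lambda>s. blinfun_scaleR_left (smooth_step \<delta> s))"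
    "\<exists>\<alpha>'. has_C1_derivative (smooth_step \<delta>) \<alpha>'"
    "0 \<le> smooth_step \<delta> s" "smooth_step \<delta> s \<le> 1" "\<bar>smooth_pos \<delta> s - max 0 s\<bar> \<le> \<delta>"
proof -
  note \<sigma>_def = smooth_pos_def[abs_def] and \<alpha>_def = smooth_step_def[abs_def]
  let ?r = "\<lambda>s. sqrt (\<delta>\<^sup>2 + s\<^sup>2)"
  have pos: "0 < \<delta>\<^sup>2 + s\<^sup>2" for s using \<delta> by (simp add: add_pos_nonneg)
  have r: "0 < ?r s" for s using pos by simp
  have cr: "continuous_on UNIV ?r" by (intro continuous_intros)
  have dr: "(?r has_real_derivative s / ?r s) (at s)" for s
    using pos[of s] by (auto intro!: derivative_eq_intros simp: field_simps)
  show "has_C1_derivative (smooth_pos \<delta>) (\<lambda>s. blinfun_scaleR_left (smooth_step \<delta> s))"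
  proof (rule has_C1_derivative_real)
    show "(smooth_pos \<delta> has_real_derivative smooth_step \<delta> s) (at s)" for s
      unfolding \<sigma>_def \<alpha>_def by (rule DERIV_cdivide[OF DERIV_add[OF DERIV_ident dr]])
    show "continuous_on UNIV (smooth_step \<delta>)" unfolding \<alpha>_def
      by (intro continuous_intros cr) (use r in \<open>auto simp: less_le\<close>)
  qed
  have "has_C1_derivative (smooth_step \<delta>) (\<lambda>s. blinfun_scaleR_left ((0 + (1 * ?r s - s * (s / ?r s)) / (?r s * ?r s)) / 2))"
  proof (rule has_C1_derivative_real)
    show "(smooth_step \<delta> has_real_derivative (0 + (1 * ?r s - s * (s / ?r s)) / (?r s * ?r s)) / 2) (at s)" for s
      unfolding \<alpha>_def
      by (rule DERIV_cdivide[OF DERIV_add[OF DERIV_const DERIV_divide[OF DERIV_ident dr]]])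
         (use r[of s] in auto)
    show "continuous_on UNIV (\<lambda>s. (0 + (1 * ?r s - s * (s / ?r s)) / (?r s * ?r s)) / 2)"
      by (intro continuous_intros cr) (use r in \<open>auto simp: less_le\<close>)
  qed
  thus "\<exists>\<alpha>'. has_C1_derivative (smooth_step \<delta>) \<alpha>'" by blast
  have abs: "\<bar>s\<bar> \<le> ?r s" by (rule real_le_rsqrt) simp
  show "0 \<le> smooth_step \<delta> s" "smooth_step \<delta> s \<le> 1"
  proof -
    have "- 1 \<le> s / ?r s" "s / ?r s \<le> 1"
      unfolding pos_le_divide_eq[OF r] pos_divide_le_eq[OF r] using abs by (auto simp: abs_le_iff)
    thus "0 \<le> smooth_step \<delta> s" "smooth_step \<delta> s \<le> 1" by (auto simp: \<alpha>_def)
  qed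
  have "?r s \<le> \<delta> + \<bar>s\<bar>"
    using \<delta> by (intro real_le_lsqrt) (auto simp: power2_sum)
  thus "\<bar>smooth_pos \<delta> s - max 0 s\<bar> \<le> \<delta>" using abs \<delta> by (auto simp: \<sigma>_def max_def abs_le_iff field_simps)
qed

text \<open>If \<open>f\<close> and \<open>g\<close> are tested with \<open>U1 = W + \<alpha> (U - W)\<close> and \<open>W1 = U - \<alpha> (U - W)\<close>, where \<open>\<alpha>\<close> is a
  smooth approximation of the indicator function of \<open>{f > g}\<close>, the result is close to testing
  \<open>max f g\<close> with \<open>U\<close> and \<open>min f g\<close> with \<open>W\<close>.  The new fields are convex combinations of \<open>U\<close> and \<open>W\<close>,
  hence admissible.  Integrating by parts for \<open>d = f - g\<close> and \<open>\<alpha> = \<sigma>' (d)\<close> turns \<open>d div (\<alpha> (U - W))\<close> into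
  \<open>\<sigma> (d) div (U - W)\<close>, and \<open>\<sigma>\<close> approximates the positive part uniformly.\<close>

lemma smooth_submodular:
  assumes K: "convex_body_at_0 K"
    and f: "has_C1_derivative f f'" "tv_le K f a" and g: "has_C1_derivative g g'" "tv_le K g b"
    and U: "U \<in> fields K" and W: "W \<in> fields K"
  shows "pairing (\<lambda>x. max (f x) (g x)) U + pairing (\<lambda>x. min (f x) (g x)) W \<le> a + b"
proof -
  define d where "d x = f x - g x" for x
  have d: "has_C1_derivative d (\<lambda>x. f' x - g' x)"
    unfolding d_def[abs_def] by (rule has_C1_derivative_diff[OF f(1) g(1)])
  obtain U' W' where U': "has_C1_derivative U U'" and W': "has_C1_derivative W W'"
    using C1_compactD(1)[OF fieldsD(1)[OF U]] C1_compactD(1)[OF fieldsD(1)[OF W]] by blast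
  define Y where "Y x = U x - W x" for x
  have Y': "has_C1_derivative Y (\<lambda>x. U' x - W' x)"
    unfolding Y_def[abs_def] by (rule has_C1_derivative_diff[OF U' W'])
  have Y: "C1_compact Y"
    using C1_compact_add[OF fieldsD(1)[OF U] C1_compact_minus[OF fieldsD(1)[OF W]]]
    by (simp add: Y_def[abs_def])
  have divY: "divergence Y x = divergence U x - divergence W x" for x
    unfolding Y_def[abs_def] by (rule divergence_diff[OF U' W'])
  have cont: "continuous_on UNIV f" "continuous_on UNIV g" "continuous_on UNIV d"
    using has_C1_derivativeD(3) f(1) g(1) d by blast+
  have int: "integrable lborel (\<lambda>x. h x * divergence V x)"
    if "continuous_on UNIV h" "C1_compact V" for h V
  proof (rule integrable_continuous_bounded_support)
    show "continuous_on UNIV (\<lambda>x. h x * divergence V x)"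
      using that C1_compactD(1)[OF that(2)] by (auto intro!: continuous_intros continuous_on_divergence)
    show "bounded {x. h x * divergence V x \<noteq> 0}"
      by (rule bounded_subset[OF bounded_support_divergence[OF that(2)]]) auto
  qed
  let ?L = "pairing (\<lambda>x. max (f x) (g x)) U + pairing (\<lambda>x. min (f x) (g x)) W"
  define N where "N = integral\<^sup>L lborel (\<lambda>x. \<bar>divergence Y x\<bar>)"
  have N0: "0 \<le> N" unfolding N_def by (rule Bochner_Integration.integral_nonneg) simp
  have iU: "C1_compact U" "C1_compact W" using fieldsD(1) U W by auto
  have L: "?L = pairing g U + pairing f W + pairing (\<lambda>x. max 0 (d x)) Y"
  proof -
    have "max (f x) (g x) * divergence U x + min (f x) (g x) * divergence W x
        = g x * divergence U x + f x * divergence W x + max 0 (d x) * divergence Y x" for x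
      by (auto simp: divY d_def max_def min_def algebra_simps)
    hence "integral\<^sup>L lborel (\<lambda>x. max (f x) (g x) * divergence U x + min (f x) (g x) * divergence W x)
        = integral\<^sup>L lborel (\<lambda>x. g x * divergence U x + f x * divergence W x + max 0 (d x) * divergence Y x)"
      by simp
    thus ?thesis
      unfolding pairing_def
      using int[OF continuous_on_max[OF cont(1,2)] iU(1)] int[OF continuous_on_min[OF cont(1,2)] iU(2)]
        int[OF cont(2) iU(1)] int[OF cont(1) iU(2)] int[OF continuous_on_max[OF continuous_on_const cont(3)] Y]
      by simp
  qed
  have "?L \<le> a + b + \<delta> * N" if \<delta>: "0 < \<delta>" for \<delta>
  proof -
    define \<sigma> where "\<sigma> = smooth_pos \<delta>"
    define \<alpha> where "\<alpha> = smooth_step \<delta>"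
    note sm = smooth_positive_part[OF \<delta>, folded \<sigma>_def \<alpha>_def]
    obtain \<alpha>' where \<alpha>': "has_C1_derivative \<alpha> \<alpha>'" using sm(2) by blast
    define \<alpha>d where "\<alpha>d x = \<alpha> (d x)" for x
    obtain \<alpha>d' where \<alpha>d: "has_C1_derivative \<alpha>d \<alpha>d'"
      using has_C1_derivative_chain[OF d \<alpha>'] unfolding \<alpha>d_def[abs_def] by blast
    have \<alpha>01: "0 \<le> \<alpha>d x" "\<alpha>d x \<le> 1" "0 \<le> 1 - \<alpha>d x" "1 - \<alpha>d x \<le> 1" for x
      using sm(3)[of "d x"] sm(4)[of "d x"] unfolding \<alpha>d_def by linarith+
    define U1 where "U1 = (\<lambda>x. W x + \<alpha>d x *\<^sub>R Y x)"
    define W1 where "W1 = (\<lambda>x. U x - \<alpha>d x *\<^sub>R Y x)"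
    have U1: "U1 \<in> fields K"
      unfolding U1_def Y_def by (rule fields_convex[OF K U W \<alpha>d \<alpha>01(1,2)])
    have "(\<lambda>x. W x + (1 - \<alpha>d x) *\<^sub>R (U x - W x)) \<in> fields K"
      by (rule fields_convex[OF K U W has_C1_derivative_diff[OF has_C1_derivative_const \<alpha>d] \<alpha>01(3,4)])
    moreover have "(\<lambda>x. W x + (1 - \<alpha>d x) *\<^sub>R (U x - W x)) = W1"
      by (simp add: W1_def Y_def algebra_simps)
    ultimately have W1: "W1 \<in> fields K" by simp
    have \<alpha>Y: "C1_compact (\<lambda>x. \<alpha>d x *\<^sub>R Y x)" by (rule C1_compact_scaleR[OF \<alpha>d Y])
    have \<alpha>Y': "has_C1_derivative (\<lambda>x. \<alpha>d x *\<^sub>R Y x) (\<lambda>x. \<alpha>d x *\<^sub>R (U' x - W' x) + (blinfun_scaleR_left (Y x) o\<^sub>L \<alpha>d' x))"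
      by (rule has_C1_derivative_scaleR[OF \<alpha>d Y'])
    let ?D = "divergence (\<lambda>x. \<alpha>d x *\<^sub>R Y x)"
    have div: "divergence U1 x = divergence W x + ?D x" "divergence W1 x = divergence U x - ?D x" for x
      unfolding U1_def W1_def by (rule divergence_add[OF W' \<alpha>Y'] divergence_diff[OF U' \<alpha>Y'])+
    have "pairing f U1 + pairing g W1 \<le> a + b"
      using f(2) g(2) U1 W1 unfolding tv_le_def by (intro add_mono) auto
    also have "pairing f U1 + pairing g W1 = pairing g U + pairing f W + pairing d (\<lambda>x. \<alpha>d x *\<^sub>R Y x)"
      unfolding pairing_def div d_def
      using int[OF cont(1) iU(2)] int[OF cont(2) iU(1)] int[OF cont(1) \<alpha>Y] int[OF cont(2) \<alpha>Y]
      by (simp add: distrib_left right_diff_distrib left_diff_distrib)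
    also have "pairing d (\<lambda>x. \<alpha>d x *\<^sub>R Y x) = - integral\<^sup>L lborel (\<lambda>x. (f' x - g' x) (\<alpha>d x *\<^sub>R Y x))"
      unfolding pairing_def by (rule integral_by_parts(3)[OF d \<alpha>Y])
    also have "(\<lambda>x. (f' x - g' x) (\<alpha>d x *\<^sub>R Y x)) = (\<lambda>x. (blinfun_scaleR_left (\<alpha> (d x)) o\<^sub>L (f' x - g' x)) (Y x))"
      by (simp add: \<alpha>d_def blinfun.scaleR_right mult.commute)
    also have "- integral\<^sup>L lborel \<dots> = pairing (\<lambda>x. \<sigma> (d x)) Y"
      unfolding pairing_def
      using integral_by_parts(3)[OF has_C1_derivative_chain[OF d sm(1)] Y] by simp
    finally have A: "pairing g U + pairing f W + pairing (\<lambda>x. \<sigma> (d x)) Y \<le> a + b" .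
    have c\<sigma>: "continuous_on UNIV (\<lambda>x. \<sigma> (d x))"
      using has_C1_derivativeD(3)[OF has_C1_derivative_chain[OF d sm(1)]] .
    have cm: "continuous_on UNIV (\<lambda>x. max 0 (d x))" by (intro continuous_intros cont)
    have "pairing (\<lambda>x. max 0 (d x)) Y - pairing (\<lambda>x. \<sigma> (d x)) Y
        = integral\<^sup>L lborel (\<lambda>x. (max 0 (d x) - \<sigma> (d x)) * divergence Y x)"
      unfolding pairing_def using int[OF c\<sigma> Y] int[OF cm Y] by (simp add: left_diff_distrib)
    also have "\<dots> \<le> integral\<^sup>L lborel (\<lambda>x. \<delta> * \<bar>divergence Y x\<bar>)"
    proof (rule integral_mono)
      show "integrable lborel (\<lambda>x. (max 0 (d x) - \<sigma> (d x)) * divergence Y x)"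
        using int[OF continuous_on_diff[OF cm c\<sigma>] Y] .
      show "integrable lborel (\<lambda>x. \<delta> * \<bar>divergence Y x\<bar>)" using integrable_divergence[OF Y] by simp
      fix x
      have "(max 0 (d x) - \<sigma> (d x)) * divergence Y x \<le> \<bar>max 0 (d x) - \<sigma> (d x)\<bar> * \<bar>divergence Y x\<bar>"
        by (metis abs_ge_self abs_mult)
      also have "\<dots> \<le> \<delta> * \<bar>divergence Y x\<bar>"
        using sm(5)[of "d x"] by (intro mult_right_mono) (auto simp: abs_minus_commute)
      finally show "(max 0 (d x) - \<sigma> (d x)) * divergence Y x \<le> \<delta> * \<bar>divergence Y x\<bar>" .
    qed
    also have "\<dots> = \<delta> * N" by (simp add: N_def)
    finally show ?thesis using A L by linarith
  qed
  note bound = this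
  have "?L \<le> a + b + e" if e: "0 < e" for e
  proof -
    have "(e / (N + 1)) * N \<le> e" using N0 e by (simp add: field_simps)
    thus ?thesis using bound[of "e / (N + 1)"] N0 e by (simp add: add_pos_nonneg)
  qed
  thus ?thesis by (rule field_le_epsilon)
qed

end

section \<open>Differentiation under the integral sign\<close>

text \<open>Derivatives of local representatives agree where both are defined, by uniqueness, so they glue.\<close>

lemma has_C1_derivative_local:
  fixes f :: "'a::real_normed_vector \<Rightarrow> 'b::real_normed_vector"
  assumes "\<And>R. \<exists>g g'. has_C1_derivative g g' \<and> (\<forall>x. norm x < R \<longrightarrow> f x = g x)"
  shows "\<exists>f'. has_C1_derivative f f'"
proof -
  obtain g g' where g: "\<And>R. has_C1_derivative (g R) (g' R)" "\<And>R x. norm x < R \<Longrightarrow> f x = g R x"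
    using assms by metis
  define f' where "f' x = g' (norm x + 1) x" for x
  have der: "(f has_derivative g' R x) (at x)" if x: "norm x < R" for R x
    by (rule has_derivative_transform_within_open[OF has_C1_derivativeD(1)[OF g(1), of R x UNIV] open_ball[of 0 R]])
       (use x g(2) in auto)
  have eq: "f' x = g' R x" if x: "norm x < R" for R x
    unfolding f'_def
    using has_derivative_unique[OF der[of x "norm x + 1"] der[OF x]] by (intro blinfun_eqI) simp
  have "(f has_derivative f' x) (at x)" for x unfolding f'_def by (rule der) simp
  moreover have "isCont f' x" for x
  proof -
    have "continuous_on (ball 0 (norm x + 1)) f'"
      using has_C1_derivativeD(2)[OF g(1)] by (rule continuous_on_eq) (use eq in auto)
    thus ?thesis by (simp add: continuous_on_eq_continuous_at)
  qed
  ultimately show ?thesis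
    unfolding has_C1_derivative_def by (intro exI[of _ f']) (auto intro: continuous_at_imp_continuous_on)
qed

lemma integrable_indicator_continuous:
  fixes \<phi> :: "'a::euclidean_space \<Rightarrow> real"
  assumes A: "A \<in> sets borel" "bounded A" and \<phi>: "continuous_on UNIV \<phi>"
  shows "integrable lborel (\<lambda>z. indicator A z * \<phi> z)"
proof -
  obtain S where S: "\<And>z. z \<in> A \<Longrightarrow> norm z \<le> S" using A(2) unfolding bounded_iff by auto
  have "integrable lborel (\<lambda>z. indicator (cball 0 S) z *\<^sub>R \<phi> z)"
    by (rule borel_integrable_compact) (use \<phi> continuous_on_subset in auto)
  from integrable_bounded_mult[of "indicator A" 1, OF _ _ this]
  have "integrable lborel (\<lambda>z. indicator A z * (indicator (cball 0 S) z *\<^sub>R \<phi> z))"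
    using A by (simp add: indicator_def)
  moreover have "indicator A z * (indicator (cball 0 S) z *\<^sub>R \<phi> z) = indicator A z * \<phi> z" for z
    using S[of z] by (auto simp: indicator_def)
  ultimately show ?thesis by (simp only:)
qed

lemma fmeasurable_bounded:
  fixes A :: "'a::euclidean_space set"
  assumes "A \<in> sets borel" "bounded A"
  shows "A \<in> fmeasurable lborel"
  using assms emeasure_bounded_finite by (intro fmeasurableI) auto

lemma integral_indicator_bound:
  fixes \<phi> :: "'a::euclidean_space \<Rightarrow> real"
  assumes A: "A \<in> sets borel" "bounded A" and \<phi>: "continuous_on UNIV \<phi>"
    and c: "\<And>z. z \<in> A \<Longrightarrow> \<bar>\<phi> z\<bar> \<le> c"
  shows "\<bar>integral\<^sup>L lborel (\<lambda>z. indicator A z * \<phi> z)\<bar> \<le> c * measure lborel A"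
proof -
  have fin: "A \<in> fmeasurable lborel" by (rule fmeasurable_bounded[OF A])
  have "\<bar>integral\<^sup>L lborel (\<lambda>z. indicator A z * \<phi> z)\<bar> \<le> integral\<^sup>L lborel (\<lambda>z. c * indicator A z)"
  proof -
    have "integrable lborel (\<lambda>z. c * indicator A z :: real)" using fin by (simp add: fmeasurable_def)
    moreover have "norm (indicator A z * \<phi> z) \<le> c * indicator A z" for z
      using c[of z] by (auto simp: indicator_def)
    ultimately have "norm (integral\<^sup>L lborel (\<lambda>z. indicator A z * \<phi> z)) \<le> integral\<^sup>L lborel (\<lambda>z. c * indicator A z)"
      by (intro Bochner_Integration.integral_norm_bound_integral integrable_indicator_continuous[OF A \<phi>]) auto
    thus ?thesis by simp
  qed
  also have "\<dots> = c * measure lborel A" using fin by (simp add: fmeasurable_def)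
  finally show ?thesis .
qed

text \<open>For \<open>x\<close> near a point and \<open>z\<close> in the bounded set \<open>A\<close> the derivative \<open>k'\<close> is uniformly continuous.  So the
  first-order remainder in \<open>x\<close> is small uniformly in \<open>z\<close> and stays small after integration.\<close>

lemma has_C1_derivative_integral_bounded:
  fixes k :: "'a::euclidean_space \<times> 'b::euclidean_space \<Rightarrow> real"
  assumes A: "A \<in> sets borel" "bounded A" and k: "has_C1_derivative k k'"
  shows "\<exists>D. has_C1_derivative (\<lambda>x. integral\<^sup>L lborel (\<lambda>z. indicator A z * k (x, z))) D"
proof -
  obtain S where S: "\<And>z. z \<in> A \<Longrightarrow> norm z \<le> S" using A(2) unfolding bounded_iff by auto
  define \<mu> where "\<mu> = measure lborel A"
  have \<mu>: "0 \<le> \<mu>" by (simp add: \<mu>_def)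
  have uc: "\<exists>\<delta>>0. \<forall>x z. norm (x - x0) < \<delta> \<longrightarrow> z \<in> A \<longrightarrow> norm (k' (x, z) - k' (x0, z)) \<le> e"
    if e: "0 < e" for x0 e
  proof -
    have "uniformly_continuous_on (cball x0 1 \<times> cball 0 S) k'"
      by (intro compact_uniformly_continuous has_C1_derivativeD(2)[OF k] compact_Times) auto
    then obtain \<delta> where \<delta>: "0 < \<delta>" "\<And>p q. p \<in> cball x0 1 \<times> cball 0 S \<Longrightarrow> q \<in> cball x0 1 \<times> cball 0 S \<Longrightarrow>
        dist p q < \<delta> \<Longrightarrow> dist (k' p) (k' q) < e"
      using e unfolding uniformly_continuous_on_def by meson
    show ?thesis
    proof (intro exI[of _ "min \<delta> 1"] conjI allI impI)
      fix x z assume x: "norm (x - x0) < min \<delta> 1" and z: "z \<in> A"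
      have "dist (k' (x, z)) (k' (x0, z)) < e"
        by (rule \<delta>(2)) (use x S[OF z] in \<open>auto simp: dist_norm norm_minus_commute dist_Pair_Pair\<close>)
      thus "norm (k' (x, z) - k' (x0, z)) \<le> e" by (simp add: dist_norm)
    qed (use \<delta> in auto)
  qed
  have ck: "continuous_on UNIV (\<lambda>z. k (x, z))" for x
    by (rule continuous_on_compose2[OF has_C1_derivativeD(3)[OF k, of UNIV]]) (auto intro!: continuous_intros)
  have ck': "continuous_on UNIV (\<lambda>z. k' (x, z))" for x
    by (rule continuous_on_compose2[OF has_C1_derivativeD(2)[OF k, of UNIV]]) (auto intro!: continuous_intros)
  have ckh: "continuous_on UNIV (\<lambda>z. k' (x, z) v)" for x v by (intro continuous_intros ck')
  note int = integrable_indicator_continuous[OF A] and bnd = integral_indicator_bound[OF A, folded \<mu>_def]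
  define D where "D x h = integral\<^sup>L lborel (\<lambda>z. indicator A z * k' (x, z) (h, 0))" for x h
  have "linear (D x)" for x
  proof
    have 1: "k' (x, z) (a + b, 0) = k' (x, z) (a, 0) + k' (x, z) (b, 0)"
      and 2: "k' (x, z) (c *\<^sub>R a, 0) = c * k' (x, z) (a, 0)" for z a b c
      using blinfun.add_right[of "k' (x, z)" "(a, 0)" "(b, 0)"] blinfun.scaleR_right[of "k' (x, z)" c "(a, 0)"]
      by simp_all
    show "D x (a + b) = D x a + D x b" for a b
      unfolding D_def 1 distrib_left by (rule Bochner_Integration.integral_add[OF int int]) (rule ckh)+
    show "D x (c *\<^sub>R a) = c *\<^sub>R D x a" for a c
      unfolding D_def 2 by (simp add: mult.left_commute)
  qed
  hence bl: "bounded_linear (D x)" for x by (simp add: linear_conv_bounded_linear)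
  have norm_Pair0: "norm (h, 0::'b) = norm h" for h :: 'a by (simp add: norm_Pair)
  have Ddiff: "norm (Blinfun (D x) - Blinfun (D x0)) \<le> e * \<mu>"
    if e: "0 \<le> e" "\<And>z. z \<in> A \<Longrightarrow> norm (k' (x, z) - k' (x0, z)) \<le> e" for x x0 e
  proof (rule norm_blinfun_bound)
    show "0 \<le> e * \<mu>" using e \<mu> by simp
    fix h
    have "(Blinfun (D x) - Blinfun (D x0)) h
        = integral\<^sup>L lborel (\<lambda>z. indicator A z * (k' (x, z) (h, 0) - k' (x0, z) (h, 0)))"
      by (simp add: blinfun.diff_left bounded_linear_Blinfun_apply[OF bl] D_def right_diff_distrib
          Bochner_Integration.integral_diff[OF int[OF ckh] int[OF ckh]])
    also have "\<bar>\<dots>\<bar> \<le> (e * norm h) * \<mu>"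
    proof (rule bnd)
      fix z assume "z \<in> A"
      have "\<bar>(k' (x, z) - k' (x0, z)) (h, 0)\<bar> \<le> norm (k' (x, z) - k' (x0, z)) * norm (h, 0::'b)"
        using norm_blinfun[of "k' (x, z) - k' (x0, z)" "(h, 0)"] by simp
      also have "\<dots> \<le> e * norm h"
        unfolding norm_Pair0 using e(2)[OF \<open>z \<in> A\<close>] by (rule mult_right_mono) simp
      finally show "\<bar>k' (x, z) (h, 0) - k' (x0, z) (h, 0)\<bar> \<le> e * norm h"
        by (simp add: blinfun.diff_left)
    qed (intro continuous_intros ck')
    finally show "norm ((Blinfun (D x) - Blinfun (D x0)) h) \<le> e * \<mu> * norm h" by (simp add: mult_ac)
  qed
  have "has_C1_derivative (\<lambda>x. integral\<^sup>L lborel (\<lambda>z. indicator A z * k (x, z))) (\<lambda>x. Blinfun (D x))"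
    unfolding has_C1_derivative_def
  proof (intro conjI allI)
    show "continuous_on UNIV (\<lambda>x. Blinfun (D x))"
      unfolding continuous_on_iff
    proof (intro ballI allI impI)
      fix x0 :: 'a and e :: real assume e: "0 < e"
      define e' where "e' = e / (2 * (\<mu> + 1))"
      have e': "0 < e'" using e \<mu> by (simp add: e'_def)
      have le: "e' * \<mu> < e"
      proof -
        have "e * \<mu> < e * (2 * (\<mu> + 1))" using e \<mu> by (intro mult_strict_left_mono) auto
        hence "e * \<mu> / (2 * (\<mu> + 1)) < e" using \<mu> by (subst pos_divide_less_eq) auto
        thus ?thesis by (simp add: e'_def)
      qed
      obtain \<delta> where \<delta>: "0 < \<delta>" "\<And>x z. norm (x - x0) < \<delta> \<Longrightarrow> z \<in> A \<Longrightarrow> norm (k' (x, z) - k' (x0, z)) \<le> e'"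
        using uc[OF e'] by blast
      show "\<exists>d>0. \<forall>x'\<in>UNIV. dist x' x0 < d \<longrightarrow> dist (Blinfun (D x')) (Blinfun (D x0)) < e"
      proof (intro exI[of _ \<delta>] conjI ballI impI \<delta>(1))
        fix x' assume "dist x' x0 < \<delta>"
        hence "norm (Blinfun (D x') - Blinfun (D x0)) \<le> e' * \<mu>"
          using Ddiff[of e' x' x0] \<delta>(2)[of x'] e' by (simp add: dist_norm)
        thus "dist (Blinfun (D x')) (Blinfun (D x0)) < e" using le by (simp add: dist_norm)
      qed
    qed
    fix x0
    show "((\<lambda>x. integral\<^sup>L lborel (\<lambda>z. indicator A z * k (x, z))) has_derivative Blinfun (D x0)) (at x0)"
      unfolding has_derivative_within_alt bounded_linear_Blinfun_apply[OF bl]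
    proof (intro conjI allI impI bl)
      fix e :: real assume e: "0 < e"
      define e' where "e' = e / (\<mu> + 1)"
      have e': "0 < e'" using e \<mu> by (simp add: e'_def)
      have le: "e' * \<mu> \<le> e" using e \<mu> by (simp add: e'_def field_simps)
      obtain \<delta> where \<delta>: "0 < \<delta>" "\<And>x z. norm (x - x0) < \<delta> \<Longrightarrow> z \<in> A \<Longrightarrow> norm (k' (x, z) - k' (x0, z)) \<le> e'"
        using uc[OF e'] by blast
      let ?I = "\<lambda>x. integral\<^sup>L lborel (\<lambda>z. indicator A z * k (x, z))"
      show "\<exists>d>0. \<forall>y\<in>UNIV. norm (y - x0) < d \<longrightarrow> norm (?I y - ?I x0 - D x0 (y - x0)) \<le> e * norm (y - x0)"
      proof (intro exI[of _ \<delta>] conjI ballI impI \<delta>(1))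
        fix y assume y: "norm (y - x0) < \<delta>"
        have lin: "\<bar>k (y, z) - k (x0, z) - k' (x0, z) (y - x0, 0)\<bar> \<le> norm (y - x0) * e'" if z: "z \<in> A" for z
        proof -
          have der: "((\<lambda>x. k (x, z)) has_derivative (\<lambda>h. k' (x, z) (h, 0))) (at x within ball x0 \<delta>)" for x
            by (rule has_derivative_compose[OF _ has_C1_derivativeD(1)[OF k, of _ UNIV]])
               (auto intro!: derivative_eq_intros)
          have "norm (k (y, z) - k (x0, z) - k' (x0, z) (y - x0, 0)) \<le> norm (y - x0) * e'"
          proof (rule differentiable_bound_linearization[where f = "\<lambda>x. k (x, z)"
                and f' = "\<lambda>x h. k' (x, z) (h, 0)" and S = "ball x0 \<delta>", OF _ der])
            show "x0 + t *\<^sub>R (y - x0) \<in> ball x0 \<delta>" if "t \<in> {0..1}" for t :: real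
            proof -
              have "norm (t *\<^sub>R (y - x0)) \<le> norm (y - x0)"
                using that by (simp add: mult_left_le_one_le)
              thus ?thesis using y by (simp add: dist_norm)
            qed
            show "x0 \<in> ball x0 \<delta>" using \<delta>(1) by simp
            fix x assume x: "x \<in> ball x0 \<delta>"
            show "onorm ((\<lambda>h. k' (x, z) (h, 0)) - (\<lambda>h. k' (x0, z) (h, 0))) \<le> e'"
            proof (rule onorm_bound)
              fix h
              have "norm ((k' (x, z) - k' (x0, z)) (h, 0)) \<le> norm (k' (x, z) - k' (x0, z)) * norm (h, 0::'b)"
                by (rule norm_blinfun)
              also have "\<dots> \<le> e' * norm h"
                unfolding norm_Pair0
                by (rule mult_right_mono[OF \<delta>(2)[OF _ z]]) (use x in \<open>auto simp: dist_norm norm_minus_commute\<close>)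
              finally show "norm (((\<lambda>h. k' (x, z) (h, 0)) - (\<lambda>h. k' (x0, z) (h, 0))) h) \<le> e' * norm h"
                by (simp add: blinfun.diff_left)
            qed (use e' in simp)
          qed
          thus ?thesis by simp
        qed
        have cd: "continuous_on UNIV (\<lambda>z. k (y, z) - k (x0, z) - k' (x0, z) (y - x0, 0))"
          by (intro continuous_on_diff ck ckh)
        have "?I y - ?I x0 - D x0 (y - x0)
            = integral\<^sup>L lborel (\<lambda>z. indicator A z * (k (y, z) - k (x0, z) - k' (x0, z) (y - x0, 0)))"
          unfolding D_def right_diff_distrib
          using int[OF ck[of y]] int[OF ck[of x0]] int[OF ckh[of x0 "(y - x0, 0)"]] by simp
        also have "\<bar>\<dots>\<bar> \<le> norm (y - x0) * e' * \<mu>"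
          by (rule bnd[OF cd lin])
        also have "\<dots> \<le> e * norm (y - x0)"
          using mult_left_mono[OF le, of "norm (y - x0)"] by (simp add: mult_ac)
        finally show "norm (?I y - ?I x0 - D x0 (y - x0)) \<le> e * norm (y - x0)" by simp
      qed
    qed
  qed
  thus ?thesis by blast
qed

section \<open>Small translations of a set of finite measure\<close>

lemma finite_measure_tail:
  fixes E :: "'a::euclidean_space set"
  assumes E: "E \<in> fmeasurable lborel" and e: "0 < e"
  obtains R where "0 < R" "measure lborel (E - cball 0 R) < e"
proof -
  let ?A = "\<lambda>n. E - cball 0 (real n)"
  have "(\<lambda>n. measure lborel (?A n)) \<longlonglongrightarrow> measure lborel (\<Inter>n. ?A n)"
  proof (rule Lim_measure_decseq)
    show "decseq ?A" by (intro decseq_SucI) auto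
    show "emeasure lborel (?A n) \<noteq> \<infinity>" for n
      using fmeasurableD2[OF fmeasurable_Diff[OF E, of "cball 0 (real n)"]] by simp
  qed (use E in auto)
  moreover have "(\<Inter>n. ?A n) = {}"
  proof -
    have "\<exists>n. norm x \<le> real n" for x :: 'a by (rule real_arch_simple)
    thus ?thesis by auto
  qed
  ultimately have "(\<lambda>n. measure lborel (?A n)) \<longlonglongrightarrow> measure lborel ({} :: 'a set)" by (simp only:)
  hence "(\<lambda>n. measure lborel (?A n)) \<longlonglongrightarrow> 0" by simp
  from order_tendstoD(2)[OF this e] obtain N where "\<And>n. n \<ge> N \<Longrightarrow> measure lborel (?A n) < e"
    by (auto simp: eventually_sequentially)
  from this[of "Suc N"] show thesis by (intro that[of "real (Suc N)"]) auto
qed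

lemma finite_measure_compact_open:
  fixes E :: "'a::euclidean_space set"
  assumes E: "E \<in> fmeasurable lborel" and e: "0 < e"
  obtains C U where "compact C" "C \<subseteq> E" "open U" "E \<subseteq> U" "U - C \<in> fmeasurable lborel"
    "measure lborel (U - C) < e"
proof -
  have Eb: "E \<in> sets borel" using E by auto
  have "0 < e / 3" using e by simp
  obtain U where U: "open U" "E \<subseteq> U" "emeasure lborel (U - E) < ennreal (e / 3)"
    using outer_regular_lborel[OF Eb \<open>0 < e / 3\<close>] by blast
  obtain T where T: "closed T" "T \<subseteq> E" "emeasure lebesgue (E - T) < ennreal (e / 3)"
  proof -
    have "E \<in> sets lebesgue" using Eb by (intro sets_completionI_sets) simp
    from sets_lebesgue_inner_closed[OF this \<open>0 < e / 3\<close>] show thesis using that by metis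
  qed
  obtain R where R: "measure lborel (E - cball 0 R) < e / 3"
    using finite_measure_tail[OF E \<open>0 < e / 3\<close>] by blast
  have f1: "U - E \<in> fmeasurable lborel"
    using U Eb by (intro fmeasurableI) (auto intro: order_less_trans)
  have f2: "E - T \<in> fmeasurable lborel" using T E by (intro fmeasurable_Diff) auto
  have f3: "E - cball 0 R \<in> fmeasurable lborel" using E by (intro fmeasurable_Diff) auto
  have m1: "measure lborel (U - E) < e / 3"
    using U(3) emeasure_eq_measure2[OF f1] e by (simp add: ennreal_less_iff)
  have "emeasure lborel (E - T) < ennreal (e / 3)" using T Eb by simp
  hence m2: "measure lborel (E - T) < e / 3"
    using emeasure_eq_measure2[OF f2] e by (simp add: ennreal_less_iff)
  have sub: "U - (T \<inter> cball 0 R) \<subseteq> (U - E) \<union> ((E - T) \<union> (E - cball 0 R))" by auto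
  have f: "(U - E) \<union> ((E - T) \<union> (E - cball 0 R)) \<in> fmeasurable lborel"
    using f1 f2 f3 by (intro fmeasurable.Un)
  have bor: "U - (T \<inter> cball 0 R) \<in> sets lborel" using U T by auto
  have "measure lborel (U - (T \<inter> cball 0 R)) \<le> measure lborel ((U - E) \<union> ((E - T) \<union> (E - cball 0 R)))"
    by (rule measure_mono_fmeasurable[OF sub bor f])
  also have "\<dots> \<le> measure lborel (U - E) + measure lborel ((E - T) \<union> (E - cball 0 R))"
    using f1 f2 f3 by (intro measure_Un_le sets.Un fmeasurableD)
  also have "\<dots> \<le> measure lborel (U - E) + (measure lborel (E - T) + measure lborel (E - cball 0 R))"
    using f2 f3 by (intro add_left_mono measure_Un_le fmeasurableD)
  also have "\<dots> < e" using m1 m2 R by linarith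
  finally show thesis
    using U T by (intro that[of "T \<inter> cball 0 R" U] fmeasurableI2[OF f sub bor]) auto
qed

context haar_C2_group
begin

lemma fmeasurable_translate:
  assumes "E \<in> fmeasurable lborel"
  shows "translate p E \<in> fmeasurable lborel" "measure lborel (translate p E) = measure lborel E"
  using assms emeasure_translate[of E p] translate_borel[of E p]
  by (auto simp: fmeasurable_def measure_def)

text \<open>Squeezing \<open>E\<close> between a compact and an open set, a small translation moves the compact set
  only inside the open one.\<close>

lemma measure_sym_diff_translate_small:
  assumes E: "E \<in> fmeasurable lborel" and e: "0 < e"
  obtains \<delta> where "0 < \<delta>" "\<And>y. norm y < \<delta> \<Longrightarrow> measure lborel (sym_diff E (translate y E)) < e"
proof -
  obtain C U where CU: "compact C" "C \<subseteq> E" "open U" "E \<subseteq> U" "U - C \<in> fmeasurable lborel"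
    "measure lborel (U - C) < e / 2"
    using finite_measure_compact_open[OF E, of "e / 2"] e by auto
  define W where "W = (\<lambda>z. mul (fst z) (snd z)) -` U"
  have "open W"
    unfolding W_def by (rule continuous_open_vimage[OF CU(3)]) (rule has_C1_derivativeD(4)[OF C1_mul])
  moreover have "{0} \<times> C \<subseteq> W" using CU by (auto simp: W_def)
  ultimately obtain X0 where X0: "0 \<in> X0" "open X0" "X0 \<times> C \<subseteq> W"
    using Elementary_Topology.tube_lemma[OF CU(1)] by metis
  obtain \<delta> where \<delta>: "0 < \<delta>" "ball 0 \<delta> \<subseteq> X0" using X0 open_contains_ball by metis
  have CW: "mul y c \<in> U" if "norm y < \<delta>" "c \<in> C" for y c
  proof -
    have "(y, c) \<in> W" using that X0(3) \<delta>(2) by (auto simp: subset_eq)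
    thus ?thesis by (simp add: W_def)
  qed
  show thesis
  proof (rule that[OF \<delta>(1)])
    fix y :: 'a assume y: "norm y < \<delta>"
    have sub: "sym_diff E (translate y E) \<subseteq> (U - C) \<union> translate y (U - C)"
    proof
      fix x assume x: "x \<in> sym_diff E (translate y E)"
      show "x \<in> (U - C) \<union> translate y (U - C)"
      proof (cases "x \<in> E")
        case True
        hence n: "mul (- y) x \<notin> E" using x by (auto simp: translate_def)
        show ?thesis
        proof (cases "x \<in> C")
          case True
          hence "mul (- y) x \<in> U" using CW[of "- y" x] y by simp
          thus ?thesis using n CU(2) by (auto simp: translate_def)
        qed (use True CU in auto)
      next
        case False
        hence n: "mul (- y) x \<in> E" using x by (auto simp: translate_def)
        show ?thesis
        proof (cases "mul (- y) x \<in> C")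
          case True
          hence "x \<in> U" using CW[of y "mul (- y) x"] y by simp
          thus ?thesis using False CU(2) by auto
        qed (use n CU in \<open>auto simp: translate_def\<close>)
      qed
    qed
    have "measure lborel (sym_diff E (translate y E)) \<le> measure lborel ((U - C) \<union> translate y (U - C))"
      by (rule measure_mono_fmeasurable[OF sub])
         (use E CU fmeasurable_translate in \<open>auto intro!: fmeasurable.Un\<close>)
    also have "\<dots> \<le> measure lborel (U - C) + measure lborel (translate y (U - C))"
      using CU fmeasurable_translate by (intro measure_Un_le) auto
    also have "\<dots> < e" using CU(6) fmeasurable_translate(2)[OF CU(5)] by simp
    finally show "measure lborel (sym_diff E (translate y E)) < e" .
  qed
qed

end

section \<open>Smoothing by left translations\<close>

lemma distr_lborel_uminus: "distr lborel borel uminus = (lborel :: 'a::euclidean_space measure)"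
  using lborel_affine[of "- 1" "0::'a"] by (simp add: density_1)

lemma integral_lborel_uminus:
  fixes f :: "'a::euclidean_space \<Rightarrow> real"
  assumes "f \<in> borel_measurable borel"
  shows "integral\<^sup>L lborel (\<lambda>x. f (- x)) = integral\<^sup>L lborel f"
proof -
  have "integral\<^sup>L (distr lborel borel uminus) f = integral\<^sup>L lborel (\<lambda>x. f (- x))"
    using assms by (intro integral_distr) auto
  thus ?thesis by (simp add: distr_lborel_uminus)
qed

definition mollifier :: "('a::euclidean_space \<Rightarrow> real) \<Rightarrow> real \<Rightarrow> bool" where
  "mollifier \<rho> r \<longleftrightarrow> C1_compact \<rho> \<and> (\<forall>x. 0 \<le> \<rho> x) \<and> (\<forall>x. \<rho> x \<noteq> 0 \<longrightarrow> norm x < r) \<and>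
     integral\<^sup>L lborel \<rho> = 1"

lemma mollifier_exists:
  assumes "0 < r"
  obtains \<rho> :: "'a::euclidean_space \<Rightarrow> real" where "mollifier \<rho> r"
proof -
  define c where "c = integral\<^sup>L lborel (bump (0::'a) r)"
  have c: "0 < c" using integral_bump_pos[OF assms, of "\<lambda>_. 1" 0] by (simp add: c_def)
  have "mollifier (\<lambda>x::'a. (1 / c) *\<^sub>R bump 0 r x) r"
    unfolding mollifier_def
  proof (intro conjI allI impI)
    show "C1_compact (\<lambda>x::'a. (1 / c) *\<^sub>R bump 0 r x)"
      by (rule C1_compact_scaleR[OF has_C1_derivative_const C1_compact_bump[OF assms]])
    show "0 \<le> (1 / c) *\<^sub>R bump 0 r x" for x :: 'a using c bump_nonneg[of 0 r x] by simp
    show "norm x < r" if "(1 / c) *\<^sub>R bump 0 r x \<noteq> 0" for x :: 'a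
      using that bump_pos_iff[OF assms, of 0 x] bump_nonneg[of 0 r x] by (auto simp: less_le)
    show "integral\<^sup>L lborel (\<lambda>x::'a. (1 / c) *\<^sub>R bump 0 r x) = 1"
      using c by (simp add: c_def)
  qed
  thus thesis by (rule that)
qed

lemma mollifierD:
  assumes "mollifier \<rho> r"
  shows "C1_compact \<rho>" "0 \<le> \<rho> x" "\<rho> x \<noteq> 0 \<Longrightarrow> norm x < r" "integral\<^sup>L lborel \<rho> = 1"
    "integrable lborel \<rho>" "continuous_on UNIV \<rho>" "\<rho> \<in> borel_measurable borel"
proof -
  show c: "C1_compact \<rho>" and "0 \<le> \<rho> x" "\<rho> x \<noteq> 0 \<Longrightarrow> norm x < r" "integral\<^sup>L lborel \<rho> = 1"
    using assms by (auto simp: mollifier_def)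
  show "continuous_on UNIV \<rho>" by (rule C1_compactD(3)[OF c])
  thus "integrable lborel \<rho>" "\<rho> \<in> borel_measurable borel"
    using integrable_continuous_bounded_support C1_compactD(2)[OF c] borel_measurable_continuous_onI by auto
qed

context haar_C2_group
begin

definition mollify :: "('a \<Rightarrow> real) \<Rightarrow> 'a set \<Rightarrow> 'a \<Rightarrow> real" where
  "mollify \<rho> E x = integral\<^sup>L lborel (\<lambda>y. \<rho> y * indicator E (mul (- y) x))"

lemma continuous_on_mul_pair: "continuous_on S (\<lambda>z. mul (- fst z) (snd z))"
proof -
  have "continuous_on S (\<lambda>z. (- fst z, snd z))" by (intro continuous_intros)
  from continuous_on_compose2[OF has_C1_derivativeD(3)[OF C1_mul, of UNIV] this] show ?thesis by simp
qed

lemma measurable_mul_minus_left [measurable]: "(\<lambda>y. mul (- y) x) \<in> borel_measurable borel"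
proof -
  have "continuous_on UNIV (\<lambda>y. mul (- fst (y, x)) (snd (y, x)))"
    by (rule continuous_on_compose2[OF continuous_on_mul_pair[of UNIV]]) (auto intro!: continuous_intros)
  thus ?thesis by (intro borel_measurable_continuous_onI) simp
qed

text \<open>The substitution \<open>y = x z\<^sup>-\<^sup>1\<close> preserves Lebesgue measure, because inversion is the linear map
  \<open>-1\<close>.  It moves the variable \<open>x\<close> into the smooth factor.\<close>

lemma mollify_eq:
  assumes \<rho>: "mollifier \<rho> r" and E: "E \<in> sets borel"
  shows "mollify \<rho> E x = integral\<^sup>L lborel (\<lambda>z. indicator E z * \<rho> (mul x (- z)))"
proof -
  have m: "(\<lambda>y. \<rho> y * indicator E (mul (- y) x)) \<in> borel_measurable borel"
    using mollifierD(7)[OF \<rho>] E by measurable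
  have m': "(\<lambda>y. \<rho> (mul x y) * indicator E (mul (- mul x y) x)) \<in> borel_measurable borel"
    using measurable_compose[OF measurable_mul m] .
  have "mollify \<rho> E x = integral\<^sup>L lborel (\<lambda>y. \<rho> (mul x y) * indicator E (mul (- mul x y) x))"
    unfolding mollify_def using integral_left_translate[OF m, of x] by simp
  also have "\<dots> = integral\<^sup>L lborel (\<lambda>z. \<rho> (mul x (- z)) * indicator E (mul (- mul x (- z)) x))"
    using integral_lborel_uminus[OF m'] by simp
  finally show ?thesis by (simp add: uminus_mul mult.commute)
qed

text \<open>For bounded \<open>x\<close> the kernel \<open>\<rho> (mul x (- z))\<close> vanishes outside a bounded set of \<open>z\<close>, so locally in \<open>x\<close>
  the mollification is an integral over a bounded set with a smooth kernel.\<close>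

lemma has_C1_derivative_mollify:
  assumes \<rho>: "mollifier \<rho> r" and E: "E \<in> sets borel"
  shows "\<exists>D. has_C1_derivative (mollify \<rho> E) D"
proof (rule has_C1_derivative_local)
  fix R
  define k where "k = (\<lambda>p::'a \<times> 'a. \<rho> (mul (fst p) (- snd p)))"
  obtain \<rho>' where \<rho>': "has_C1_derivative \<rho> \<rho>'" using C1_compactD(1)[OF mollifierD(1)[OF \<rho>]] by blast
  have "bounded_linear (\<lambda>p::'a \<times> 'a. (fst p, - snd p))"
    by (intro bounded_linear_Pair bounded_linear_fst bounded_linear_minus bounded_linear_snd)
  from has_C1_derivative_chain[OF has_C1_derivative_chain[OF has_C1_derivative_bounded_linear[OF this] C1_mul] \<rho>']
  obtain k' where k': "has_C1_derivative k k'" unfolding k_def by auto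
  define B where "B = (\<lambda>z. mul (- fst z) (snd z)) ` (cball 0 r \<times> cball 0 R)"
  have "compact B"
    unfolding B_def by (intro compact_continuous_image continuous_on_mul_pair compact_Times) auto
  hence B: "bounded B" "B \<in> sets borel" by (auto simp: compact_imp_bounded compact_imp_closed)
  have supp: "z \<in> B" if x: "norm x < R" and z: "\<rho> (mul x (- z)) \<noteq> 0" for x z
  proof -
    have "norm (mul x (- z)) \<le> r" using mollifierD(3)[OF \<rho> z] by simp
    moreover have "z = mul (- mul x (- z)) x" by (simp add: uminus_mul)
    ultimately show ?thesis
      unfolding B_def by (intro image_eqI[of _ _ "(mul x (- z), x)"]) (use x in auto)
  qed
  have "mollify \<rho> E x = integral\<^sup>L lborel (\<lambda>z. indicator (E \<inter> B) z * k (x, z))" if "norm x < R" for x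
    unfolding mollify_eq[OF \<rho> E] k_def
    by (rule Bochner_Integration.integral_cong) (use supp[OF that] in \<open>auto simp: indicator_def\<close>)
  moreover have "\<exists>D. has_C1_derivative (\<lambda>x. integral\<^sup>L lborel (\<lambda>z. indicator (E \<inter> B) z * k (x, z))) D"
    by (rule has_C1_derivative_integral_bounded[OF _ _ k']) (use E B bounded_subset[OF B(1)] in auto)
  ultimately show "\<exists>g g'. has_C1_derivative g g' \<and> (\<forall>x. norm x < R \<longrightarrow> mollify \<rho> E x = g x)" by blast
qed

lemma integrable_mollify:
  assumes \<rho>: "mollifier \<rho> r" and E: "E \<in> sets borel"
  shows "integrable lborel (\<lambda>y. \<rho> y * indicator E (mul (- y) x))"
  using integrable_bounded_mult[of "\<lambda>y. indicator E (mul (- y) x)" 1, OF _ _ mollifierD(5)[OF \<rho>]] E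
  by (simp add: mult.commute indicator_def)

lemma mollify_bounds:
  assumes \<rho>: "mollifier \<rho> r" and E: "E \<in> sets borel"
  shows "0 \<le> mollify \<rho> E x" "mollify \<rho> E x \<le> 1"
proof -
  show "0 \<le> mollify \<rho> E x"
    unfolding mollify_def using mollifierD(2)[OF \<rho>] by (intro Bochner_Integration.integral_nonneg) auto
  have "mollify \<rho> E x \<le> integral\<^sup>L lborel \<rho>"
    unfolding mollify_def using mollifierD(2)[OF \<rho>]
    by (intro integral_mono integrable_mollify[OF \<rho> E] mollifierD(5)[OF \<rho>]) (auto simp: indicator_def)
  thus "mollify \<rho> E x \<le> 1" using mollifierD(4)[OF \<rho>] by simp
qed

lemma integrable_pair_product:
  fixes H :: "'a \<Rightarrow> real"
  assumes \<rho>: "mollifier \<rho> r" and H: "continuous_on UNIV H" "bounded {x. H x \<noteq> 0}"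
    and w: "(\<lambda>(y, x). w y x) \<in> borel_measurable borel" "\<And>y x. \<bar>w y x\<bar> \<le> (1::real)"
  shows "integrable (lborel \<Otimes>\<^sub>M lborel) (\<lambda>(y, x). w y x * (\<rho> y * H x))"
proof -
  have "integrable lborel (\<lambda>z. (case z of (y, x) \<Rightarrow> w y x) * (\<rho> (fst z) * H (snd z)))"
  proof (rule integrable_bounded_mult[OF w(1)])
    show "integrable lborel (\<lambda>z. \<rho> (fst z) * H (snd z))"
    proof (rule integrable_continuous_bounded_support)
      show "continuous_on UNIV (\<lambda>z. \<rho> (fst z) * H (snd z))"
        by (intro continuous_on_mult continuous_on_compose2[OF mollifierD(6)[OF \<rho>]]
             continuous_on_compose2[OF H(1)] continuous_intros) auto
      show "bounded {z. \<rho> (fst z) * H (snd z) \<noteq> 0}"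
        by (rule bounded_subset[OF bounded_Times[OF C1_compactD(2)[OF mollifierD(1)[OF \<rho>]] H(2)]]) auto
    qed
  qed (use w(2) in \<open>auto split: prod.split\<close>)
  thus ?thesis unfolding lborel_prod by (simp add: case_prod_beta')
qed

lemma measurable_indicator_translate:
  assumes "E \<in> sets borel"
  shows "(\<lambda>(y, x). indicator E (mul (- y) x) :: real) \<in> borel_measurable borel"
proof -
  have "(indicator E :: 'a \<Rightarrow> real) \<in> borel_measurable borel" using assms by simp
  from measurable_compose[OF borel_measurable_continuous_onI[OF continuous_on_mul_pair[of UNIV]] this]
  have "(\<lambda>z. indicator E (mul (- fst z) (snd z)) :: real) \<in> borel_measurable borel" .
  thus ?thesis by (simp add: case_prod_beta')
qed

text \<open>A mollification is an average of indicator functions of left translates, which all have the same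
  perimeter.\<close>

lemma tv_le_mollify:
  assumes \<rho>: "mollifier \<rho> r" and E: "E \<in> sets borel" and a: "tv_le K (indicator E) a"
  shows "tv_le K (mollify \<rho> E) a"
  unfolding tv_le_def
proof
  fix U assume U: "U \<in> fields K"
  have UC: "C1_compact U" by (rule fieldsD(1)[OF U])
  let ?H = "divergence U"
  have H: "continuous_on UNIV ?H" "bounded {x. ?H x \<noteq> 0}"
    using C1_compactD(1)[OF UC] continuous_on_divergence bounded_support_divergence[OF UC] by blast+
  define w where "w y x = (indicator E (mul (- y) x) :: real)" for y x
  have int: "integrable (lborel \<Otimes>\<^sub>M lborel) (\<lambda>(y, x). w y x * (\<rho> y * ?H x))"
    by (rule integrable_pair_product[OF \<rho> H])
       (use measurable_indicator_translate[OF E] in \<open>auto simp: w_def indicator_def\<close>)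
  have trans: "w y x = indicator (translate y E) x" for y x
    by (simp add: w_def translate_def indicator_def)
  have le: "pairing (indicator (translate y E)) U \<le> a" for y
    using a translate_field_in_fields[OF U, of "- y"] pairing_translate[OF E UC, of y] by (simp add: tv_le_def)
  have "pairing (mollify \<rho> E) U = integral\<^sup>L lborel (\<lambda>x. integral\<^sup>L lborel (\<lambda>y. w y x * (\<rho> y * ?H x)))"
    unfolding pairing_def mollify_def w_def
    by (rule Bochner_Integration.integral_cong[OF refl], subst integral_mult_left_zero[symmetric]) (simp add: mult_ac)
  also have "\<dots> = integral\<^sup>L lborel (\<lambda>y. integral\<^sup>L lborel (\<lambda>x. w y x * (\<rho> y * ?H x)))"
    by (rule lborel_pair.Fubini_integral[OF int])
  also have "\<dots> = integral\<^sup>L lborel (\<lambda>y. \<rho> y * pairing (indicator (translate y E)) U)"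
    unfolding pairing_def trans
    by (rule Bochner_Integration.integral_cong[OF refl], subst integral_mult_right_zero[symmetric]) (simp add: mult_ac)
  also have "\<dots> \<le> integral\<^sup>L lborel (\<lambda>y. \<rho> y * a)"
  proof (rule integral_mono)
    have "integrable lborel (\<lambda>y. integral\<^sup>L lborel (\<lambda>x. w y x * (\<rho> y * ?H x)))"
      using lborel_pair.integrable_fst[OF int] by simp
    moreover have "integral\<^sup>L lborel (\<lambda>x. w y x * (\<rho> y * ?H x)) = \<rho> y * pairing (indicator (translate y E)) U" for y
      unfolding pairing_def trans by (subst integral_mult_right_zero[symmetric]) (simp add: mult_ac)
    ultimately show "integrable lborel (\<lambda>y. \<rho> y * pairing (indicator (translate y E)) U)" by simp
    show "integrable lborel (\<lambda>y. \<rho> y * a)" using mollifierD(5)[OF \<rho>] by simp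
    show "\<rho> y * pairing (indicator (translate y E)) U \<le> \<rho> y * a" for y
      by (rule mult_left_mono[OF le mollifierD(2)[OF \<rho>]])
  qed
  also have "\<dots> = a" using mollifierD(4)[OF \<rho>] by simp
  finally show "pairing (mollify \<rho> E) U \<le> a" .
qed

text \<open>The difference is at most the average over small \<open>y\<close> of the volume of the symmetric difference of \<open>E\<close>
  and its translate by \<open>y\<close>.\<close>

lemma mollify_close:
  fixes H :: "'a \<Rightarrow> real"
  assumes E: "E \<in> fmeasurable lborel" and H: "continuous_on UNIV H" "bounded {x. H x \<noteq> 0}" "\<And>x. 0 \<le> H x"
    and e: "0 < e"
  obtains \<rho> r where "mollifier \<rho> r" "integral\<^sup>L lborel (\<lambda>x. \<bar>mollify \<rho> E x - indicator E x\<bar> * H x) \<le> e"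
proof -
  have Eb: "E \<in> sets borel" using E by auto
  obtain M where M: "0 \<le> M" "\<And>x. norm (H x) \<le> M" using bounded_continuous_bounded_support[OF H(1,2)] by blast
  define e' where "e' = e / (M + 1)"
  have e': "0 < e'" using e M by (simp add: e'_def)
  have le_e: "M * e' \<le> e" using e M by (simp add: e'_def field_simps)
  obtain r where r: "0 < r" "\<And>y. norm y < r \<Longrightarrow> measure lborel (sym_diff E (translate y E)) < e'"
    using measure_sym_diff_translate_small[OF E e'] by blast
  obtain \<rho> :: "'a \<Rightarrow> real" where \<rho>: "mollifier \<rho> r" using mollifier_exists[OF r(1)] by blast
  define w where "w y x = \<bar>indicator E (mul (- y) x) - indicator E x :: real\<bar>" for y x
  have w_ind: "w y x = indicator (sym_diff E (translate y E)) x" for y x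
    by (auto simp: w_def translate_def indicator_def)
  have wm: "(\<lambda>(y, x). w y x) \<in> borel_measurable borel"
  proof -
    have "(\<lambda>z::'a \<times> 'a. indicator E (snd z) :: real) \<in> borel_measurable borel"
      by (rule measurable_compose[OF borel_measurable_continuous_onI[OF continuous_on_snd[OF continuous_on_id]]])
         (use Eb in simp)
    hence "(\<lambda>z. \<bar>(case z of (y, x) \<Rightarrow> indicator E (mul (- y) x)) - indicator E (snd z) :: real\<bar>) \<in> borel_measurable borel"
      using measurable_indicator_translate[OF Eb] by (intro borel_measurable_abs borel_measurable_diff)
    thus ?thesis by (simp add: w_def case_prod_beta')
  qed
  have int: "integrable (lborel \<Otimes>\<^sub>M lborel) (\<lambda>(y, x). w y x * (\<rho> y * H x))"
    by (rule integrable_pair_product[OF \<rho> H(1,2) wm]) (auto simp: w_def indicator_def)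
  have iE: "integrable lborel (\<lambda>y. \<rho> y * indicator E (mul (- y) x))" for x by (rule integrable_mollify[OF \<rho> Eb])
  have iw: "integrable lborel (\<lambda>y. \<rho> y * w y x)" for x
  proof -
    have "integrable lborel (\<lambda>y. \<bar>\<rho> y * indicator E (mul (- y) x) - \<rho> y * indicator E x\<bar>)"
      using iE[of x] mollifierD(5)[OF \<rho>] by (intro integrable_abs Bochner_Integration.integrable_diff) auto
    moreover have "\<bar>\<rho> y * indicator E (mul (- y) x) - \<rho> y * indicator E x\<bar> = \<rho> y * w y x" for y
      using mollifierD(2)[OF \<rho>, of y] by (simp add: w_def abs_mult right_diff_distrib[symmetric])
    ultimately show ?thesis by simp
  qed
  have point: "\<bar>mollify \<rho> E x - indicator E x\<bar> \<le> integral\<^sup>L lborel (\<lambda>y. \<rho> y * w y x)" for x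
  proof -
    have "mollify \<rho> E x - indicator E x
        = integral\<^sup>L lborel (\<lambda>y. \<rho> y * indicator E (mul (- y) x) - \<rho> y * indicator E x)"
      using iE[of x] mollifierD(4,5)[OF \<rho>] by (simp add: mollify_def)
    also have "\<bar>\<dots>\<bar> \<le> integral\<^sup>L lborel (\<lambda>y. \<bar>\<rho> y * indicator E (mul (- y) x) - \<rho> y * indicator E x\<bar>)"
      by (rule integral_abs_bound)
    also have "\<dots> = integral\<^sup>L lborel (\<lambda>y. \<rho> y * w y x)"
      using mollifierD(2)[OF \<rho>]
      by (intro Bochner_Integration.integral_cong refl) (simp add: w_def abs_mult right_diff_distrib[symmetric])
    finally show ?thesis .
  qed
  have inner: "integral\<^sup>L lborel (\<lambda>x. w y x * (\<rho> y * H x)) \<le> \<rho> y * (M * e')" for y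
  proof (cases "\<rho> y = 0")
    case False
    hence y: "norm y < r" using mollifierD(3)[OF \<rho>] by blast
    have fm: "sym_diff E (translate y E) \<in> fmeasurable lborel"
      using E fmeasurable_translate by (auto intro!: fmeasurable.Un)
    have "integral\<^sup>L lborel (\<lambda>x. w y x * (\<rho> y * H x)) \<le> integral\<^sup>L lborel (\<lambda>x. (\<rho> y * M) * w y x)"
    proof (rule integral_mono)
      show "integrable lborel (\<lambda>x. w y x * (\<rho> y * H x))"
        unfolding w_ind
      proof (rule integrable_bounded_mult[where B = 1])
        show "(indicator (sym_diff E (translate y E)) :: 'a \<Rightarrow> real) \<in> borel_measurable borel"
          using fmeasurableD[OF fm] by (intro borel_measurable_indicator) simp
        show "integrable lborel (\<lambda>x. \<rho> y * H x)"
          using integrable_continuous_bounded_support[OF H(1,2)] by simp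
      qed (simp add: indicator_def)
      show "integrable lborel (\<lambda>x. (\<rho> y * M) * w y x)"
        unfolding w_ind using fm by (auto simp: fmeasurable_def)
      show "w y x * (\<rho> y * H x) \<le> (\<rho> y * M) * w y x" for x
      proof -
        have "\<rho> y * H x \<le> \<rho> y * M"
          using M(2)[of x] by (intro mult_left_mono mollifierD(2)[OF \<rho>]) auto
        hence "w y x * (\<rho> y * H x) \<le> w y x * (\<rho> y * M)"
          by (rule mult_left_mono) (simp add: w_def)
        thus ?thesis by (simp add: mult.commute)
      qed
    qed
    also have "\<dots> = \<rho> y * M * measure lborel (sym_diff E (translate y E))"
      unfolding w_ind using fm by (simp add: fmeasurable_def)
    also have "\<dots> \<le> \<rho> y * M * e'"
      using r(2)[OF y] M(1) mollifierD(2)[OF \<rho>] by (intro mult_left_mono) auto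
    finally show ?thesis by (simp add: mult_ac)
  qed simp
  have swap: "integrable (lborel \<Otimes>\<^sub>M lborel) (\<lambda>(x, y). w y x * (\<rho> y * H x))"
    using lborel_pair.integrable_product_swap[OF int] by (simp add: case_prod_beta')
  have "integral\<^sup>L lborel (\<lambda>x. \<bar>mollify \<rho> E x - indicator E x\<bar> * H x)
      \<le> integral\<^sup>L lborel (\<lambda>x. integral\<^sup>L lborel (\<lambda>y. w y x * (\<rho> y * H x)))"
  proof (rule integral_mono)
    obtain D where D: "has_C1_derivative (mollify \<rho> E) D" using has_C1_derivative_mollify[OF \<rho> Eb] by blast
    have "mollify \<rho> E \<in> borel_measurable borel"
      by (rule borel_measurable_continuous_onI[OF has_C1_derivativeD(3)[OF D]])
    moreover have "\<bar>mollify \<rho> E x - indicator E x\<bar> \<le> 1" for x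
      using mollify_bounds[OF \<rho> Eb, of x] by (simp add: indicator_def abs_le_iff)
    ultimately show "integrable lborel (\<lambda>x. \<bar>mollify \<rho> E x - indicator E x\<bar> * H x)"
      by (intro integrable_bounded_mult[where B = 1] integrable_continuous_bounded_support[OF H(1,2)])
         (use Eb in auto)
    show "integrable lborel (\<lambda>x. integral\<^sup>L lborel (\<lambda>y. w y x * (\<rho> y * H x)))"
      using lborel_pair.integrable_fst[OF swap] by simp
    fix x
    have "\<bar>mollify \<rho> E x - indicator E x\<bar> * H x \<le> integral\<^sup>L lborel (\<lambda>y. \<rho> y * w y x) * H x"
      by (rule mult_right_mono[OF point H(3)])
    also have "\<dots> = integral\<^sup>L lborel (\<lambda>y. w y x * (\<rho> y * H x))"
      by (subst integral_mult_left_zero[symmetric]) (simp add: mult_ac)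
    finally show "\<bar>mollify \<rho> E x - indicator E x\<bar> * H x \<le> integral\<^sup>L lborel (\<lambda>y. w y x * (\<rho> y * H x))" .
  qed
  also have "\<dots> = integral\<^sup>L lborel (\<lambda>y. integral\<^sup>L lborel (\<lambda>x. w y x * (\<rho> y * H x)))"
    by (rule lborel_pair.Fubini_integral[OF int])
  also have "\<dots> \<le> integral\<^sup>L lborel (\<lambda>y. \<rho> y * (M * e'))"
    using lborel_pair.integrable_fst[OF int] mollifierD(5)[OF \<rho>] inner by (intro integral_mono) auto
  also have "\<dots> = M * e'" using mollifierD(4)[OF \<rho>] by simp
  also have "\<dots> \<le> e" by (rule le_e)
  finally show thesis using that[OF \<rho>] by blast
qed

end

section \<open>Submodularity of the perimeter\<close>

context haar_C2_group
begin

text \<open>Smooth functions with variation at most \<open>a\<close> come arbitrarily close to \<open>f\<close> in every weighted \<open>L\<^sup>1\<close> norm.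
  Weights \<open>H\<close> of bounded support make the notion apply to complements of sets of finite measure.\<close>

definition approximable :: "'a set \<Rightarrow> ('a \<Rightarrow> real) \<Rightarrow> real \<Rightarrow> bool" where
  "approximable K f a \<longleftrightarrow> f \<in> borel_measurable borel \<and> (\<forall>x. 0 \<le> f x \<and> f x \<le> 1) \<and>
     (\<forall>H e. continuous_on UNIV H \<and> bounded {x. H x \<noteq> (0::real)} \<and> (\<forall>x. 0 \<le> H x) \<and> 0 < e \<longrightarrow>
        (\<exists>\<phi> \<phi>'. has_C1_derivative \<phi> \<phi>' \<and> (\<forall>x. 0 \<le> \<phi> x \<and> \<phi> x \<le> 1) \<and> tv_le K \<phi> a \<and>
           integral\<^sup>L lborel (\<lambda>x. \<bar>\<phi> x - f x\<bar> * H x) \<le> e))"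

lemma approximable_indicator:
  assumes E: "E \<in> fmeasurable lborel" and a: "per K E \<le> ereal a"
  shows "approximable K (indicator E) a"
  unfolding approximable_def
proof (intro conjI allI impI)
  have Eb: "E \<in> sets borel" using E by auto
  thus "indicator E \<in> borel_measurable borel" by simp
  fix H :: "'a \<Rightarrow> real" and e :: real
  assume "continuous_on UNIV H \<and> bounded {x. H x \<noteq> 0} \<and> (\<forall>x. 0 \<le> H x) \<and> 0 < e"
  then obtain \<rho> r where \<rho>: "mollifier \<rho> r"
    "integral\<^sup>L lborel (\<lambda>x. \<bar>mollify \<rho> E x - indicator E x\<bar> * H x) \<le> e"
    using mollify_close[OF E, of H e] by blast
  obtain D where "has_C1_derivative (mollify \<rho> E) D" using has_C1_derivative_mollify[OF \<rho>(1) Eb] by blast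
  thus "\<exists>\<phi> \<phi>'. has_C1_derivative \<phi> \<phi>' \<and> (\<forall>x. 0 \<le> \<phi> x \<and> \<phi> x \<le> 1) \<and> tv_le K \<phi> a \<and>
           integral\<^sup>L lborel (\<lambda>x. \<bar>\<phi> x - indicator E x\<bar> * H x) \<le> e"
    using mollify_bounds[OF \<rho>(1) Eb] tv_le_mollify[OF \<rho>(1) Eb a[unfolded per_le_iff]] \<rho>(2) by blast
qed (auto simp: indicator_def)

lemma fields_uminus:
  assumes "U \<in> fields K"
  shows "(\<lambda>x. - U x) \<in> fields (uminus ` K)"
  unfolding fields_def
proof (intro CollectI conjI allI)
  show "C1_compact (\<lambda>x. - U x)" by (rule C1_compact_minus[OF fieldsD(1)[OF assms]])
  fix p
  obtain k where "k \<in> K" "U p = dL p 0 k" using fieldsD(2)[OF assms] by blast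
  thus "- U p \<in> dL p 0 ` uminus ` K"
    by (intro image_eqI[of _ _ "- k"] imageI) (simp_all add: blinfun.minus_right)
qed

lemma fields_uminus_iff: "U \<in> fields (uminus ` K) \<longleftrightarrow> (\<lambda>x. - U x) \<in> fields K"
  using fields_uminus[of U "uminus ` K"] fields_uminus[of "\<lambda>x. - U x" K]
  by (auto simp: image_image)

lemma convex_body_at_0_uminus: "convex_body_at_0 K \<Longrightarrow> convex_body_at_0 (uminus ` K)"
  unfolding convex_body_at_0_def
  by (auto intro!: compact_negations convex_negations image_eqI[of 0 uminus 0])

lemma pairing_minus:
  assumes "C1_compact U"
  shows "pairing f (\<lambda>x. - U x) = - pairing f U"
proof -
  obtain U' where U': "has_C1_derivative U U'" using C1_compactD(1)[OF assms] by blast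
  show ?thesis by (simp add: pairing_def divergence_minus[OF U'])
qed

lemma pairing_one_minus:
  assumes U: "C1_compact U" and f: "f \<in> borel_measurable borel" "\<And>x. \<bar>f x\<bar> \<le> 1"
  shows "pairing (\<lambda>x. 1 - f x) U = pairing f (\<lambda>x. - U x)"
proof -
  have int: "integrable lborel (\<lambda>x. f x * divergence U x)"
    by (rule integrable_bounded_mult[OF f integrable_divergence[OF U]])
  have "pairing (\<lambda>x. 1 - f x) U = integral\<^sup>L lborel (divergence U) - pairing f U"
    using int integrable_divergence[OF U] by (simp add: pairing_def left_diff_distrib)
  thus ?thesis by (simp add: integral_divergence_zero[OF U] pairing_minus[OF U])
qed

lemma approximable_one_minus:
  assumes a: "approximable (uminus ` K) f a"
  shows "approximable K (\<lambda>x. 1 - f x) a"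
  unfolding approximable_def
proof (intro conjI allI impI)
  have f: "f \<in> borel_measurable borel" "\<And>x. 0 \<le> f x" "\<And>x. f x \<le> 1"
    using a by (auto simp: approximable_def)
  show "(\<lambda>x. 1 - f x) \<in> borel_measurable borel" using f by simp
  show "0 \<le> 1 - f x" "1 - f x \<le> 1" for x using f by auto
  fix H :: "'a \<Rightarrow> real" and e :: real
  assume "continuous_on UNIV H \<and> bounded {x. H x \<noteq> 0} \<and> (\<forall>x. 0 \<le> H x) \<and> 0 < e"
  then obtain \<phi> \<phi>' where \<phi>: "has_C1_derivative \<phi> \<phi>'" "\<And>x. 0 \<le> \<phi> x" "\<And>x. \<phi> x \<le> 1" "tv_le (uminus ` K) \<phi> a"
    "integral\<^sup>L lborel (\<lambda>x. \<bar>\<phi> x - f x\<bar> * H x) \<le> e"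
    using a unfolding approximable_def by blast
  have m: "\<phi> \<in> borel_measurable borel" by (rule borel_measurable_continuous_onI[OF has_C1_derivativeD(3)[OF \<phi>(1)]])
  have "tv_le K (\<lambda>x. 1 - \<phi> x) a"
    unfolding tv_le_def
  proof
    fix U assume U: "U \<in> fields K"
    have "pairing (\<lambda>x. 1 - \<phi> x) U = pairing \<phi> (\<lambda>x. - U x)"
      using \<phi>(2,3) by (intro pairing_one_minus fieldsD(1)[OF U] m) (simp add: abs_le_iff order_trans[OF _ \<phi>(2)])
    also have "\<dots> \<le> a" using \<phi>(4) fields_uminus[OF U] by (simp add: tv_le_def)
    finally show "pairing (\<lambda>x. 1 - \<phi> x) U \<le> a" .
  qed
  moreover have "\<bar>1 - \<phi> x - (1 - f x)\<bar> = \<bar>\<phi> x - f x\<bar>" for x by simp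
  ultimately show "\<exists>\<phi> \<phi>'. has_C1_derivative \<phi> \<phi>' \<and> (\<forall>x. 0 \<le> \<phi> x \<and> \<phi> x \<le> 1) \<and> tv_le K \<phi> a \<and>
           integral\<^sup>L lborel (\<lambda>x. \<bar>\<phi> x - (1 - f x)\<bar> * H x) \<le> e"
    using \<phi> has_C1_derivative_diff[OF has_C1_derivative_const[of 1] \<phi>(1)]
    by (intro exI[of _ "\<lambda>x. 1 - \<phi> x"] exI[of _ "\<lambda>x. 0 - \<phi>' x"]) auto
qed

lemma approximable_submodular:
  assumes K: "convex_body_at_0 K" and f: "approximable K f a" and g: "approximable K g b"
    and U: "U \<in> fields K" and W: "W \<in> fields K"
  shows "pairing (\<lambda>x. max (f x) (g x)) U + pairing (\<lambda>x. min (f x) (g x)) W \<le> a + b"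
proof (rule field_le_epsilon)
  fix e :: real assume e: "0 < e"
  have UC: "C1_compact U" and WC: "C1_compact W" using U W by (auto intro: fieldsD)
  define H where "H x = \<bar>divergence U x\<bar> + \<bar>divergence W x\<bar>" for x
  have c: "continuous_on UNIV (divergence U)" "continuous_on UNIV (divergence W)"
    using C1_compactD(1)[OF UC] C1_compactD(1)[OF WC] continuous_on_divergence by blast+
  have H1: "continuous_on UNIV H" unfolding H_def by (intro continuous_intros c)
  have H2: "bounded {x. H x \<noteq> 0}"
    by (rule bounded_subset[of "{x. divergence U x \<noteq> 0} \<union> {x. divergence W x \<noteq> 0}"])
       (auto simp: H_def bounded_support_divergence UC WC)
  have H3: "0 \<le> H x" for x by (simp add: H_def)
  have iH: "integrable lborel H" by (rule integrable_continuous_bounded_support[OF H1 H2])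
  have fm: "f \<in> borel_measurable borel" "\<And>x. 0 \<le> f x" "\<And>x. f x \<le> 1"
    and gm: "g \<in> borel_measurable borel" "\<And>x. 0 \<le> g x" "\<And>x. g x \<le> 1"
    using f g by (auto simp: approximable_def)
  have e2: "0 < e / 2" using e by simp
  obtain \<phi> \<phi>' where \<phi>: "has_C1_derivative \<phi> \<phi>'" "\<And>x. 0 \<le> \<phi> x" "\<And>x. \<phi> x \<le> 1" "tv_le K \<phi> a"
    "integral\<^sup>L lborel (\<lambda>x. \<bar>\<phi> x - f x\<bar> * H x) \<le> e / 2"
    using f H1 H2 H3 e2 unfolding approximable_def by meson
  obtain \<psi> \<psi>' where \<psi>: "has_C1_derivative \<psi> \<psi>'" "\<And>x. 0 \<le> \<psi> x" "\<And>x. \<psi> x \<le> 1" "tv_le K \<psi> b"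
    "integral\<^sup>L lborel (\<lambda>x. \<bar>\<psi> x - g x\<bar> * H x) \<le> e / 2"
    using g H1 H2 H3 e2 unfolding approximable_def by meson
  have m: "\<phi> \<in> borel_measurable borel" "\<psi> \<in> borel_measurable borel"
    using borel_measurable_continuous_onI has_C1_derivativeD(3) \<phi>(1) \<psi>(1) by blast+
  have int: "integrable lborel (\<lambda>x. h x * divergence V x)"
    if "h \<in> borel_measurable borel" "\<And>x. 0 \<le> h x" "\<And>x. h x \<le> 1" "C1_compact V" for h V
    by (rule integrable_bounded_mult[OF that(1) _ integrable_divergence[OF that(4)], of 1])
       (use that(2,3) in \<open>simp add: abs_of_nonneg\<close>)
  have iU: "integrable lborel (\<lambda>x. max (f x) (g x) * divergence U x)"
    "integrable lborel (\<lambda>x. max (\<phi> x) (\<psi> x) * divergence U x)"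
    "integrable lborel (\<lambda>x. min (f x) (g x) * divergence W x)"
    "integrable lborel (\<lambda>x. min (\<phi> x) (\<psi> x) * divergence W x)"
    using fm gm \<phi>(2,3) \<psi>(2,3) m UC WC by (auto intro!: int borel_measurable_max borel_measurable_min simp: le_max_iff_disj min_le_iff_disj)
  have iD: "integrable lborel (\<lambda>x. \<bar>\<phi> x - f x\<bar> * H x)" "integrable lborel (\<lambda>x. \<bar>\<psi> x - g x\<bar> * H x)"
  proof -
    have "\<bar>\<bar>\<phi> x - f x\<bar>\<bar> \<le> 1" "\<bar>\<bar>\<psi> x - g x\<bar>\<bar> \<le> 1" for x
      using \<phi>(2,3)[of x] \<psi>(2,3)[of x] fm(2,3)[of x] gm(2,3)[of x] by (auto simp: abs_le_iff)
    thus "integrable lborel (\<lambda>x. \<bar>\<phi> x - f x\<bar> * H x)" "integrable lborel (\<lambda>x. \<bar>\<psi> x - g x\<bar> * H x)"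
      using m fm gm by (auto intro!: integrable_bounded_mult[OF _ _ iH, of _ 1])
  qed
  let ?D = "\<lambda>x. (max (f x) (g x) * divergence U x + min (f x) (g x) * divergence W x)
     - (max (\<phi> x) (\<psi> x) * divergence U x + min (\<phi> x) (\<psi> x) * divergence W x)"
  have point: "?D x \<le> \<bar>\<phi> x - f x\<bar> * H x + \<bar>\<psi> x - g x\<bar> * H x" for x
  proof -
    let ?d = "\<bar>\<phi> x - f x\<bar> + \<bar>\<psi> x - g x\<bar>"
    have 1: "\<bar>max (f x) (g x) - max (\<phi> x) (\<psi> x)\<bar> \<le> ?d" "\<bar>min (f x) (g x) - min (\<phi> x) (\<psi> x)\<bar> \<le> ?d"
      by (auto simp: max_def min_def)
    have "?D x = (max (f x) (g x) - max (\<phi> x) (\<psi> x)) * divergence U x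
        + (min (f x) (g x) - min (\<phi> x) (\<psi> x)) * divergence W x" by (simp add: algebra_simps)
    also have "\<dots> \<le> \<bar>max (f x) (g x) - max (\<phi> x) (\<psi> x)\<bar> * \<bar>divergence U x\<bar>
        + \<bar>min (f x) (g x) - min (\<phi> x) (\<psi> x)\<bar> * \<bar>divergence W x\<bar>"
      unfolding abs_mult[symmetric] by (intro add_mono abs_ge_self)
    also have "\<dots> \<le> ?d * \<bar>divergence U x\<bar> + ?d * \<bar>divergence W x\<bar>"
      using 1 by (intro add_mono mult_right_mono) auto
    finally show ?thesis by (simp add: H_def algebra_simps)
  qed
  have "pairing (\<lambda>x. max (f x) (g x)) U + pairing (\<lambda>x. min (f x) (g x)) W
      - (pairing (\<lambda>x. max (\<phi> x) (\<psi> x)) U + pairing (\<lambda>x. min (\<phi> x) (\<psi> x)) W) = integral\<^sup>L lborel ?D"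
    unfolding pairing_def using iU by simp
  also have "\<dots> \<le> integral\<^sup>L lborel (\<lambda>x. \<bar>\<phi> x - f x\<bar> * H x + \<bar>\<psi> x - g x\<bar> * H x)"
    by (rule integral_mono[OF _ _ point]) (use iU iD in simp_all)
  also have "\<dots> \<le> e" using iD \<phi>(5) \<psi>(5) by simp
  finally show "pairing (\<lambda>x. max (f x) (g x)) U + pairing (\<lambda>x. min (f x) (g x)) W \<le> a + b + e"
    using smooth_submodular[OF K \<phi>(1,4) \<psi>(1,4) U W] by linarith
qed

text \<open>The supremum \<open>c\<close> of the first term leaves \<open>s - c\<close> as a bound for the second one.\<close>

lemma tv_le_split:
  assumes K: "convex_body_at_0 K" "convex_body_at_0 K'"
    and le: "\<And>U W. U \<in> fields K \<Longrightarrow> W \<in> fields K' \<Longrightarrow> pairing f U + pairing g W \<le> s"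
  shows "\<exists>c d. tv_le K f c \<and> tv_le K' g d \<and> c + d \<le> s"
proof -
  let ?S = "pairing f ` fields K"
  obtain W0 where W0: "W0 \<in> fields K'" using zero_in_fields[OF K(2)] by blast
  have ne: "?S \<noteq> {}" using zero_in_fields[OF K(1)] by blast
  have "bdd_above ?S"
    by (rule bdd_aboveI2[of _ _ "s - pairing g W0"]) (use le[OF _ W0] in force)
  hence 1: "tv_le K f (Sup ?S)" by (auto simp: tv_le_def intro: cSup_upper)
  have "tv_le K' g (s - Sup ?S)"
    unfolding tv_le_def
  proof
    fix W assume "W \<in> fields K'"
    hence "Sup ?S \<le> s - pairing g W" by (intro cSup_least[OF ne]) (use le in force)
    thus "pairing g W \<le> s - Sup ?S" by simp
  qed
  thus ?thesis using 1 by (intro exI[of _ "Sup ?S"] exI[of _ "s - Sup ?S"]) simp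
qed

lemma per_Un_Int:
  assumes K: "convex_body_at_0 K" and E: "E \<in> fmeasurable lborel" "per K E \<le> ereal a"
    and G: "G \<in> fmeasurable lborel" "per K G \<le> ereal b"
  shows "\<exists>c d. per K (E \<union> G) \<le> ereal c \<and> per K (E \<inter> G) \<le> ereal d \<and> c + d \<le> a + b"
proof -
  have "(\<lambda>x. max (indicator E x) (indicator G x :: real)) = indicator (E \<union> G)"
    "(\<lambda>x. min (indicator E x) (indicator G x :: real)) = indicator (E \<inter> G)"
    by (auto simp: indicator_def)
  hence "pairing (indicator (E \<union> G)) U + pairing (indicator (E \<inter> G)) W \<le> a + b"
    if "U \<in> fields K" "W \<in> fields K" for U W
    using approximable_submodular[OF K approximable_indicator[OF E] approximable_indicator[OF G] that] by simp
  from tv_le_split[OF K K this] show ?thesis by (simp add: per_le_iff)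
qed

text \<open>The perimeter of a complement is the perimeter with respect to the reflected body, since
  divergences of test fields have integral zero.\<close>

lemma per_Diff:
  assumes K: "convex_body_at_0 K" and E: "E \<in> fmeasurable lborel" "per K E \<le> ereal a"
    and G: "G \<in> fmeasurable lborel" "per (uminus ` K) G \<le> ereal b"
  shows "\<exists>c d. per K (E - G) \<le> ereal c \<and> per (uminus ` K) (G - E) \<le> ereal d \<and> c + d \<le> a + b"
proof -
  have max: "(\<lambda>x. max (indicator E x) (1 - indicator G x :: real)) = (\<lambda>x. 1 - indicator (G - E) x)"
    and min: "(\<lambda>x. min (indicator E x) (1 - indicator G x :: real)) = indicator (E - G)"
    by (auto simp: indicator_def)
  have m: "indicator (G - E) \<in> borel_measurable borel" using E G by (auto intro!: borel_measurable_indicator)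
  have "pairing (indicator (E - G)) W + pairing (indicator (G - E)) U \<le> a + b"
    if U: "U \<in> fields (uminus ` K)" and W: "W \<in> fields K" for U W
  proof -
    have V: "(\<lambda>x. - U x) \<in> fields K" using U by (simp add: fields_uminus_iff)
    have "pairing (\<lambda>x. 1 - indicator (G - E) x) (\<lambda>x. - U x) = pairing (indicator (G - E)) U"
      using pairing_one_minus[OF fieldsD(1)[OF V] m] by (simp add: indicator_def)
    thus ?thesis
      using approximable_submodular[OF K approximable_indicator[OF E]
          approximable_one_minus[OF approximable_indicator[OF G]] V W]
      unfolding max min by simp
  qed
  from tv_le_split[OF K convex_body_at_0_uminus[OF K] this] show ?thesis by (simp add: per_le_iff)
qed

end

section \<open>Balls have finite perimeter\<close>

definition cutoff :: "real \<Rightarrow> real" where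
  "cutoff t = 1 - sq_pos (1 - sq_pos t)"

lemma cutoff_simps: "t \<le> 0 \<Longrightarrow> cutoff t = 0" "1 \<le> t \<Longrightarrow> cutoff t = 1" "0 \<le> cutoff t" "cutoff t \<le> 1"
proof -
  show "t \<le> 0 \<Longrightarrow> cutoff t = 0" by (simp add: cutoff_def sq_pos_def)
  show "cutoff t = 1" if "1 \<le> t"
  proof -
    have "1 \<le> sq_pos t" using that by (simp add: sq_pos_def max_def one_le_power)
    thus ?thesis by (simp add: cutoff_def sq_pos_def)
  qed
  show "cutoff t \<le> 1" by (simp add: cutoff_def sq_pos_nonneg)
  have "max 0 (1 - sq_pos t) \<le> 1" using sq_pos_nonneg[of t] by simp
  hence "sq_pos (1 - sq_pos t) \<le> 1"
    by (simp add: sq_pos_def[of "1 - sq_pos t"] power_le_one)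
  thus "0 \<le> cutoff t" by (simp add: cutoff_def)
qed

definition cutoff' :: "real \<Rightarrow> real" where
  "cutoff' t = 4 * max 0 (1 - sq_pos t) * max 0 t"

lemma DERIV_cutoff: "(cutoff has_real_derivative cutoff' t) (at t)"
  unfolding cutoff_def[abs_def] cutoff'_def
  by (rule derivative_eq_intros DERIV_chain2[OF DERIV_sq_pos] DERIV_sq_pos refl)+ simp

lemma continuous_on_sq_pos: "continuous_on S sq_pos"
  by (rule has_C1_derivativeD(3)[OF has_C1_derivative_sq_pos])

lemma has_C1_derivative_cutoff: "has_C1_derivative cutoff (\<lambda>t. blinfun_scaleR_left (cutoff' t))"
proof (rule has_C1_derivative_real[OF DERIV_cutoff])
  show "continuous_on UNIV cutoff'"
    unfolding cutoff'_def[abs_def] by (intro continuous_intros continuous_on_sq_pos)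
qed

lemma cutoff'_zero:
  assumes "t \<le> 0 \<or> 1 \<le> t"
  shows "cutoff' t = 0"
proof (cases "t \<le> 0")
  case False
  hence "1 \<le> t\<^sup>2" using assms by (intro one_le_power) auto
  thus ?thesis using False by (simp add: cutoff'_def sq_pos_def)
qed (simp add: cutoff'_def)

lemma cutoff'_bound: "\<bar>cutoff' t\<bar> \<le> 4"
proof (cases "0 < t \<and> t < 1")
  case True
  have "max 0 (1 - sq_pos t) * max 0 t \<le> 1 * 1"
    using True sq_pos_nonneg[of t] by (intro mult_mono) auto
  thus ?thesis by (simp add: cutoff'_def abs_mult)
next
  case False
  thus ?thesis using cutoff'_zero[of t] by auto
qed

text \<open>Bernoulli's inequality bounds the volume of the shell linearly in its thickness \<open>t / \<rho>\<close>.\<close>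

lemma measure_shell:
  fixes a :: "'a::euclidean_space"
  assumes "0 < \<rho>" "0 < t" "t \<le> \<rho>\<^sup>2"
  shows "measure lborel (cball a \<rho> - ball a (\<rho> - t / \<rho>))
    \<le> unit_ball_vol (real DIM('a)) * \<rho> ^ DIM('a) * (real DIM('a) / \<rho>\<^sup>2) * t"
proof -
  let ?d = "DIM('a)" and ?u = "unit_ball_vol (real DIM('a))" and ?r = "\<rho> - t / \<rho>"
  have r: "0 \<le> ?r" "?r \<le> \<rho>" using assms by (auto simp: field_simps power2_eq_square)
  have u: "0 \<le> ?u" by simp
  have sub: "ball a ?r \<subseteq> cball a \<rho>" using r by auto
  have fin: "cball a \<rho> \<in> fmeasurable lborel" by (rule fmeasurable_bounded) auto
  have "measure lborel (cball a \<rho> - ball a ?r) = measure lborel (cball a \<rho>) - measure lborel (ball a ?r)"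
    using fin sub by (intro measurable_measure_Diff) auto
  also have "\<dots> = ?u * (\<rho> ^ ?d - ?r ^ ?d)"
    using r assms by (simp add: content_cball content_ball right_diff_distrib)
  also have "\<dots> \<le> ?u * (\<rho> ^ ?d * (real ?d / \<rho>\<^sup>2 * t))"
  proof (rule mult_left_mono[OF _ u])
    have "?r = \<rho> * (1 + - (t / \<rho>\<^sup>2))" using assms by (simp add: field_simps power2_eq_square)
    hence "?r ^ ?d = \<rho> ^ ?d * (1 + - (t / \<rho>\<^sup>2)) ^ ?d" by (simp only: power_mult_distrib)
    moreover have "1 + real ?d * - (t / \<rho>\<^sup>2) \<le> (1 + - (t / \<rho>\<^sup>2)) ^ ?d"
      using assms by (intro Bernoulli_inequality) (simp add: field_simps)
    hence "\<rho> ^ ?d * (1 + real ?d * - (t / \<rho>\<^sup>2)) \<le> \<rho> ^ ?d * (1 + - (t / \<rho>\<^sup>2)) ^ ?d"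
      using assms by (intro mult_left_mono) auto
    ultimately show "\<rho> ^ ?d - ?r ^ ?d \<le> \<rho> ^ ?d * (real ?d / \<rho>\<^sup>2 * t)"
      by (simp add: algebra_simps)
  qed
  finally show ?thesis by (simp add: mult_ac)
qed

context haar_C2_group
begin

text \<open>Approximate the indicator function of the ball by cutoff functions of the squared distance.
  Their derivative is of order \<open>n\<close> on a shell of measure of order \<open>1 / n\<close>, and test fields are
  uniformly bounded near the ball.\<close>

lemma per_ball_finite:
  assumes K: "convex_body_at_0 K" and \<rho>: "0 < \<rho>"
  shows "\<exists>c. per K (ball a \<rho>) \<le> ereal c"
proof -
  obtain M where M: "0 \<le> M" "\<And>U x. U \<in> fields K \<Longrightarrow> x \<in> cball a \<rho> \<Longrightarrow> norm (U x) \<le> M"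
    using fields_bounded[OF K compact_cball[of a \<rho>]] by blast
  define v where "v = unit_ball_vol (real DIM('a)) * \<rho> ^ DIM('a) * (real DIM('a) / \<rho>\<^sup>2)"
  have v: "0 \<le> v" using \<rho> by (simp add: v_def)
  define c where "c = 8 * \<rho> * M * v"
  define q where "q x = \<rho>\<^sup>2 - (x - a) \<bullet> (x - a)" for x
  define \<psi> where "\<psi> n x = cutoff (n * q x)" for n :: real and x
  define q' where "q' x = - (2 *\<^sub>R blinfun_inner_right (x - a))" for x
  have q: "has_C1_derivative q q'" unfolding q_def[abs_def] q'_def[abs_def] by (rule has_C1_derivative_sqdist)
  define \<psi>' where "\<psi>' n x = blinfun_scaleR_left (cutoff' (n * q x)) o\<^sub>L (n *\<^sub>R q' x + (blinfun_scaleR_left (q x) o\<^sub>L 0))" for n x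
  have \<psi>: "has_C1_derivative (\<psi> n) (\<psi>' n)" for n
    using has_C1_derivative_chain[OF has_C1_derivative_scaleR[OF has_C1_derivative_const[of n] q] has_C1_derivative_cutoff]
    by (simp add: \<psi>_def[abs_def] \<psi>'_def[abs_def])
  have \<psi>'_apply: "\<psi>' n x w = cutoff' (n * q x) * (n * (- 2 * ((x - a) \<bullet> w)))" for n x w
    by (simp add: \<psi>'_def q'_def blinfun.add_left blinfun.scaleR_left blinfun.minus_left zero_blinfun.rep_eq mult.commute)
  obtain N :: nat where N: "1 / \<rho>\<^sup>2 \<le> real N" "0 < N"
  proof -
    obtain m :: nat where "1 / \<rho>\<^sup>2 \<le> real m" using real_arch_simple by blast
    thus thesis by (intro that[of "Suc m"]) auto
  qed
  have "tv_le K (indicator (ball a \<rho>)) c"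
    unfolding tv_le_def
  proof
    fix U assume U: "U \<in> fields K"
    have UC: "C1_compact U" by (rule fieldsD(1)[OF U])
    have bound: "pairing (\<psi> n) U \<le> c" if n: "real N \<le> n" for n :: real
    proof -
      have n0: "0 < n" using n N by simp
      have tn: "0 < 1 / n" "1 / n \<le> \<rho>\<^sup>2"
        using n0 order_trans[OF N(1) n] \<rho> by (auto simp: field_simps)
      let ?S = "cball a \<rho> - ball a (\<rho> - (1 / n) / \<rho>)"
      have Sf: "?S \<in> fmeasurable lborel" by (rule fmeasurable_bounded) auto
      have point: "- \<psi>' n x (U x) \<le> (8 * n * \<rho> * M) * indicator ?S x" for x
      proof (cases "0 < n * q x \<and> n * q x < 1")
        case True
        hence q1: "0 < q x" "q x < 1 / n" using n0 by (auto simp: zero_less_mult_iff field_simps)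
        have "(norm (x - a))\<^sup>2 < \<rho>\<^sup>2" using q1(1) by (simp add: q_def power2_norm_eq_inner)
        hence x1: "norm (x - a) \<le> \<rho>" using \<rho> by (meson less_imp_le power2_less_imp_less)
        \<comment> \<open>the inner radius \<open>\<rho> - 1 / (n \<rho>)\<close> lies below the square root of \<open>\<rho>\<^sup>2 - 1 / n\<close>\<close>
        have "(\<rho> - (1 / n) / \<rho>)\<^sup>2 = \<rho>\<^sup>2 - 2 * (1 / n) + (1 / n) * ((1 / n) / \<rho>\<^sup>2)"
        proof -
          have "\<rho> * ((1 / n) / \<rho>) = 1 / n" "((1 / n) / \<rho>)\<^sup>2 = (1 / n) * ((1 / n) / \<rho>\<^sup>2)"
            using \<rho> by (simp_all add: power2_eq_square)
          thus ?thesis unfolding power2_diff using \<rho> by simp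
        qed
        also have "\<dots> \<le> \<rho>\<^sup>2 - 2 * (1 / n) + (1 / n) * 1"
          using tn \<rho> by (intro add_left_mono mult_left_mono) (auto simp: pos_divide_le_eq mult.commute)
        also have "\<dots> < (norm (x - a))\<^sup>2" using q1(2) by (simp add: q_def power2_norm_eq_inner)
        finally have x2: "\<rho> - (1 / n) / \<rho> \<le> norm (x - a)"
          by (meson norm_ge_zero power2_less_imp_less less_imp_le)
        have xS: "x \<in> ?S" using x1 x2 by (simp add: dist_norm norm_minus_commute)
        have "\<bar>(x - a) \<bullet> U x\<bar> \<le> norm (x - a) * norm (U x)" by (rule Cauchy_Schwarz_ineq2)
        also have "\<dots> \<le> \<rho> * M" using x1 M(2)[OF U, of x] xS \<rho> by (intro mult_mono) auto
        finally have in_bd: "\<bar>(x - a) \<bullet> U x\<bar> \<le> \<rho> * M" .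
        have "- \<psi>' n x (U x) \<le> \<bar>cutoff' (n * q x)\<bar> * (n * (2 * \<bar>(x - a) \<bullet> U x\<bar>))"
          unfolding \<psi>'_apply using n0 abs_ge_minus_self[of "cutoff' (n * q x) * (n * (- 2 * ((x - a) \<bullet> U x)))"]
          by (simp add: abs_mult)
        also have "\<dots> \<le> 4 * (n * (2 * (\<rho> * M)))"
          using n0 in_bd \<rho> M by (intro mult_mono cutoff'_bound) auto
        finally show ?thesis using xS by (simp add: mult_ac)
      next
        case False
        hence "cutoff' (n * q x) = 0" using cutoff'_zero[of "n * q x"] by auto
        thus ?thesis using n0 \<rho> M by (simp add: \<psi>'_apply)
      qed
      have "pairing (\<psi> n) U = integral\<^sup>L lborel (\<lambda>x. - \<psi>' n x (U x))"
        unfolding pairing_def using integral_by_parts(3)[OF \<psi> UC, of n] by simp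
      also have "\<dots> \<le> integral\<^sup>L lborel (\<lambda>x. (8 * n * \<rho> * M) * indicator ?S x)"
        by (rule integral_mono[OF _ _ point]) (use integral_by_parts(2)[OF \<psi> UC, of n] Sf in \<open>auto simp: fmeasurable_def\<close>)
      also have "\<dots> = (8 * n * \<rho> * M) * measure lborel ?S" using Sf by (simp add: fmeasurable_def)
      also have "\<dots> \<le> (8 * n * \<rho> * M) * (v * (1 / n))"
        using measure_shell[OF \<rho> tn, of a] n0 \<rho> M by (intro mult_left_mono) (auto simp: v_def)
      also have "\<dots> = c" using n0 by (simp add: c_def)
      finally show ?thesis .
    qed
    have int: "integrable lborel (divergence U)" by (rule integrable_divergence[OF UC])
    have mD: "divergence U \<in> borel_measurable borel" using borel_measurable_integrable[OF int] by simp
    have "(\<lambda>n. pairing (\<psi> (real n)) U) \<longlonglongrightarrow> pairing (indicator (ball a \<rho>)) U"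
      unfolding pairing_def
    proof (rule integral_dominated_convergence)
      show "(\<lambda>x. indicator (ball a \<rho>) x * divergence U x) \<in> borel_measurable lborel"
        using mD by (intro borel_measurable_times borel_measurable_indicator) auto
      show "(\<lambda>x. \<psi> (real n) x * divergence U x) \<in> borel_measurable lborel" for n
        using borel_measurable_continuous_onI[OF has_C1_derivativeD(3)[OF \<psi>[of "real n"]]] mD by simp
      show "integrable lborel (\<lambda>x. \<bar>divergence U x\<bar>)" using int by simp
      show "AE x in lborel. norm (\<psi> (real n) x * divergence U x) \<le> \<bar>divergence U x\<bar>" for n
        using cutoff_simps(3,4) by (intro always_eventually allI) (simp add: \<psi>_def abs_mult mult_left_le_one_le)
      show "AE x in lborel. (\<lambda>n. \<psi> (real n) x * divergence U x) \<longlonglongrightarrow> indicator (ball a \<rho>) x * divergence U x"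
      proof (intro always_eventually allI tendsto_mult tendsto_const)
        fix x
        have qx: "0 < q x \<longleftrightarrow> x \<in> ball a \<rho>"
        proof -
          have "0 < bump a \<rho> x \<longleftrightarrow> 0 < q x"
            unfolding bump_def q_def sq_pos_def by (auto simp: max_def)
          thus ?thesis using bump_pos_iff[OF \<rho>, of a x] by simp
        qed
        show "(\<lambda>n. \<psi> (real n) x) \<longlonglongrightarrow> indicator (ball a \<rho>) x"
        proof (cases "0 < q x")
          case True
          obtain m :: nat where m: "1 / q x \<le> real m" using real_arch_simple by blast
          have "\<psi> (real n) x = 1" if "m \<le> n" for n
          proof -
            have "1 / q x \<le> real n" using m that by (meson of_nat_mono order_trans)
            hence "1 \<le> real n * q x" using True by (simp add: field_simps)
            thus ?thesis by (simp add: \<psi>_def cutoff_simps)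
          qed
          hence "\<forall>\<^sub>F n in sequentially. \<psi> (real n) x = 1" unfolding eventually_sequentially by blast
          thus ?thesis using qx True by (simp add: tendsto_eventually)
        next
          case False
          hence "\<psi> (real n) x = 0" for n
            by (simp add: \<psi>_def cutoff_simps mult_nonneg_nonpos)
          thus ?thesis using qx False by simp
        qed
      qed
    qed
    moreover have "\<forall>\<^sub>F n in sequentially. pairing (\<psi> (real n)) U \<le> c"
      using bound unfolding eventually_sequentially by (intro exI[of _ N]) auto
    ultimately show "pairing (indicator (ball a \<rho>)) U \<le> c"
      by (rule tendsto_upperbound) simp
  qed
  thus ?thesis by (auto simp: per_le_iff)
qed

end

section \<open>Sets that cannot be shrunk profitably\<close>

context haar_C2_group
begin

text \<open>Removing a part of such a set \<open>\<Omega>\<close> decreases the perimeter by at most \<open>C\<close> times the removed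
  volume.  The real numbers \<open>w\<close> and \<open>z\<close> are upper bounds for perimeters, so that subsets of infinite
  perimeter impose no condition.\<close>

definition inward_minimizing :: "'a set \<Rightarrow> real \<Rightarrow> 'a set \<Rightarrow> bool" where
  "inward_minimizing K C \<Omega> \<longleftrightarrow> \<Omega> \<in> fmeasurable lborel \<and>
     (\<exists>w. per K \<Omega> \<le> ereal w \<and>
       (\<forall>Z z. Z \<in> sets borel \<longrightarrow> Z \<subseteq> \<Omega> \<longrightarrow> per K Z \<le> ereal z \<longrightarrow> w \<le> z + C * measure lborel (\<Omega> - Z)))"

definition perimeter_real :: "'a set \<Rightarrow> 'a set \<Rightarrow> real" where
  "perimeter_real K E = real_of_ereal (per K E)"

lemma perimeter_real:
  assumes "convex_body_at_0 K" "per K E \<le> ereal c"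
  shows "per K E = ereal (perimeter_real K E)" "0 \<le> perimeter_real K E" "perimeter_real K E \<le> c"
proof -
  have 0: "0 \<le> per K E" by (rule per_nonneg[OF assms(1)])
  show 1: "per K E = ereal (perimeter_real K E)"
    unfolding perimeter_real_def using 0 assms(2) by (cases "per K E") auto
  show "0 \<le> perimeter_real K E" using 0 1 by simp
  show "perimeter_real K E \<le> c" using assms(2) 1 by simp
qed

text \<open>For large \<open>C\<close> the functional \<open>J Z = per K Z - C |Z|\<close> is negative at \<open>A\<close>.  Any of its minimizers
  among the subsets of \<open>A\<close> is inward minimizing and has positive measure.  Since \<open>J\<close> is submodular, the
  intersection of two nearly minimizing sets is nearly minimizing, with added errors.  So the
  intersections of the tails of a fast minimizing sequence are again minimizing, and their union is a
  minimizer, since \<open>J\<close> is lower semicontinuous along monotone sequences.\<close>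

lemma inward_minimizing_subset_exists:
  assumes K: "convex_body_at_0 K" and A: "A \<in> fmeasurable lborel" "0 < measure lborel A"
    and pA: "per K A \<le> ereal a"
  shows "\<exists>C \<Omega>. 0 < C \<and> \<Omega> \<subseteq> A \<and> 0 < measure lborel \<Omega> \<and> inward_minimizing K C \<Omega>"
proof -
  have Ab: "A \<in> sets borel" using A by auto
  define P where "P = perimeter_real K"
  \<comment> \<open>this choice gives \<open>J A = - 1\<close>\<close>
  define C where "C = (P A + 1) / measure lborel A"
  have PA: "0 \<le> P A" using perimeter_real[OF K pA] by (simp add: P_def)
  have C: "0 < C" using A(2) PA by (simp add: C_def)
  define J where "J Z = P Z - C * measure lborel Z" for Z
  define \<Z> where "\<Z> = {Z. Z \<in> sets borel \<and> Z \<subseteq> A \<and> (\<exists>c. per K Z \<le> ereal c)}"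
  have JA: "J A = - 1" using A(2) by (simp add: J_def C_def)
  have AZ: "A \<in> \<Z>" using Ab pA by (auto simp: \<Z>_def)
  have \<Z>D: "Z \<in> fmeasurable lborel" "per K Z = ereal (P Z)" "0 \<le> P Z" "Z \<in> sets borel" "Z \<subseteq> A"
    "measure lborel Z \<le> measure lborel A" if "Z \<in> \<Z>" for Z
    using that perimeter_real[OF K] fmeasurableI2[OF A(1)] measure_mono_fmeasurable[of Z A lborel] A(1)
    by (auto simp: \<Z>_def P_def)
  have sub: "Y \<inter> Z \<in> \<Z>" "Y \<union> Z \<in> \<Z>" "J (Y \<union> Z) + J (Y \<inter> Z) \<le> J Y + J Z"
    if Y: "Y \<in> \<Z>" and Z: "Z \<in> \<Z>" for Y Z
  proof -
    obtain c d where cd: "per K (Y \<union> Z) \<le> ereal c" "per K (Y \<inter> Z) \<le> ereal d" "c + d \<le> P Y + P Z"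
      using per_Un_Int[OF K \<Z>D(1)[OF Y] _ \<Z>D(1)[OF Z], of "P Y" "P Z"] \<Z>D(2)[OF Y] \<Z>D(2)[OF Z] by auto
    show "Y \<inter> Z \<in> \<Z>" "Y \<union> Z \<in> \<Z>" using cd \<Z>D[OF Y] \<Z>D[OF Z] by (auto simp: \<Z>_def)
    have "P (Y \<union> Z) + P (Y \<inter> Z) \<le> P Y + P Z"
      using perimeter_real(3)[OF K cd(1)] perimeter_real(3)[OF K cd(2)] cd(3) by (simp add: P_def)
    moreover have "measure lborel (Y \<union> Z) + measure lborel (Y \<inter> Z) = measure lborel Y + measure lborel Z"
      using measure_Un3[OF \<Z>D(1)[OF Y] \<Z>D(1)[OF Z]] by simp
    hence "C * measure lborel (Y \<union> Z) + C * measure lborel (Y \<inter> Z) = C * measure lborel Y + C * measure lborel Z"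
      by (metis distrib_left)
    ultimately show "J (Y \<union> Z) + J (Y \<inter> Z) \<le> J Y + J Z" by (simp add: J_def)
  qed
  have lsc: "F \<in> \<Z> \<and> J F \<le> \<kappa>"
    if E: "\<And>n. E n \<in> \<Z>" and F: "F \<in> sets borel" "F \<subseteq> A"
      and lim: "\<And>x. (\<lambda>n. indicator (E n) x :: real) \<longlonglongrightarrow> indicator F x"
      and le: "\<And>n::nat. J (E n) \<le> k n" and k: "k \<longlonglongrightarrow> \<kappa>" for E F k \<kappa>
  proof -
    have "(\<lambda>n. integral\<^sup>L lborel (indicator (E n) :: _ \<Rightarrow> real)) \<longlonglongrightarrow> integral\<^sup>L lborel (indicator F)"
    proof (rule integral_dominated_convergence)
      show "integrable lborel (indicator A :: _ \<Rightarrow> real)" using A by (auto simp: fmeasurable_def)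
      show "AE x in lborel. norm (indicator (E n) x :: real) \<le> indicator A x" for n
        using \<Z>D(5)[OF E[of n]] by (intro always_eventually allI) (auto simp: indicator_def)
    qed (use F lim \<Z>D(4)[OF E] in auto)
    hence m: "(\<lambda>n. measure lborel (E n)) \<longlonglongrightarrow> measure lborel F" by simp
    have "per K F \<le> ereal (\<kappa> + C * measure lborel F)"
    proof (rule per_lower_semicontinuous[OF \<Z>D(4)[OF E] F(1) lim])
      show "per K (E n) \<le> ereal (k n + C * measure lborel (E n))" for n
        using le[of n] \<Z>D(2)[OF E[of n]] by (simp add: J_def)
      show "(\<lambda>n. k n + C * measure lborel (E n)) \<longlonglongrightarrow> \<kappa> + C * measure lborel F"
        by (intro tendsto_intros k m)
    qed
    moreover from this have "P F \<le> \<kappa> + C * measure lborel F"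
      using perimeter_real(3)[OF K] unfolding P_def by blast
    ultimately show ?thesis using F by (auto simp: \<Z>_def J_def)
  qed
  define j where "j = Inf (J ` \<Z>)"
  have bdd: "bdd_below (J ` \<Z>)"
  proof (rule bdd_belowI2)
    fix Z assume Z: "Z \<in> \<Z>"
    have "C * measure lborel Z \<le> C * measure lborel A" using \<Z>D(6)[OF Z] C by simp
    thus "- (C * measure lborel A) \<le> J Z" using \<Z>D(3)[OF Z] by (simp add: J_def)
  qed
  have j_le: "j \<le> J Z" if "Z \<in> \<Z>" for Z unfolding j_def using that bdd by (intro cInf_lower) auto
  have "\<exists>Z\<in>\<Z>. J Z < j + (1 / 2) ^ n" for n :: nat
  proof -
    have "\<exists>y\<in>J ` \<Z>. y < j + (1 / 2) ^ n"
      unfolding j_def by (rule cInf_lessD) (use AZ in auto)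
    thus ?thesis by auto
  qed
  then obtain Z where Z: "\<And>n. Z n \<in> \<Z>" "\<And>n. J (Z n) < j + (1 / 2) ^ n" by metis
  define D where "D N m = (\<Inter>n\<in>{N..N + m}. Z n)" for N m
  have D_Suc: "D N (Suc m) = D N m \<inter> Z (N + Suc m)" for N m
  proof -
    have "{N..N + Suc m} = insert (N + Suc m) {N..N + m}" by auto
    thus ?thesis by (auto simp: D_def)
  qed
  \<comment> \<open>the errors \<open>(1 / 2) ^ n\<close> for \<open>n\<close> from \<open>N\<close> to \<open>N + m\<close> add up to the stated bound\<close>
  have D: "D N m \<in> \<Z> \<and> J (D N m) \<le> j + 2 * (1 / 2) ^ N - (1 / 2) ^ (N + m)" for N m
  proof (induction m)
    case 0
    show ?case using Z(1)[of N] Z(2)[of N] by (simp add: D_def)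
  next
    case (Suc m)
    have "J (D N m \<inter> Z (N + Suc m)) \<le> J (D N m) + J (Z (N + Suc m)) - J (D N m \<union> Z (N + Suc m))"
      using sub(3)[OF conjunct1[OF Suc] Z(1)[of "N + Suc m"]] by linarith
    also have "\<dots> \<le> (j + 2 * (1 / 2) ^ N - (1 / 2) ^ (N + m)) + (j + (1 / 2) ^ (N + Suc m)) - j"
      using Suc Z(2)[of "N + Suc m"] j_le[OF sub(2)[OF conjunct1[OF Suc] Z(1)]]
      by (intro diff_mono add_mono) (auto simp: less_imp_le)
    also have "\<dots> = j + 2 * (1 / 2) ^ N - (1 / 2) ^ (N + Suc m)" by simp
    finally show ?case using sub(1)[OF conjunct1[OF Suc] Z(1)] by (simp add: D_Suc)
  qed
  define I where "I N = (\<Inter>m. D N m)" for N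
  have Isub: "I N \<subseteq> A" and Ib: "I N \<in> sets borel" for N
    using \<Z>D(5)[OF conjunct1[OF D[of N 0]]] \<Z>D(4)[OF conjunct1[OF D]] by (auto simp: I_def intro!: sets.countable_INT)
  have I: "I N \<in> \<Z> \<and> J (I N) \<le> j + 2 * (1 / 2) ^ N" for N
  proof (rule lsc[where E = "D N" and k = "\<lambda>_. j + 2 * (1 / 2) ^ N", OF _ Ib Isub _ _ tendsto_const])
    show "D N m \<in> \<Z>" for m using D by blast
    have "decseq (D N)" by (intro decseq_SucI) (auto simp: D_Suc)
    thus "(\<lambda>n. indicator (D N n) x :: real) \<longlonglongrightarrow> indicator (I N) x" for x
      unfolding I_def by (rule LIMSEQ_indicator_decseq)
    have "(0::real) \<le> (1 / 2) ^ (N + m)" for m by simp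
    thus "J (D N m) \<le> j + 2 * (1 / 2) ^ N" for m using D[of N m] by (meson diff_le_eq le_add_same_cancel1 order_trans)
  qed
  define \<Omega> where "\<Omega> = (\<Union>N. I N)"
  have "\<Omega> \<in> \<Z> \<and> J \<Omega> \<le> j + 2 * 0"
  proof (rule lsc[where E = I and k = "\<lambda>N. j + 2 * (1 / 2) ^ N"])
    show "\<Omega> \<in> sets borel" "\<Omega> \<subseteq> A" using Ib Isub by (auto simp: \<Omega>_def)
    have "I N \<subseteq> I (Suc N)" for N
    proof
      fix x assume "x \<in> I N"
      hence "x \<in> Z n" if "N \<le> n" for n
        using that by (auto simp: I_def D_def dest!: spec[of _ "n - N"])
      thus "x \<in> I (Suc N)" by (auto simp: I_def D_def)
    qed
    hence "incseq I" by (rule incseq_SucI)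
    thus "(\<lambda>n. indicator (I n) x :: real) \<longlonglongrightarrow> indicator \<Omega> x" for x
      unfolding \<Omega>_def by (rule LIMSEQ_indicator_incseq)
    show "(\<lambda>N. j + 2 * (1 / 2) ^ N) \<longlonglongrightarrow> j + 2 * 0"
      by (intro tendsto_intros LIMSEQ_power_zero) simp
  qed (use I in auto)
  hence \<Omega>: "\<Omega> \<in> \<Z>" "J \<Omega> \<le> j" by auto
  have "J \<Omega> \<le> - 1" using \<Omega>(2) j_le[OF AZ] JA by simp
  hence "0 < C * measure lborel \<Omega>" using \<Z>D(3)[OF \<Omega>(1)] by (simp add: J_def)
  hence pos: "0 < measure lborel \<Omega>" using C by (simp add: zero_less_mult_iff)
  have "P \<Omega> \<le> z + C * measure lborel (\<Omega> - Y)"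
    if Y: "Y \<in> sets borel" "Y \<subseteq> \<Omega>" "per K Y \<le> ereal z" for Y z
  proof -
    have YZ: "Y \<in> \<Z>" using Y \<Z>D(5)[OF \<Omega>(1)] by (auto simp: \<Z>_def)
    have "measure lborel (\<Omega> - Y) = measure lborel \<Omega> - measure lborel Y"
      using Y \<Z>D(1)[OF \<Omega>(1)] by (intro measurable_measure_Diff) auto
    hence "C * measure lborel (\<Omega> - Y) = C * measure lborel \<Omega> - C * measure lborel Y"
      by (simp add: right_diff_distrib)
    moreover have "P Y \<le> z" using perimeter_real(3)[OF K Y(3)] by (simp add: P_def)
    moreover have "J \<Omega> \<le> J Y" using \<Omega>(2) j_le[OF YZ] by simp
    ultimately show ?thesis by (simp add: J_def)
  qed
  hence "inward_minimizing K C \<Omega>"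
    using \<Z>D(1,2)[OF \<Omega>(1)] unfolding inward_minimizing_def by (intro conjI exI[of _ "P \<Omega>"]) auto
  thus ?thesis using C pos \<Z>D(5)[OF \<Omega>(1)] by blast
qed

end

section \<open>Adding and removing translates of an inward minimizing set\<close>

lemma fmeasurable_lborel_borel:
  assumes "E \<in> fmeasurable lborel" "G \<in> fmeasurable lborel"
  shows "E \<inter> G \<in> sets borel" "E - G \<in> sets borel"
  using fmeasurableD[OF assms(1)] fmeasurableD[OF assms(2)] by auto

lemma measure_Int_Diff_lborel:
  assumes "E \<in> fmeasurable lborel" "G \<in> fmeasurable lborel"
  shows "measure lborel E = measure lborel (E \<inter> G) + measure lborel (E - G)"
proof -
  have "E \<inter> G \<in> fmeasurable lborel" "E - G \<in> fmeasurable lborel"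
    using assms by (auto intro!: fmeasurable_Int_fmeasurable fmeasurable_Diff)
  moreover have "(E \<inter> G) \<union> (E - G) = E" "(E - G) - (E \<inter> G) = E - G" by auto
  ultimately show ?thesis using measure_Un2[of "E \<inter> G" lborel "E - G"] by simp
qed

context haar_C2_group
begin

lemma translate_Diff: "translate p (E - G) = translate p E - translate p G"
  and translate_mono: "E \<subseteq> G \<Longrightarrow> translate p E \<subseteq> translate p G"
  by (auto simp: translate_def)

lemma inward_minimizing_translate:
  assumes "inward_minimizing K C \<Omega>"
  shows "inward_minimizing K C (translate p \<Omega>)"
proof -
  obtain w where \<Omega>: "\<Omega> \<in> fmeasurable lborel" "per K \<Omega> \<le> ereal w"
    and w: "\<And>Z z. Z \<in> sets borel \<Longrightarrow> Z \<subseteq> \<Omega> \<Longrightarrow> per K Z \<le> ereal z \<Longrightarrow> w \<le> z + C * measure lborel (\<Omega> - Z)"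
    using assms unfolding inward_minimizing_def by blast
  have "w \<le> z + C * measure lborel (translate p \<Omega> - Z)"
    if Z: "Z \<in> sets borel" "Z \<subseteq> translate p \<Omega>" "per K Z \<le> ereal z" for Z z
  proof -
    define Y where "Y = translate (- p) Z"
    have Y: "Y \<in> sets borel" "per K Y \<le> ereal z"
      using Z translate_borel[OF Z(1)] per_translate[OF Z(1)] by (auto simp: Y_def)
    have sub: "Y \<subseteq> \<Omega>"
      using translate_mono[OF Z(2), of "- p"] by (simp add: Y_def translate_translate)
    have "translate p (\<Omega> - Y) = translate p \<Omega> - Z"
      by (simp add: Y_def translate_Diff translate_translate)
    moreover have "measure lborel (translate p (\<Omega> - Y)) = measure lborel (\<Omega> - Y)"
      using \<Omega>(1) Y(1) by (intro fmeasurable_translate fmeasurable_Diff) auto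
    ultimately show ?thesis using w[OF Y(1) sub Y(2)] by simp
  qed
  moreover have "\<Omega> \<in> sets borel" using \<Omega>(1) by auto
  ultimately show ?thesis
    using \<Omega> fmeasurable_translate[OF \<Omega>(1)] per_translate[of \<Omega> K p]
    unfolding inward_minimizing_def by auto
qed

text \<open>By submodularity the perimeter of the union exceeds that of \<open>F\<close> by at most the perimeter that \<open>\<Omega>\<close> loses
  when it is cut down to \<open>F \<inter> \<Omega>\<close>.\<close>

lemma per_Un_inward_minimizing:
  assumes K: "convex_body_at_0 K" and F: "F \<in> fmeasurable lborel" "per K F \<le> ereal a"
    and \<Omega>: "inward_minimizing K C \<Omega>"
  shows "per K (F \<union> \<Omega>) \<le> ereal (a + C * measure lborel (\<Omega> - F))"
proof -
  obtain w where w: "\<Omega> \<in> fmeasurable lborel" "per K \<Omega> \<le> ereal w"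
    "\<And>Z z. Z \<in> sets borel \<Longrightarrow> Z \<subseteq> \<Omega> \<Longrightarrow> per K Z \<le> ereal z \<Longrightarrow> w \<le> z + C * measure lborel (\<Omega> - Z)"
    using \<Omega> unfolding inward_minimizing_def by blast
  obtain c d where cd: "per K (F \<union> \<Omega>) \<le> ereal c" "per K (F \<inter> \<Omega>) \<le> ereal d" "c + d \<le> a + w"
    using per_Un_Int[OF K F w(1,2)] by blast
  have "w \<le> d + C * measure lborel (\<Omega> - F \<inter> \<Omega>)"
    using F(1) w(1) by (intro w(3) cd(2) fmeasurable_lborel_borel) auto
  moreover have "\<Omega> - F \<inter> \<Omega> = \<Omega> - F" by auto
  ultimately have "c \<le> a + C * measure lborel (\<Omega> - F)" using cd(3) by simp
  thus ?thesis using cd(1) by (meson ereal_less_eq(3) order_trans)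
qed

text \<open>Here \<open>\<Omega>\<close> is cut down to \<open>\<Omega> - F\<close>; its boundary inside \<open>F\<close> is seen from outside, hence the reflected
  body.\<close>

lemma per_Diff_inward_minimizing:
  assumes K: "convex_body_at_0 K" and F: "F \<in> fmeasurable lborel" "per K F \<le> ereal a"
    and \<Omega>: "inward_minimizing (uminus ` K) C \<Omega>"
  shows "per K (F - \<Omega>) \<le> ereal (a + C * measure lborel (\<Omega> \<inter> F))"
proof -
  obtain w where w: "\<Omega> \<in> fmeasurable lborel" "per (uminus ` K) \<Omega> \<le> ereal w"
    "\<And>Z z. Z \<in> sets borel \<Longrightarrow> Z \<subseteq> \<Omega> \<Longrightarrow> per (uminus ` K) Z \<le> ereal z \<Longrightarrow> w \<le> z + C * measure lborel (\<Omega> - Z)"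
    using \<Omega> unfolding inward_minimizing_def by blast
  obtain c d where cd: "per K (F - \<Omega>) \<le> ereal c" "per (uminus ` K) (\<Omega> - F) \<le> ereal d" "c + d \<le> a + w"
    using per_Diff[OF K F w(1,2)] by blast
  have "w \<le> d + C * measure lborel (\<Omega> - (\<Omega> - F))"
    using F(1) w(1) by (intro w(3) cd(2) fmeasurable_lborel_borel) auto
  moreover have "\<Omega> - (\<Omega> - F) = \<Omega> \<inter> F" by auto
  ultimately have "c \<le> a + C * measure lborel (\<Omega> \<inter> F)" using cd(3) by simp
  thus ?thesis using cd(1) by (meson ereal_less_eq(3) order_trans)
qed

text \<open>Left-invariance reduces the comparison of the translates by \<open>x\<close> and \<open>y\<close> to a translation by the small
  element \<open>mul (- x) y\<close>.\<close>

lemma continuous_on_measure_translate_Int: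
  assumes \<Omega>: "\<Omega> \<in> fmeasurable lborel" and F: "F \<in> fmeasurable lborel"
  shows "continuous_on UNIV (\<lambda>x. measure lborel (translate x \<Omega> \<inter> F))"
  unfolding continuous_on_iff
proof (intro ballI allI impI)
  fix x :: 'a and e :: real assume e: "0 < e"
  obtain \<delta> where \<delta>: "0 < \<delta>" "\<And>y. norm y < \<delta> \<Longrightarrow> measure lborel (sym_diff \<Omega> (translate y \<Omega>)) < e"
    using measure_sym_diff_translate_small[OF \<Omega> e] by blast
  have "isCont (mul (- x)) x" by (rule has_C1_derivativeD(4)[OF has_C1_derivative_left_translation])
  then obtain \<eta> where \<eta>: "0 < \<eta>" "\<And>y. dist y x < \<eta> \<Longrightarrow> dist (mul (- x) y) (mul (- x) x) < \<delta>"
    using \<delta>(1) unfolding continuous_at_eps_delta by blast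
  show "\<exists>d>0. \<forall>y\<in>UNIV. dist y x < d \<longrightarrow>
      dist (measure lborel (translate y \<Omega> \<inter> F)) (measure lborel (translate x \<Omega> \<inter> F)) < e"
  proof (intro exI[of _ \<eta>] conjI ballI impI \<eta>(1))
    fix y assume y: "dist y x < \<eta>"
    let ?S = "sym_diff (translate x \<Omega>) (translate y \<Omega>)"
    note fm = fmeasurable_translate(1)[OF \<Omega>]
    have S: "?S = translate x (sym_diff \<Omega> (translate (mul (- x) y) \<Omega>))"
      by (auto simp: translate_def mul_assoc uminus_mul)
    have "sym_diff \<Omega> (translate (mul (- x) y) \<Omega>) \<in> fmeasurable lborel"
      using \<Omega> fm by (auto intro!: fmeasurable.Un)
    from fmeasurable_translate[OF this, of x]
    have Sf: "?S \<in> fmeasurable lborel"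
      and "measure lborel ?S = measure lborel (sym_diff \<Omega> (translate (mul (- x) y) \<Omega>))"
      unfolding S .
    hence Se: "measure lborel ?S < e"
      using \<delta>(2)[of "mul (- x) y"] \<eta>(2)[OF y] by simp
    have le: "measure lborel (translate u \<Omega> \<inter> F) \<le> measure lborel (translate v \<Omega> \<inter> F) + measure lborel ?S"
      if "sym_diff (translate u \<Omega>) (translate v \<Omega>) = ?S" for u v
    proof -
      have fi: "translate u \<Omega> \<inter> F \<in> fmeasurable lborel" for u
        using fm F by (intro fmeasurable_Int_fmeasurable) auto
      have "measure lborel (translate u \<Omega> \<inter> F) \<le> measure lborel ((translate v \<Omega> \<inter> F) \<union> ?S)"
      proof (rule measure_mono_fmeasurable[OF _ fmeasurableD[OF fi] fmeasurable.Un[OF fi Sf]])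
        show "translate u \<Omega> \<inter> F \<subseteq> (translate v \<Omega> \<inter> F) \<union> ?S" using that by blast
      qed
      also have "\<dots> \<le> measure lborel (translate v \<Omega> \<inter> F) + measure lborel ?S"
        by (rule measure_Un_le[OF fmeasurableD[OF fi] fmeasurableD[OF Sf]])
      finally show ?thesis .
    qed
    show "dist (measure lborel (translate y \<Omega> \<inter> F)) (measure lborel (translate x \<Omega> \<inter> F)) < e"
      using le[of x y] le[of y x] Se by (auto simp: dist_real_def Un_commute)
  qed
qed

text \<open>The points \<open>x\<close> whose translate meets the ball form a bounded set.\<close>

lemma translate_disjoint_ball:
  assumes "bounded \<Omega>"
  obtains x where "translate x \<Omega> \<inter> cball 0 R = {}"
proof -
  define B where "B = (\<lambda>z. mul (fst z) (snd z)) ` (cball 0 R \<times> uminus ` closure \<Omega>)"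
  have "compact B"
    unfolding B_def
    using assms by (intro compact_continuous_image has_C1_derivativeD(3)[OF C1_mul] compact_Times
        compact_negations) auto
  hence "bounded B" by (rule compact_imp_bounded)
  then obtain b where b: "\<And>z. z \<in> B \<Longrightarrow> norm z \<le> b" unfolding bounded_iff by blast
  obtain x :: 'a where x: "norm x = max 0 (b + 1)" using vector_choose_size[of "max 0 (b + 1)"] by auto
  have "y \<notin> translate x \<Omega>" if y: "norm y \<le> R" for y
  proof
    assume "y \<in> translate x \<Omega>"
    hence "mul (- x) y \<in> closure \<Omega>" using closure_subset[of \<Omega>] by (auto simp: translate_def)
    moreover have "x = mul y (- mul (- x) y)" by (simp add: uminus_mul)
    ultimately have "x \<in> B"
      unfolding B_def using y by (intro image_eqI[of _ _ "(y, - mul (- x) y)"]) auto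
    thus False using b[of x] x by simp
  qed
  thus thesis by (intro that[of x]) (auto simp: disjoint_iff)
qed

text \<open>Moving \<open>x\<close> from the identity, where \<open>\<Omega>\<close> lies in \<open>F\<close> up to a null set, to a point where \<open>x \<Omega>\<close> nearly leaves the
  set \<open>F\<close> of finite measure, every intermediate overlap occurs.\<close>

lemma translate_overlap_attained:
  assumes \<Omega>: "\<Omega> \<in> fmeasurable lborel" "bounded \<Omega>" and F: "F \<in> fmeasurable lborel"
    and in_F: "measure lborel (\<Omega> - F) = 0" and v: "v \<le> measure lborel \<Omega>" "0 < v \<or> bounded F \<and> v = 0"
  obtains x where "measure lborel (translate x \<Omega> \<inter> F) = v"
proof -
  let ?f = "\<lambda>x. measure lborel (translate x \<Omega> \<inter> F)"
  have "\<exists>x. ?f x \<le> v"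
  proof (cases "bounded F")
    case True
    then obtain R where R: "\<And>x. x \<in> F \<Longrightarrow> norm x \<le> R" unfolding bounded_iff by blast
    obtain x where "translate x \<Omega> \<inter> cball 0 R = {}" using translate_disjoint_ball[OF \<Omega>(2)] .
    hence "translate x \<Omega> \<inter> F = {}" using R by fastforce
    hence "?f x = 0" by simp
    thus ?thesis using v(2) by (metis less_imp_le order_refl)
  next
    case False
    obtain R where R: "measure lborel (F - cball 0 R) < v" using finite_measure_tail[OF F] v(2) False by blast
    obtain x where x: "translate x \<Omega> \<inter> cball 0 R = {}" using translate_disjoint_ball[OF \<Omega>(2)] .
    have "?f x \<le> measure lborel (F - cball 0 R)"
      using x F fmeasurable_translate(1)[OF \<Omega>(1), of x]
      by (intro measure_mono_fmeasurable fmeasurable_Diff) auto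
    thus ?thesis using R by (intro exI[of _ x]) simp
  qed
  then obtain x1 where x1: "?f x1 \<le> v" by blast
  have "measure lborel \<Omega> = measure lborel (\<Omega> \<inter> F) + measure lborel (\<Omega> - F)"
    using \<Omega> F by (intro measure_Int_Diff_lborel)
  hence x0: "v \<le> ?f 0" using v(1) in_F by simp
  have "connected (?f ` UNIV)"
    by (rule connected_continuous_image[OF continuous_on_measure_translate_Int[OF \<Omega>(1) F]])
       (rule connected_UNIV)
  hence "{?f x1..?f 0} \<subseteq> ?f ` UNIV" by (rule connected_contains_Icc) (rule rangeI)+
  hence "v \<in> ?f ` UNIV" using x0 x1 by auto
  thus thesis using that by blast
qed

lemma grow_once:
  assumes K: "convex_body_at_0 K" and F: "F \<in> fmeasurable lborel" "per K F \<le> ereal a"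
    and \<Omega>: "inward_minimizing K C \<Omega>" "bounded \<Omega>" "measure lborel (\<Omega> - F) = 0"
    and l: "0 \<le> l" "l < measure lborel \<Omega> \<or> bounded F \<and> l = measure lborel \<Omega>"
  obtains x where "measure lborel (F \<union> translate x \<Omega>) = measure lborel F + l"
    "per K (F \<union> translate x \<Omega>) \<le> ereal (a + C * l)"
proof -
  have \<Omega>f: "\<Omega> \<in> fmeasurable lborel" using \<Omega>(1) by (auto simp: inward_minimizing_def)
  obtain x where x: "measure lborel (translate x \<Omega> \<inter> F) = measure lborel \<Omega> - l"
    by (rule translate_overlap_attained[OF \<Omega>f \<Omega>(2) F(1) \<Omega>(3), of "measure lborel \<Omega> - l"]) (use l in auto)
  note fx = fmeasurable_translate[OF \<Omega>f, of x]
  have "measure lborel (translate x \<Omega>)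
      = measure lborel (translate x \<Omega> \<inter> F) + measure lborel (translate x \<Omega> - F)"
    using fx F by (intro measure_Int_Diff_lborel)
  hence d: "measure lborel (translate x \<Omega> - F) = l" using x fx by simp
  have "measure lborel (F \<union> translate x \<Omega>) = measure lborel F + measure lborel (translate x \<Omega> - F)"
    using F fx by (intro measure_Un2)
  with d show thesis
    using per_Un_inward_minimizing[OF K F inward_minimizing_translate[OF \<Omega>(1), of x]]
    by (intro that) auto
qed

lemma shrink_once:
  assumes K: "convex_body_at_0 K" and F: "F \<in> fmeasurable lborel" "per K F \<le> ereal a"
    and \<Omega>: "inward_minimizing (uminus ` K) C \<Omega>" "bounded \<Omega>" "measure lborel (\<Omega> - F) = 0"
    and l: "0 < l" "l \<le> measure lborel \<Omega>"
  obtains x where "measure lborel (F - translate x \<Omega>) = measure lborel F - l"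
    "per K (F - translate x \<Omega>) \<le> ereal (a + C * l)"
proof -
  have \<Omega>f: "\<Omega> \<in> fmeasurable lborel" using \<Omega>(1) by (auto simp: inward_minimizing_def)
  obtain x where x: "measure lborel (translate x \<Omega> \<inter> F) = l"
    by (rule translate_overlap_attained[OF \<Omega>f \<Omega>(2) F(1) \<Omega>(3), of l]) (use l in auto)
  note fx = fmeasurable_translate[OF \<Omega>f, of x]
  have "measure lborel F = measure lborel (F \<inter> translate x \<Omega>) + measure lborel (F - translate x \<Omega>)"
    using fx F by (intro measure_Int_Diff_lborel)
  hence "measure lborel (F - translate x \<Omega>) = measure lborel F - l" using x by (simp add: Int_commute)
  with x show thesis
    using per_Diff_inward_minimizing[OF K F inward_minimizing_translate[OF \<Omega>(1), of x]]
    by (intro that) auto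
qed

text \<open>Each step adds a translate of \<open>\<Omega>\<close>, which gains any volume up to that of \<open>\<Omega>\<close> and keeps the set bounded;
  \<open>n\<close> steps suffice for \<open>n\<close> times the volume of \<open>\<Omega>\<close>.\<close>

lemma grow_bounded:
  assumes K: "convex_body_at_0 K" and \<Omega>: "inward_minimizing K C \<Omega>" "bounded \<Omega>"
    and F: "F \<in> fmeasurable lborel" "per K F \<le> ereal a" "bounded F" "measure lborel (\<Omega> - F) = 0"
    and l: "0 \<le> l" "l \<le> real n * measure lborel \<Omega>"
  shows "\<exists>G. G \<in> fmeasurable lborel \<and> measure lborel G = measure lborel F + l \<and> per K G \<le> ereal (a + C * l)"
  using F l
proof (induction n arbitrary: F a l)
  case 0
  thus ?case by (intro exI[of _ F]) auto
next
  case (Suc n)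
  define l1 where "l1 = min l (measure lborel \<Omega>)"
  have l1: "0 \<le> l1" "l1 \<le> l" "l1 \<le> measure lborel \<Omega>" "l - l1 \<le> real n * measure lborel \<Omega>"
    using Suc.prems(5,6) by (auto simp: l1_def min_def algebra_simps)
  have \<Omega>f: "\<Omega> \<in> fmeasurable lborel" using \<Omega>(1) by (auto simp: inward_minimizing_def)
  obtain x where x: "measure lborel (F \<union> translate x \<Omega>) = measure lborel F + l1"
    "per K (F \<union> translate x \<Omega>) \<le> ereal (a + C * l1)"
    by (rule grow_once[OF K Suc.prems(1,2) \<Omega> Suc.prems(4) l1(1)]) (use l1(3) Suc.prems(3) in auto)
  let ?G = "F \<union> translate x \<Omega>"
  have Gf: "?G \<in> fmeasurable lborel" using Suc.prems(1) fmeasurable_translate[OF \<Omega>f] by (intro fmeasurable.Un)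
  have "bounded (translate x \<Omega>)"
  proof -
    have "translate x \<Omega> \<subseteq> mul x ` closure \<Omega>"
      using closure_subset[of \<Omega>] by (auto simp: translate_def intro!: image_eqI[of _ "mul x" "mul (- x) _"])
    moreover have "bounded (mul x ` closure \<Omega>)"
      using \<Omega>(2) by (intro compact_imp_bounded compact_continuous_image
          has_C1_derivativeD(3)[OF has_C1_derivative_left_translation]) auto
    ultimately show ?thesis by (rule bounded_subset[rotated])
  qed
  hence Gb: "bounded ?G" using Suc.prems(3) by simp
  have "measure lborel (\<Omega> - ?G) \<le> measure lborel (\<Omega> - F)"
    using \<Omega>f Suc.prems(1) Gf by (intro measure_mono_fmeasurable fmeasurable_Diff sets.Diff) auto
  hence G0: "measure lborel (\<Omega> - ?G) = 0" using Suc.prems(4) measure_nonneg[of lborel "\<Omega> - ?G"] by simp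
  obtain G where "G \<in> fmeasurable lborel" "measure lborel G = measure lborel ?G + (l - l1)"
    "per K G \<le> ereal ((a + C * l1) + C * (l - l1))"
    using Suc.IH[OF Gf x(2) Gb G0 _ l1(4)] l1(2) by auto
  thus ?case using x(1) by (intro exI[of _ G]) (auto simp: algebra_simps)
qed

lemma bounded_inward_minimizing_exists:
  assumes K: "convex_body_at_0 K" and F: "F \<in> fmeasurable lborel" and \<rho>: "0 < \<rho>"
    and ball: "measure lborel (ball p \<rho> - F) = 0"
  obtains C \<Omega> where "0 < C" "inward_minimizing K C \<Omega>" "bounded \<Omega>" "0 < measure lborel \<Omega>"
    "measure lborel (\<Omega> - F) = 0"
proof -
  have bf: "ball p \<rho> \<in> fmeasurable lborel" by (rule fmeasurable_bounded) auto
  obtain c where "per K (ball p \<rho>) \<le> ereal c" using per_ball_finite[OF K \<rho>] by blast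
  moreover have "0 < measure lborel (ball p \<rho>)" using \<rho> by (rule content_ball_pos)
  ultimately obtain C \<Omega> where \<Omega>: "0 < C" "\<Omega> \<subseteq> ball p \<rho>" "0 < measure lborel \<Omega>" "inward_minimizing K C \<Omega>"
    using inward_minimizing_subset_exists[OF K bf] by blast
  have "\<Omega> \<in> fmeasurable lborel" using \<Omega>(4) by (auto simp: inward_minimizing_def)
  hence "measure lborel (\<Omega> - F) \<le> measure lborel (ball p \<rho> - F)"
    using \<Omega>(2) F bf by (intro measure_mono_fmeasurable fmeasurable_Diff sets.Diff) auto
  hence "measure lborel (\<Omega> - F) = 0" using ball measure_nonneg[of lborel "\<Omega> - F"] by simp
  thus thesis using \<Omega> bounded_subset[OF bounded_ball \<Omega>(2)] by (intro that[of C \<Omega>]) auto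
qed

text \<open>The body \<open>K\<close> governs the sets that are added to \<open>F\<close>, its reflection those that are removed.\<close>

theorem volume_deformation:
  assumes K: "convex_body_at_0 K" and F: "F \<in> fmeasurable lborel" "per K F \<le> ereal a"
    and \<rho>: "0 < \<rho>" "measure lborel (ball p \<rho> - F) = 0"
  shows "\<exists>C (m::real) (M::ereal). 0 < C \<and> 0 < m \<and> 0 < M \<and> (bounded F \<longrightarrow> M = \<infinity>) \<and>
    (\<forall>l::real. - m < l \<and> ereal l < M \<longrightarrow>
      (\<exists>G. G \<in> fmeasurable lborel \<and> measure lborel G = measure lborel F + l \<and> per K G \<le> ereal (a + C * \<bar>l\<bar>)))"
proof -
  obtain C1 \<Omega>1 where \<Omega>1: "0 < C1" "inward_minimizing K C1 \<Omega>1" "bounded \<Omega>1" "0 < measure lborel \<Omega>1"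
    "measure lborel (\<Omega>1 - F) = 0"
    using bounded_inward_minimizing_exists[OF K F(1) \<rho>] by blast
  obtain C2 \<Omega>2 where \<Omega>2: "0 < C2" "inward_minimizing (uminus ` K) C2 \<Omega>2" "bounded \<Omega>2" "0 < measure lborel \<Omega>2"
    "measure lborel (\<Omega>2 - F) = 0"
    using bounded_inward_minimizing_exists[OF convex_body_at_0_uminus[OF K] F(1) \<rho>] by blast
  define C where "C = max C1 C2"
  define M where "M = (if bounded F then \<infinity> else ereal (measure lborel \<Omega>1))"
  have "\<exists>G. G \<in> fmeasurable lborel \<and> measure lborel G = measure lborel F + l \<and> per K G \<le> ereal (a + C * \<bar>l\<bar>)"
    if l: "- measure lborel \<Omega>2 < l" "ereal l < M" for l
  proof (cases "0 \<le> l")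
    case True
    have *: "ereal (a + C1 * l) \<le> ereal (a + C * \<bar>l\<bar>)"
      using True by (simp add: C_def mult_right_mono)
    have "\<exists>G. G \<in> fmeasurable lborel \<and> measure lborel G = measure lborel F + l \<and> per K G \<le> ereal (a + C1 * l)"
    proof (cases "bounded F")
      case bF: True
      obtain n :: nat where "l / measure lborel \<Omega>1 \<le> real n" using real_arch_simple by blast
      hence "l \<le> real n * measure lborel \<Omega>1" using \<Omega>1(4) by (simp add: pos_divide_le_eq)
      from grow_bounded[OF K \<Omega>1(2,3) F bF \<Omega>1(5) True this] show ?thesis .
    next
      case False
      hence "l < measure lborel \<Omega>1" using l(2) by (simp add: M_def)
      then obtain x where x: "measure lborel (F \<union> translate x \<Omega>1) = measure lborel F + l"
        "per K (F \<union> translate x \<Omega>1) \<le> ereal (a + C1 * l)"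
        using grow_once[OF K F \<Omega>1(2,3,5) True] by blast
      have "\<Omega>1 \<in> fmeasurable lborel" using \<Omega>1(2) by (auto simp: inward_minimizing_def)
      hence "F \<union> translate x \<Omega>1 \<in> fmeasurable lborel" using F(1) fmeasurable_translate by (intro fmeasurable.Un)
      thus ?thesis using x by blast
    qed
    thus ?thesis using * by (meson order_trans)
  next
    case False
    hence l': "0 < - l" "- l \<le> measure lborel \<Omega>2" using l(1) by auto
    obtain x where x: "measure lborel (F - translate x \<Omega>2) = measure lborel F - (- l)"
      "per K (F - translate x \<Omega>2) \<le> ereal (a + C2 * (- l))"
      using shrink_once[OF K F \<Omega>2(2,3,5) l'] by blast
    have "\<Omega>2 \<in> fmeasurable lborel" using \<Omega>2(2) by (auto simp: inward_minimizing_def)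
    hence "translate x \<Omega>2 \<in> sets lborel" using fmeasurable_translate by blast
    hence "F - translate x \<Omega>2 \<in> fmeasurable lborel" using F(1) by (intro fmeasurable_Diff)
    moreover have "ereal (a + C2 * (- l)) \<le> ereal (a + C * \<bar>l\<bar>)"
      using False mult_right_mono[of C2 C "- l"] by (simp add: C_def)
    ultimately show ?thesis using x by (intro exI[of _ "F - translate x \<Omega>2"]) (auto intro: order_trans)
  qed
  moreover have "0 < M" using \<Omega>1(4) by (simp add: M_def zero_ereal_def)
  ultimately show ?thesis
    using \<Omega>1(1,4) \<Omega>2(4) by (intro exI[of _ C] exI[of _ "measure lborel \<Omega>2"] exI[of _ M]) (auto simp: C_def M_def)
qed

end

section \<open>Sub-Finsler perimeter as a perimeter of translated convex bodies\<close>

lemma horizontal_iff: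
  "u \<in> horizontal k X p \<longleftrightarrow> (\<exists>a. u = (\<Sum>i=1..k. a i *\<^sub>R X i p))"
proof
  let ?T = "{u. \<exists>a. u = (\<Sum>i=1..k. a i *\<^sub>R X i p)}"
  have "subspace ?T"
    unfolding subspace_def
  proof (intro conjI ballI allI)
    show "0 \<in> ?T" by (auto intro!: exI[of _ "\<lambda>_. 0"])
    fix x y assume "x \<in> ?T" "y \<in> ?T"
    then obtain a b where "x = (\<Sum>i=1..k. a i *\<^sub>R X i p)" "y = (\<Sum>i=1..k. b i *\<^sub>R X i p)" by blast
    thus "x + y \<in> ?T"
      by (auto simp: sum.distrib[symmetric] scaleR_add_left[symmetric] intro!: exI[of _ "\<lambda>i. a i + b i"])
  next
    fix c x assume "x \<in> ?T"
    then obtain a where "x = (\<Sum>i=1..k. a i *\<^sub>R X i p)" by blast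
    thus "c *\<^sub>R x \<in> ?T" by (auto simp: scaleR_sum_right intro!: exI[of _ "\<lambda>i. c * a i"])
  qed
  moreover have "{X i p | i. i \<in> {1..k}} \<subseteq> ?T"
  proof clarify
    fix i assume i: "i \<in> {1..k}"
    have "X i p = (\<Sum>l=1..k. (if l = i then 1 else 0) *\<^sub>R X l p)"
      using i by (simp add: if_distrib[where f = "\<lambda>c. c *\<^sub>R _"] cong: if_cong)
    thus "\<exists>a. X i p = (\<Sum>l=1..k. a l *\<^sub>R X l p)" by (rule exI[of _ "\<lambda>l. if l = i then 1 else 0"])
  qed
  ultimately have "horizontal k X p \<subseteq> ?T" unfolding horizontal_def by (intro span_minimal)
  thus "u \<in> horizontal k X p \<Longrightarrow> \<exists>a. u = (\<Sum>i=1..k. a i *\<^sub>R X i p)" by blast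
next
  assume "\<exists>a. u = (\<Sum>i=1..k. a i *\<^sub>R X i p)"
  then obtain a where u: "u = (\<Sum>i=1..k. a i *\<^sub>R X i p)" by blast
  show "u \<in> horizontal k X p"
    unfolding horizontal_def u by (intro span_sum span_scale, rule span_base, blast)
qed

text \<open>A gauge of at most \<open>1\<close> puts every \<open>w / (1 + 1 / n)\<close> into the star-shaped set \<open>K\<close>; let \<open>n\<close> tend to infinity.
  The assumption on \<open>w\<close> excludes the infimum of the empty set.\<close>

lemma gauge_norm_le_1_iff:
  fixes K :: "'a::euclidean_space set"
  assumes K: "compact K" "convex K" "0 \<in> K" and w: "\<exists>l>0. w \<in> (\<lambda>x. l *\<^sub>R x) ` K"
  shows "gauge_norm K w \<le> 1 \<longleftrightarrow> w \<in> K"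
proof
  let ?S = "{l. 0 \<le> l \<and> w \<in> (\<lambda>x. l *\<^sub>R x) ` K}"
  have bdd: "bdd_below ?S" by (rule bdd_belowI[of _ 0]) auto
  show "w \<in> K \<Longrightarrow> gauge_norm K w \<le> 1"
    unfolding gauge_norm_def by (rule cInf_lower[OF _ bdd]) (auto intro!: image_eqI[of _ _ w])
  assume le: "gauge_norm K w \<le> 1"
  have "?S \<noteq> {}" using w by (auto intro: less_imp_le)
  have "inverse (1 + inverse (real (Suc n))) *\<^sub>R w \<in> K" for n
  proof -
    let ?e = "1 + inverse (real (Suc n))"
    have e: "1 < ?e" by simp
    have "Inf ?S < ?e" using le e unfolding gauge_norm_def by linarith
    then obtain l where l: "l \<in> ?S" "l < ?e" using cInf_lessD[OF \<open>?S \<noteq> {}\<close>] by blast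
    then obtain x where x: "x \<in> K" "w = l *\<^sub>R x" by auto
    have "(1 - l / ?e) *\<^sub>R 0 + (l / ?e) *\<^sub>R x \<in> K"
      using l e by (intro convexD[OF K(2)] K(3) x(1)) (auto simp: divide_le_eq)
    moreover have "inverse ?e *\<^sub>R w = (l / ?e) *\<^sub>R x" using x by (simp add: divide_inverse mult.commute)
    ultimately show ?thesis by simp
  qed
  moreover have "(\<lambda>n. inverse (1 + inverse (real (Suc n))) *\<^sub>R w) \<longlonglongrightarrow> inverse (1 + 0) *\<^sub>R w"
    by (intro tendsto_intros LIMSEQ_inverse_real_of_nat) simp
  ultimately have "inverse (1 + 0) *\<^sub>R w \<in> K"
    by (rule closed_sequentially[OF compact_imp_closed[OF K(1)]])
  thus "w \<in> K" by simp
qed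

locale sub_finsler_C2_group = sub_finsler_nilpotent_group mul r k X V g K + nilpotent_C2_group mul r dmul ddmul
  for mul :: "(real, 'd::{finite,linorder}) vec \<Rightarrow> (real, 'd) vec \<Rightarrow> (real, 'd) vec" and r k X V g K dmul ddmul
begin

sublocale haar_C2_group mul dmul ddmul
  by unfold_locales (rule lborel_left_translation)

lemma X_eq: "i \<in> {1..k} \<Longrightarrow> X i p = dL p 0 (X i 0)"
  using X_left_invariant[of i] unfolding left_invariant_def left_diff_eq by (metis mul_0_right)

lemma sum_X_eq: "(\<Sum>i=1..k. a i *\<^sub>R X i p) = dL p 0 (\<Sum>i=1..k. a i *\<^sub>R X i 0)"
  unfolding blinfun.sum_right blinfun.scaleR_right
  by (intro sum.cong refl arg_cong2[where f = scaleR] X_eq)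

lemma to_origin_eq:
  assumes "w \<in> horizontal k X 0"
  shows "to_origin k X p (dL p 0 w) = w"
  unfolding to_origin_def
proof (rule the_equality)
  obtain a where w: "w = (\<Sum>i=1..k. a i *\<^sub>R X i 0)" using assms unfolding horizontal_iff by blast
  have "dL p 0 w = (\<Sum>i=1..k. a i *\<^sub>R X i p)" unfolding w by (rule sum_X_eq[symmetric])
  with w show "\<exists>a. dL p 0 w = (\<Sum>i=1..k. a i *\<^sub>R X i p) \<and> w = (\<Sum>i=1..k. a i *\<^sub>R X i 0)" by blast
  fix w' assume "\<exists>a. dL p 0 w = (\<Sum>i=1..k. a i *\<^sub>R X i p) \<and> w' = (\<Sum>i=1..k. a i *\<^sub>R X i 0)"
  then obtain b where b: "dL p 0 w = (\<Sum>i=1..k. b i *\<^sub>R X i p)" "w' = (\<Sum>i=1..k. b i *\<^sub>R X i 0)" by blast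
  have "dL p 0 w = dL p 0 w'" unfolding b by (rule sum_X_eq)
  thus "w' = w" by (metis dL_inverse_0(1))
qed

lemma zero_in_K: "0 \<in> K"
  using K_interior interior_of_subset by fastforce

lemma convex_body_K: "convex_body_at_0 K"
  using K_convex_body zero_in_K by (simp add: convex_body_at_0_def)

text \<open>A small multiple of \<open>w\<close> lies in the relative neighbourhood of \<open>0\<close> that \<open>K\<close> contains.\<close>

lemma K_absorbing:
  assumes w: "w \<in> horizontal k X 0"
  shows "\<exists>l>0. w \<in> (\<lambda>x. l *\<^sub>R x) ` K"
proof -
  obtain T where T: "openin (top_of_set (horizontal k X 0)) T" "0 \<in> T" "T \<subseteq> K"
    using K_interior unfolding interior_of_def by blast
  then obtain O' where O': "open O'" "T = horizontal k X 0 \<inter> O'" by (auto simp: openin_open)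
  then obtain e where e: "0 < e" "ball 0 e \<subseteq> O'" using T(2) open_contains_ball by blast
  define t where "t = e / (norm w + 1)"
  have nw: "0 < norm w + 1" by (simp add: add_nonneg_pos)
  have t: "0 < t" using e nw by (simp add: t_def)
  have "norm (t *\<^sub>R w) < e"
  proof -
    have "e * norm w < e * (norm w + 1)" using e by simp
    thus ?thesis using e nw by (simp add: t_def pos_divide_less_eq)
  qed
  hence "t *\<^sub>R w \<in> O'" using e(2) by (auto simp: subset_eq)
  moreover have "t *\<^sub>R w \<in> horizontal k X 0" using w by (simp add: horizontal_def span_scale)
  ultimately have "t *\<^sub>R w \<in> K" using O' T by blast
  moreover have "w = inverse t *\<^sub>R (t *\<^sub>R w)" using t by simp
  ultimately show ?thesis
    using t by (intro exI[of _ "inverse t"] conjI image_eqI[of _ _ "t *\<^sub>R w"]) auto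
qed

lemma admissible_fields_eq: "admissible_fields k X K = fields K"
proof -
  have "(U p \<in> horizontal k X p \<and> K_norm k X K p (U p) \<le> 1) \<longleftrightarrow> U p \<in> dL p 0 ` K" for U p
  proof
    assume U: "U p \<in> horizontal k X p \<and> K_norm k X K p (U p) \<le> 1"
    then obtain a where a: "U p = (\<Sum>i=1..k. a i *\<^sub>R X i p)" by (auto simp: horizontal_iff)
    define w where "w = (\<Sum>i=1..k. a i *\<^sub>R X i 0)"
    have w: "w \<in> horizontal k X 0" unfolding horizontal_iff w_def by blast
    have Uw: "U p = dL p 0 w" unfolding a w_def by (rule sum_X_eq)
    have "gauge_norm K w \<le> 1" using U to_origin_eq[OF w] by (simp add: K_norm_def Uw)
    hence "w \<in> K" using gauge_norm_le_1_iff[OF K_convex_body zero_in_K K_absorbing[OF w]] by simp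
    thus "U p \<in> dL p 0 ` K" using Uw by blast
  next
    assume "U p \<in> dL p 0 ` K"
    then obtain w where w: "w \<in> K" "U p = dL p 0 w" by blast
    hence wh: "w \<in> horizontal k X 0" using K_horizontal by blast
    have "gauge_norm K w \<le> 1"
      using gauge_norm_le_1_iff[OF K_convex_body zero_in_K K_absorbing[OF wh]] w by simp
    hence "K_norm k X K p (U p) \<le> 1" using to_origin_eq[OF wh] by (simp add: K_norm_def w)
    moreover obtain a where a: "w = (\<Sum>i=1..k. a i *\<^sub>R X i 0)" using wh unfolding horizontal_iff by blast
    have "U p = (\<Sum>i=1..k. a i *\<^sub>R X i p)" unfolding w(2) a by (rule sum_X_eq[symmetric])
    hence "U p \<in> horizontal k X p" unfolding horizontal_iff by blast
    ultimately show "U p \<in> horizontal k X p \<and> K_norm k X K p (U p) \<le> 1" by simp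
  qed
  hence "(\<forall>p. U p \<in> horizontal k X p) \<and> (\<forall>p. K_norm k X K p (U p) \<le> 1) \<longleftrightarrow> (\<forall>p. U p \<in> dL p 0 ` K)" for U
    by blast
  thus ?thesis
    unfolding admissible_fields_def fields_def C1_compact_def C_k_1_iff compact_closure by blast
qed

lemma riem_div_eq_divergence:
  assumes "has_C1_derivative U U'"
  shows "riem_div g U = divergence U"
  using riem_div_eq[OF g_inner_product g_left_invariant has_C1_derivativeD(1)[OF assms, of _ UNIV]]
  by (intro ext) (simp add: divergence_eq[OF assms])

text \<open>The perimeter only sees the set up to null sets, so it may be computed on a Borel representative.\<close>

lemma perimeter_eq_per:
  assumes E: "E \<in> sets lebesgue" and B: "B \<in> sets borel" and eq: "AE x in lebesgue. x \<in> E \<longleftrightarrow> x \<in> B"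
  shows "perimeter k X g K E = per K B"
proof -
  have "set_lebesgue_integral lebesgue E (riem_div g U) = pairing (indicator B) U"
    if U: "U \<in> fields K" for U
  proof -
    obtain U' where U': "has_C1_derivative U U'" using C1_compactD(1)[OF fieldsD(1)[OF U]] by blast
    have m: "divergence U \<in> borel_measurable borel"
      by (rule borel_measurable_continuous_onI[OF continuous_on_divergence[OF U']])
    have mB: "(\<lambda>x. indicator B x * divergence U x) \<in> borel_measurable lborel"
      using m B by (intro borel_measurable_times borel_measurable_indicator) auto
    have ml: "divergence U \<in> borel_measurable lebesgue"
      using m by (intro measurable_completion) simp
    have "set_lebesgue_integral lebesgue E (riem_div g U) = integral\<^sup>L lebesgue (\<lambda>x. indicator E x * divergence U x)"
      by (simp add: set_lebesgue_integral_def riem_div_eq_divergence[OF U'])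
    also have "\<dots> = integral\<^sup>L lebesgue (\<lambda>x. indicator B x * divergence U x)"
    proof (rule integral_cong_AE)
      show "(\<lambda>x. indicator E x * divergence U x) \<in> borel_measurable lebesgue"
        using ml E by (intro borel_measurable_times borel_measurable_indicator)
      show "(\<lambda>x. indicator B x * divergence U x) \<in> borel_measurable lebesgue"
        using mB by (rule measurable_completion)
      show "AE x in lebesgue. indicator E x * divergence U x = indicator B x * divergence U x"
        using eq by eventually_elim (auto simp: indicator_def)
    qed
    also have "\<dots> = pairing (indicator B) U"
      unfolding pairing_def by (rule integral_completion[OF mB])
    finally show ?thesis .
  qed
  thus ?thesis
    unfolding perimeter_def per_def admissible_fields_eq by (intro SUP_cong) auto
qed

lemma perimeter_borel: "B \<in> sets borel \<Longrightarrow> perimeter k X g K B = per K B"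
  by (rule perimeter_eq_per) (auto intro: sets_completionI_sets)

lemma deformation_family:
  assumes F: "finite_perimeter k X g K F" "emeasure lebesgue F < \<infinity>" and p: "p \<in> interior F"
  shows "\<exists>(C::real) (m::real) (M::ereal). 0 < C \<and> 0 < m \<and> 0 < M \<and> (bounded F \<longrightarrow> M = \<infinity>) \<and>
    (\<forall>l::real. - m < l \<and> ereal l < M \<longrightarrow> (\<exists>G. finite_perimeter k X g K G \<and> emeasure lebesgue G < \<infinity> \<and>
       measure lebesgue G = measure lebesgue F + l \<and>
       perimeter k X g K G - perimeter k X g K F \<le> ereal (C * \<bar>l\<bar>)))"
proof -
  have Fl: "F \<in> sets lebesgue" using F(1) by (simp add: finite_perimeter_def)
  obtain B N where BN: "B \<in> sets borel" "N \<in> null_sets lebesgue" "B \<union> N = F"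
    using sets_lebesgue_almost_borel[OF Fl] unfolding negligible_iff_null_sets by metis
  have AE: "AE x in lebesgue. x \<in> F \<longleftrightarrow> x \<in> B"
    using AE_not_in[OF BN(2)] by eventually_elim (use BN(3) in auto)
  have Bl: "B \<in> sets lebesgue" using BN(1) by (auto intro: sets_completionI_sets)
  have perF: "perimeter k X g K F = per K B" by (rule perimeter_eq_per[OF Fl BN(1) AE])
  have emF: "emeasure lebesgue F = emeasure lborel B"
  proof -
    have "emeasure lebesgue F = emeasure lebesgue B" by (rule emeasure_eq_AE[OF AE Fl Bl])
    thus ?thesis using BN(1) by simp
  qed
  have mF: "measure lebesgue F = measure lborel B" by (simp add: measure_def emF)
  have Bf: "B \<in> fmeasurable lborel" using BN(1) F(2) emF by (intro fmeasurableI) auto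
  have "per K B < \<infinity>" using F(1) perF by (simp add: finite_perimeter_def)
  then obtain c where "per K B \<le> ereal c" by (cases "per K B") (auto intro: that)
  hence a: "per K B = ereal (perimeter_real K B)" by (rule perimeter_real(1)[OF convex_body_K])
  obtain \<rho> where \<rho>: "0 < \<rho>" "ball p \<rho> \<subseteq> F" using p by (auto simp: mem_interior)
  have "ball p \<rho> - B \<in> null_sets lebesgue"
    by (rule null_sets_subset[OF BN(2)]) (use \<rho> BN Bl in auto)
  hence "emeasure lebesgue (ball p \<rho> - B) = 0" by auto
  hence "emeasure lborel (ball p \<rho> - B) = 0" using BN(1) by simp
  hence ball: "measure lborel (ball p \<rho> - B) = 0" by (simp add: measure_def)
  obtain C m M where CM: "0 < C" "0 < m" "0 < M" "bounded B \<longrightarrow> M = \<infinity>"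
    "\<And>l. - m < l \<and> ereal l < M \<Longrightarrow> \<exists>G. G \<in> fmeasurable lborel \<and> measure lborel G = measure lborel B + l \<and>
        per K G \<le> ereal (perimeter_real K B + C * \<bar>l\<bar>)"
    using volume_deformation[OF convex_body_K Bf eq_refl[OF a] \<rho>(1) ball] by blast
  have "\<exists>G. finite_perimeter k X g K G \<and> emeasure lebesgue G < \<infinity> \<and>
       measure lebesgue G = measure lebesgue F + l \<and>
       perimeter k X g K G - perimeter k X g K F \<le> ereal (C * \<bar>l\<bar>)"
    if l: "- m < l \<and> ereal l < M" for l
  proof -
    obtain G where G: "G \<in> fmeasurable lborel" "measure lborel G = measure lborel B + l"
      "per K G \<le> ereal (perimeter_real K B + C * \<bar>l\<bar>)"
      using CM(5)[OF l] by blast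
    have Gb: "G \<in> sets borel" using G(1) by auto
    have pG: "perimeter k X g K G = per K G" by (rule perimeter_borel[OF Gb])
    have eG: "emeasure lebesgue G = emeasure lborel G" using Gb by simp
    have "finite_perimeter k X g K G"
      using Gb G(3) pG by (auto simp: finite_perimeter_def intro: sets_completionI_sets le_less_trans)
    moreover have "emeasure lebesgue G < \<infinity>" using G(1) eG by (simp add: fmeasurable_def)
    moreover have "measure lebesgue G = measure lebesgue F + l" using G(2) mF by (simp add: measure_def eG)
    moreover have "perimeter k X g K G - perimeter k X g K F \<le> ereal (C * \<bar>l\<bar>)"
      using G(3) by (simp add: pG perF a ereal_minus_le add.commute)
    ultimately show ?thesis by blast
  qed
  moreover have "bounded F \<longrightarrow> M = \<infinity>" using CM(4) BN(3) by (metis bounded_Un)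
  ultimately show ?thesis using CM(1-3) by blast
qed

end

theorem lemma3p6:
  fixes mul :: "(real, 'd::{finite,linorder}) vec \<Rightarrow> (real, 'd) vec \<Rightarrow> (real, 'd) vec"
    and r k :: nat
    and X :: "nat \<Rightarrow> (real, 'd) vec \<Rightarrow> (real, 'd) vec"
    and V :: "(real, 'd) vec \<Rightarrow> (real, 'd) vec set"
    and g :: "(real, 'd) vec \<Rightarrow> (real, 'd) vec \<Rightarrow> (real, 'd) vec \<Rightarrow> real"
    and K F :: "(real, 'd) vec set"
    and p :: "(real, 'd) vec"
  assumes "sub_finsler_nilpotent_group mul r k X V g K"
    and "finite_perimeter k X g K F"
    and "emeasure lebesgue F < \<infinity>"
    and "p \<in> interior F"
  shows "\<exists>(C3::real) (lambda0::real) (lambda1::ereal) (Fam :: real \<Rightarrow> (real, 'd) vec set).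
    C3 > 0 \<and> lambda0 > 0 \<and> lambda1 > 0 \<and>
    (\<forall>l::real. - lambda0 < l \<and> ereal l < lambda1 \<longrightarrow>
       finite_perimeter k X g K (Fam l) \<and>
       emeasure lebesgue (Fam l) < \<infinity> \<and>
       measure lebesgue (Fam l) = measure lebesgue F + l \<and>
       perimeter k X g K (Fam l) - perimeter k X g K F \<le> ereal (C3 * \<bar>l\<bar>)) \<and>
    (bounded F \<longrightarrow> lambda1 = \<infinity>)"
  proof -
  interpret sub_finsler_nilpotent_group mul r k X V g K by fact
  obtain dmul ddmul where "nilpotent_C2_group mul r dmul ddmul"
    using nilpotent_group_imp_C2[OF nilpotent_group_axioms] by blast
  then interpret nilpotent_C2_group mul r dmul ddmul .
  interpret sub_finsler_C2_group mul r k X V g K dmul ddmul ..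
  obtain C m :: real and M :: ereal where C: "0 < C" "0 < m" "0 < M" "bounded F \<longrightarrow> M = \<infinity>"
    "\<forall>l::real. - m < l \<and> ereal l < M \<longrightarrow> (\<exists>G. finite_perimeter k X g K G \<and> emeasure lebesgue G < \<infinity> \<and>
       measure lebesgue G = measure lebesgue F + l \<and>
       perimeter k X g K G - perimeter k X g K F \<le> ereal (C * \<bar>l\<bar>))"
    using deformation_family[OF assms(2-4)] by blast
  then obtain Fam where "\<forall>l::real. - m < l \<and> ereal l < M \<longrightarrow>
      finite_perimeter k X g K (Fam l) \<and> emeasure lebesgue (Fam l) < \<infinity> \<and>
       measure lebesgue (Fam l) = measure lebesgue F + l \<and>
       perimeter k X g K (Fam l) - perimeter k X g K F \<le> ereal (C * \<bar>l\<bar>)"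
    by metis
  with C(1-4) show ?thesis by blast
qed

end
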